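(* Let $\varepsilon\in(0,1)$. For both the spherical codebook and the i.i.d. Gaussian codebook, $$\log M^*(n,\varepsilon,\sigma^2,D)=\frac n2\log\frac{\sigma^2}{D}+\sqrt{n\,\mathrm V(\sigma^2,\zeta)}\,\mathrm Q^{-1}(\varepsilon)+O(\log n)\quad (n\to\infty),$$ where $M^*$ denotes $M^*_{\rm sp}$ or $M^*_{\rm iid}$ respectively. Consequently $$L^*_{\rm sp}(\varepsilon)=L^*_{\rm iid}(\varepsilon)=\sqrt{\mathrm V(\sigma^2,\zeta)}\,\mathrm Q^{-1}(\varepsilon),$$ and in particular $\lim_{n\to\infty}\frac1n\log M^*_{\rm iid}(n,\varepsilon,\sigma^2,D)=\lim_{n\to\infty}\frac1n\log M^*_{\rm sp}(n,\varepsilon,\sigma^2,D)=\frac12\log\frac{\sigma^2}{D}$.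
   Context: Let $X$ be a real-valued random variable (the source) with $\sigma^2:=\mathsf E[X^2]$, $\zeta:=\mathsf E[X^4]<\infty$ and $\mathsf E[X^6]<\infty$, and let $X^n=(X_1,\dots,X_n)$ consist of i.i.d. copies of $X$. Fix a distortion level $0<D<\sigma^2$. For $x^n,y^n\in\mathbb R^n$ let $d(x^n,y^n)=\frac1n\|x^n-y^n\|^2$. A random codebook consists of $M$ codewords $Y^n(1),\dots,Y^n(M)$, i.i.d. and independent of $X^n$, each distributed either uniformly on the sphere $\{y^n\in\mathbb R^n:\|y^n\|^2=n(\sigma^2-D)\}$ (spherical codebook) or as $\mathcal N(0,(\sigma^2-D)I_n)$ (i.i.d. Gaussian codebook). The encoder maps $X^n$ to a codeword minimizing $d(X^n,Y^n(i))$ over $i$. The ensemble excess-distortion probability is $P_{e,n}(M):=\Pr\{\min_{1\le i\le M} d(X^n,Y^n(i))>D\}=\mathsf E\big[(1-\Pr\{d(X^n,Y^n)\le D\mid X^n\})^M\big]$, where $Y^n$ is one codeword independent of $X^n$ and the probability is over both source and codebook. All logarithms are natural. Define $\mathrm V(\sigma^2,\zeta):=\frac{\zeta-\sigma^4}{4\sigma^4}$. $\mathrm Q$ is the standard Gaussian complementary cdf and $\mathrm Q^{-1}$ its inverse. $M^*_{\rm sp}(n,\varepsilon,\sigma^2,D)$ (resp. $M^*_{\rm iid}(n,\varepsilon,\sigma^2,D)$) is the minimum number $M$ of codewords such that $P_{e,n}(M)\le\varepsilon$ when the spherical (resp. i.i.d. Gaussian) codebook is used. The second-order coding rate is $L^*_{\rm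 sp}(\varepsilon):=\limsup_{n\to\infty}\frac1{\sqrt n}\big(\log M^*_{\rm sp}(n,\varepsilon,\sigma^2,D)-\frac n2\log\frac{\sigma^2}{D}\big)$, and $L^*_{\rm iid}(\varepsilon)$ is defined analogously. *)

theory Defs
  imports "HOL-Probability.Probability" "HOL-Library.Landau_Symbols"
begin

text \<open>Points of R^n are represented as functions nat => real; only the
coordinates in {..<n} matter (the product measures below live on the
extensional functions with domain {..<n}).\<close>

definition dist_n :: "nat \<Rightarrow> (nat \<Rightarrow> real) \<Rightarrow> (nat \<Rightarrow> real) \<Rightarrow> real" where
  "dist_n n x y = (\<Sum>i<n. (x i - y i)\<^sup>2) / real n"

definition source_n :: "real measure \<Rightarrow> nat \<Rightarrow> (nat \<Rightarrow> real) measure" where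
  "source_n P n = PiM {..<n} (\<lambda>_. P)"

definition std_gauss :: "real measure" where
  "std_gauss = density lborel std_normal_density"

definition iid_codeword :: "real \<Rightarrow> nat \<Rightarrow> (nat \<Rightarrow> real) measure" where
  "iid_codeword s n = PiM {..<n} (\<lambda>_. density lborel (normal_density 0 (sqrt s)))"

text \<open>Spherical codeword: uniform distribution on the sphere
  {y. ||y||^2 = n s} in R^n, realised (as usual) as the law of
  sqrt(n s) Z / ||Z|| with Z ~ N(0, I_n).\<close>
definition sp_codeword :: "real \<Rightarrow> nat \<Rightarrow> (nat \<Rightarrow> real) measure" where
  "sp_codeword s n = distr (PiM {..<n} (\<lambda>_. std_gauss)) (PiM {..<n} (\<lambda>_. borel))
     (\<lambda>z. restrict (\<lambda>i. sqrt (real n * s) * z i / sqrt (\<Sum>j<n. (z j)\<^sup>2)) {..<n})"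

definition cover_prob :: "(nat \<Rightarrow> (nat \<Rightarrow> real) measure) \<Rightarrow> real \<Rightarrow> nat \<Rightarrow> (nat \<Rightarrow> real) \<Rightarrow> real" where
  "cover_prob C D n x = measure (C n) {y \<in> space (C n). dist_n n x y \<le> D}"

definition excess_prob ::
  "real measure \<Rightarrow> (nat \<Rightarrow> (nat \<Rightarrow> real) measure) \<Rightarrow> real \<Rightarrow> nat \<Rightarrow> nat \<Rightarrow> real" where
  "excess_prob P C D n M = (\<integral>x. (1 - cover_prob C D n x) ^ M \<partial>source_n P n)"

definition M_star ::
  "real measure \<Rightarrow> (nat \<Rightarrow> (nat \<Rightarrow> real) measure) \<Rightarrow> real \<Rightarrow> real \<Rightarrow> nat \<Rightarrow> nat" where
  "M_star P C D eps n = (LEAST M. excess_prob P C D n M \<le> eps)"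

definition M_star_sp :: "real measure \<Rightarrow> real \<Rightarrow> real \<Rightarrow> real \<Rightarrow> nat \<Rightarrow> nat" where
  "M_star_sp P sigma2 D eps n = M_star P (sp_codeword (sigma2 - D)) D eps n"

definition M_star_iid :: "real measure \<Rightarrow> real \<Rightarrow> real \<Rightarrow> real \<Rightarrow> nat \<Rightarrow> nat" where
  "M_star_iid P sigma2 D eps n = M_star P (iid_codeword (sigma2 - D)) D eps n"

definition second_order_rate :: "(nat \<Rightarrow> nat) \<Rightarrow> real \<Rightarrow> real \<Rightarrow> ereal" where
  "second_order_rate Mst sigma2 D =
     limsup (\<lambda>n. ereal ((ln (real (Mst n)) - real n / 2 * ln (sigma2 / D)) / sqrt (real n)))"

definition Qfun :: "real \<Rightarrow> real" where
  "Qfun x = measure std_gauss {x<..}"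

definition Qinv :: "real \<Rightarrow> real" where
  "Qinv e = (THE x. Qfun x = e)"

definition dispersion :: "real \<Rightarrow> real \<Rightarrow> real" where
  "dispersion sigma2 zeta = (zeta - sigma2\<^sup>2) / (4 * sigma2\<^sup>2)"

end

theory Submission
  imports Defs "HOL-Real_Asymp.Real_Asymp"
begin

text \<open>
  Put \<open>T = (\<Sum>x\<^sub>i\<^sup>2 - n \<sigma>\<^sup>2) / (2 \<sigma>\<^sup>2)\<close>. Both codebooks cover a source word \<open>x\<close> with probability
  \<open>exp (- n/2 ln (\<sigma>\<^sup>2/D) - T + O(ln n))\<close> as long as \<open>T = O(sqrt (n ln n))\<close>, and the latter fails with
  probability \<open>O(ln n / sqrt n)\<close> only. The excess-distortion probability of \<open>M\<close> codewords is
  therefore, up to \<open>O(ln n / sqrt n)\<close>, the probability that \<open>T\<close> exceeds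
  \<open>ln M - n/2 ln (\<sigma>\<^sup>2/D) + O(ln n)\<close>. As \<open>T\<close> is a sum of i.i.d. terms of variance \<open>V\<close>, a Berry--Esseen bound
  turns this into the claimed expansion. An error \<open>O(ln n / sqrt n)\<close> instead of \<open>O(1 / sqrt n)\<close>
  in that bound costs only \<open>O(ln n)\<close> in \<open>ln M\<close>, so Gaussian smoothing and the Levy inversion formula suffice.

  For the covering probabilities, rotation invariance reduces everything to the component of a Gaussian vector
  along \<open>x\<close> and the norm of the orthogonal part. A spherical codeword covers \<open>x\<close> iff the vector
  lies in a cone around \<open>x\<close>. For a Gaussian codeword the upper bound is Chernoff's; the lower bound
  prescribes the component along \<open>x\<close> and estimates the lower tail of a chi-square variable by exponential
  tilting, where the Berry--Esseen bound applies again.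
\<close>

section \<open>Comparing distribution functions through characteristic functions\<close>

text \<open>The covering exponents are linear in \<open>T\<close> only up to a remainder of order
  \<open>T^2 / n\<close>. This dictates the window \<open>T = O(sqrt (n ln n))\<close>, where the
  remainder is \<open>O(ln n)\<close>. Chebyshev's inequality would leave probability of order
  \<open>1 / ln n\<close> outside it, too much, so normal approximation is used there as well. A
  logarithmic loss is harmless because the normal approximation of \<open>T\<close> has density of
  order \<open>1 / sqrt n\<close>: moving a threshold by a multiple of \<open>ln n\<close> moves the
  probability by a multiple of \<open>ln n / sqrt n\<close>, which absorbs every error of that size.
  In the same way covering probabilities matter only up to powers of \<open>n\<close>. The sixth
  moment of the source is the third absolute moment of its square, as the normal approximation
  requires. If \<open>V = 0\<close> no normalisation is possible, but then \<open>T\<close> vanishes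
  almost surely; this case is split off.\<close>

lemma cdf_diff_le_char_integral:
  fixes M N :: "real measure" and H :: "real \<Rightarrow> real" and b :: real
  assumes M: "real_distribution M" and N: "real_distribution N"
    and M0: "\<And>a. measure M {a} = 0" and N0: "\<And>a. measure N {a} = 0"
    and H: "integrable lborel H"
    and Hnn: "\<And>t. 0 \<le> H t"
    and le: "\<And>t. cmod (char M t - char N t) \<le> \<bar>t\<bar> * H t"
  shows "\<bar>cdf M b - cdf N b\<bar> \<le> (\<integral>t. H t \<partial>lborel) / pi"
proof -
  interpret M: real_distribution M by fact
  interpret N: real_distribution N by fact
  \<comment> \<open>For a finite interval: the inversion kernel is at most
    \<open>2 / \<bar>t\<bar>\<close>, the hypothesis supplies \<open>\<bar>t\<bar> * H t\<close>,
    and \<open>2 / (2 * pi)\<close> gives the constant, uniformly in \<open>a\<close>.\<close>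
  have main: "\<bar>measure M {a<..b} - measure N {a<..b}\<bar> \<le> (\<integral>t. H t \<partial>lborel) / pi" if "a < b" for a
  proof -
    let ?F = "\<lambda>t::real. (iexp (-(t * a)) - iexp (-(t * b))) / (\<i> * t)"
    let ?I = "\<lambda>K T. 1 / (2 * pi) * (CLBINT t=ereal (- real T)..ereal (real T). ?F t * char K t)"
    \<comment> \<open>This bound depends on \<open>a\<close> and serves integrability only; the
      estimate rests on \<open>F2\<close>. At \<open>t = 0\<close> the kernel is \<open>0\<close> by
      the convention for division, so both bounds hold there too.\<close>
    have F1: "cmod (?F t) \<le> b - a" for t
    proof (cases "t = 0")
      case False
      then show ?thesis using Levy_Inversion_aux2[of "-b" "-a" t] that by simp
    qed (use that in simp)
    have F2: "cmod (?F t) \<le> 2 / \<bar>t\<bar>" for t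
    proof -
      have "cmod (iexp (-(t * a)) - iexp (-(t * b))) \<le> cmod (iexp (-(t * a))) + cmod (iexp (-(t * b)))"
        by (rule norm_triangle_ineq4)
      also have "\<dots> = 2" unfolding norm_exp_i_times by simp
      finally show ?thesis
        unfolding norm_divide by (simp add: norm_mult divide_right_mono)
    qed
    have lim: "(\<lambda>T::nat. ?I M T - ?I N T) \<longlonglongrightarrow> of_real (measure M {a<..b}) - of_real (measure N {a<..b})"
      using tendsto_diff[OF M.Levy_Inversion[OF less_imp_le[OF that] M0 M0]
          N.Levy_Inversion[OF less_imp_le[OF that] N0 N0]] by simp
    have bound: "cmod (?I M T - ?I N T) \<le> (\<integral>t. H t \<partial>lborel) / pi" for T :: nat
    proof -
      have int: "interval_lebesgue_integrable lborel (ereal (- real T)) (ereal (real T)) (\<lambda>t. ?F t * char K t)"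
        if "real_distribution K" for K
      proof -
        interpret K: real_distribution K by fact
        have "cmod (?F t * char K t) \<le> b - a" for t
        proof -
          have "cmod (?F t * char K t) \<le> (b - a) * 1"
            unfolding norm_mult using \<open>a < b\<close> by (intro mult_mono F1 K.cmod_char_le_1) auto
          then show ?thesis by simp
        qed
        then show ?thesis
          apply (simp add: interval_lebesgue_integrable_def set_integrable_def del: times_divide_eq_left)
          apply (intro integrableI_bounded_set_indicator[where B="b - a"])
          apply (auto)
          done
      qed
      have "?I M T - ?I N T = 1 / (2 * pi) * (CLBINT t=ereal (- real T)..ereal (real T). ?F t * char M t - ?F t * char N t)"
        using int[OF M] int[OF N] by (subst interval_lebesgue_integral_diff) (auto simp: right_diff_distrib)
      also have "(CLBINT t=ereal (- real T)..ereal (real T). ?F t * char M t - ?F t * char N t)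
         = (CLBINT t. indicator {- real T<..<real T} t *\<^sub>R (?F t * (char M t - char N t)))" 
        by (simp add: interval_lebesgue_integral_def set_lebesgue_integral_def right_diff_distrib)
      finally have "cmod (?I M T - ?I N T) = 1 / (2 * pi) * cmod (CLBINT t. indicator {- real T<..<real T} t *\<^sub>R (?F t * (char M t - char N t)))"
        by (simp add: norm_mult norm_divide)
      also have "\<dots> \<le> 1 / (2 * pi) * (\<integral>t. 2 * H t \<partial>lborel)"
      proof -
        have I1: "integrable lborel (\<lambda>t. indicator {- real T<..<real T} t *\<^sub>R (?F t * (char M t - char N t)))"
          using interval_lebesgue_integral_diff(1)[OF int[OF M] int[OF N]]
          by (simp add: interval_lebesgue_integrable_def set_integrable_def right_diff_distrib)
        have I2: "integrable lborel (\<lambda>t. 2 * H t)" using H by simp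
        have I3: "cmod (indicator {- real T<..<real T} t *\<^sub>R (?F t * (char M t - char N t))) \<le> 2 * H t" for t
proof (cases "t \<in> {- real T<..<real T}")
          case True
          have "cmod (?F t * (char M t - char N t)) \<le> 2 / \<bar>t\<bar> * (\<bar>t\<bar> * H t)"
            unfolding norm_mult by (intro mult_mono F2 le) auto
          also have "\<dots> \<le> 2 * H t" using Hnn by simp
          finally show ?thesis using True by simp
        qed (use Hnn[of t] in auto)
        show ?thesis
          by (intro mult_left_mono Bochner_Integration.integral_norm_bound_integral[OF I1 I2 I3]) auto
      qed
      finally show ?thesis by simp
    qed
    have "cmod (of_real (measure M {a<..b}) - of_real (measure N {a<..b})) \<le> (\<integral>t. H t \<partial>lborel) / pi"
      by (rule tendsto_upperbound[OF tendsto_norm[OF lim]]) (use bound in auto)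
    then show ?thesis by (simp flip: of_real_diff)
  qed
  \<comment> \<open>The left end goes to minus infinity; the bound does not depend on it.\<close>
  have "(\<lambda>i::nat. \<bar>(cdf M b - cdf M (- real i)) - (cdf N b - cdf N (- real i))\<bar>) \<longlonglongrightarrow> \<bar>(cdf M b - 0) - (cdf N b - 0)\<bar>"
    by (intro tendsto_intros M.cdf_lim_neg_infty N.cdf_lim_neg_infty)
  moreover have "\<forall>\<^sub>F i::nat in sequentially. \<bar>(cdf M b - cdf M (- real i)) - (cdf N b - cdf N (- real i))\<bar> \<le> (\<integral>t. H t \<partial>lborel) / pi"
  proof -
    have "\<forall>\<^sub>F i::nat in sequentially. - b < real i"
      by real_asymp
    then show ?thesis
    proof eventually_elim
      case (elim i)
      then show ?case using main[of "- real i"] by (simp add: M.cdf_diff_eq N.cdf_diff_eq)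
    qed
  qed
  ultimately show ?thesis using tendsto_upperbound by fastforce
qed

section \<open>Gaussian measures and Gaussian smoothing\<close>

text \<open>The parameter is the standard deviation, not the variance.\<close>

definition gauss :: "real \<Rightarrow> real measure" where
  "gauss \<tau> = density lborel (\<lambda>x. ennreal (normal_density 0 \<tau> x))"

lemma std_gauss_eq: "std_gauss = gauss 1"
  by (simp add: std_gauss_def gauss_def)

lemma sets_gauss [simp, measurable_cong]: "sets (gauss \<tau>) = sets borel"
  and space_gauss [simp]: "space (gauss \<tau>) = UNIV"
  by (simp_all add: gauss_def)

lemma prob_space_gauss: "0 < \<tau> \<Longrightarrow> prob_space (gauss \<tau>)"
  unfolding gauss_def by (rule prob_space_normal_density)

lemma real_distribution_gauss: "0 < \<tau> \<Longrightarrow> real_distribution (gauss \<tau>)"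
  using prob_space_gauss[of \<tau>] by (simp add: real_distribution_def real_distribution_axioms_def)

lemma nn_integral_gauss:
  assumes [measurable]: "f \<in> borel_measurable borel"
  shows "(\<integral>\<^sup>+x. f x \<partial>gauss \<tau>) = (\<integral>\<^sup>+x. ennreal (normal_density 0 \<tau> x) * f x \<partial>lborel)"
  unfolding gauss_def by (subst nn_integral_density) auto

lemma nn_integral_gauss_scale:
  assumes "0 < \<tau>" and [measurable]: "f \<in> borel_measurable borel"
  shows "(\<integral>\<^sup>+x. f x \<partial>gauss \<tau>) = (\<integral>\<^sup>+x. f (\<tau> * x) \<partial>gauss 1)"
proof -
  have "(\<integral>\<^sup>+x. f x \<partial>gauss \<tau>) = ennreal \<bar>\<tau>\<bar> * (\<integral>\<^sup>+x. ennreal (normal_density 0 \<tau> (0 + \<tau> * x)) * f (0 + \<tau> * x) \<partial>lborel)"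
    unfolding nn_integral_gauss[OF assms(2)] using assms by (subst nn_integral_real_affine[where t=0 and c=\<tau>]) auto
  also have "\<dots> = (\<integral>\<^sup>+x. ennreal \<bar>\<tau>\<bar> * (ennreal (normal_density 0 \<tau> (\<tau> * x)) * f (\<tau> * x)) \<partial>lborel)"
    by (subst nn_integral_cmult) auto
  also have "\<dots> = (\<integral>\<^sup>+x. ennreal (normal_density 0 1 x) * f (\<tau> * x) \<partial>lborel)"
  proof (rule nn_integral_cong)
    fix x
    have "\<bar>\<tau>\<bar> * normal_density 0 \<tau> (\<tau> * x) = normal_density 0 1 x"
      using assms(1) by (simp add: normal_density_def real_sqrt_mult power_mult_distrib)
    then show "ennreal \<bar>\<tau>\<bar> * (ennreal (normal_density 0 \<tau> (\<tau> * x)) * f (\<tau> * x)) = ennreal (normal_density 0 1 x) * f (\<tau> * x)"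
      by (simp add: mult.assoc[symmetric] ennreal_mult[symmetric])
  qed
  also have "\<dots> = (\<integral>\<^sup>+x. f (\<tau> * x) \<partial>gauss 1)" by (subst nn_integral_gauss) auto
  finally show ?thesis .
qed

lemma gauss_eq_distr: "0 < \<tau> \<Longrightarrow> gauss \<tau> = distr (gauss 1) borel (\<lambda>x. \<tau> * x)"
proof (rule measure_eqI)
  fix A assume "A \<in> sets (gauss \<tau>)" "0 < \<tau>"
  then have [measurable]: "A \<in> sets borel" by simp
  have "emeasure (gauss \<tau>) A = (\<integral>\<^sup>+x. indicator A x \<partial>gauss \<tau>)"
    by simp
  also have "\<dots> = (\<integral>\<^sup>+x. indicator A (\<tau> * x) \<partial>gauss 1)"
    using \<open>0 < \<tau>\<close> by (intro nn_integral_gauss_scale) auto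
  also have "\<dots> = emeasure (distr (gauss 1) borel (\<lambda>x. \<tau> * x)) A"
    by (subst nn_integral_distr[symmetric, where f="indicator A" and M'=borel]) auto
  finally show "emeasure (gauss \<tau>) A = emeasure (distr (gauss 1) borel (\<lambda>x. \<tau> * x)) A" .
qed simp

lemma char_gauss:
  assumes "0 < \<tau>"
  shows "char (gauss \<tau>) t = of_real (exp (- (\<tau> * t)\<^sup>2 / 2))"
proof -
  have "char (gauss \<tau>) t = (CLINT x|gauss 1. iexp (t * (\<tau> * x)))"
    unfolding char_def gauss_eq_distr[OF assms] by (subst integral_distr) auto
  also have "\<dots> = char std_normal_distribution (\<tau> * t)"
    by (simp add: char_def gauss_def mult_ac)
  finally show ?thesis by (simp add: char_std_normal_distribution)
qed

lemma gauss_singleton: "measure (gauss \<tau>) {a} = 0"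
  by (simp add: measure_def gauss_def emeasure_density) 

text \<open>The density is at most one; this crude Lipschitz constant of the normal distribution
  function is enough.\<close>

lemma gauss_Ioc_le:
  assumes "a \<le> b"
  shows "measure (gauss 1) {a<..b} \<le> b - a"
proof -
  have "emeasure (gauss 1) {a<..b} = (\<integral>\<^sup>+x. ennreal (normal_density 0 1 x) * indicator {a<..b} x \<partial>lborel)"
    unfolding gauss_def by (subst emeasure_density) auto
  also have "\<dots> \<le> (\<integral>\<^sup>+x. indicator {a<..b} x \<partial>lborel)"
  proof (rule nn_integral_mono)
    fix x :: real
    have "normal_density 0 1 x \<le> 1"
    proof -
      have "1 \<le> sqrt (2 * pi)" using pi_gt3 by simp
      then have "1 / sqrt (2 * pi) * exp (- x\<^sup>2 / 2) \<le> 1 * 1" by (intro mult_mono) auto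
      then show ?thesis by (simp add: std_normal_density_def)
    qed
    then show "ennreal (normal_density 0 1 x) * indicator {a<..b} x \<le> indicator {a<..b} x"
      by (auto split: split_indicator simp: ennreal_le_1)
  qed
  also have "\<dots> = ennreal (b - a)" using assms by simp
  finally show ?thesis using assms
    by (simp add: measure_def enn2real_leI)
qed

text \<open>The density at \<open>a + x\<close> is at most \<open>exp (- a\<^sup>2 / 2)\<close>
  times the density at \<open>x\<close>, because the cross term \<open>a * x\<close> is nonnegative
  for \<open>x \<ge> 0\<close>. No factor \<open>1 / a\<close> appears, so \<open>a = 0\<close> is
  allowed.\<close>

lemma gauss_Ici_le:
  assumes "0 \<le> a"
  shows "measure (gauss 1) {a..} \<le> exp (- a\<^sup>2 / 2)"
proof -
  have "emeasure (gauss 1) {a..} = (\<integral>\<^sup>+x. ennreal (normal_density 0 1 x) * indicator {a..} x \<partial>lborel)"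
    unfolding gauss_def by (subst emeasure_density) auto
  also have "\<dots> = (\<integral>\<^sup>+x. ennreal (normal_density 0 1 (a + 1 * x)) * indicator {a..} (a + 1 * x) \<partial>lborel)"
    by (subst nn_integral_real_affine[where t=a and c=1]) auto
  also have "\<dots> \<le> (\<integral>\<^sup>+x. ennreal (exp (- a\<^sup>2 / 2)) * ennreal (normal_density 0 1 x) \<partial>lborel)"
  proof (rule nn_integral_mono)
    fix x :: real
    show "ennreal (normal_density 0 1 (a + 1 * x)) * indicator {a..} (a + 1 * x)
       \<le> ennreal (exp (- a\<^sup>2 / 2)) * ennreal (normal_density 0 1 x)"
    proof (cases "0 \<le> x")
      case True
      have "- (a + x)\<^sup>2 / 2 \<le> - a\<^sup>2 / 2 + - x\<^sup>2 / 2"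
        using True assms by (simp add: power2_sum)
      then have "exp (- (a + x)\<^sup>2 / 2) \<le> exp (- a\<^sup>2 / 2) * exp (- x\<^sup>2 / 2)"
        by (simp only: exp_add[symmetric] exp_le_cancel_iff)
      then have "normal_density 0 1 (a + x) \<le> exp (- a\<^sup>2 / 2) * normal_density 0 1 x"
        by (simp add: std_normal_density_def divide_right_mono)
      then show ?thesis using True by (simp add: ennreal_mult[symmetric] )
    qed simp
  qed
  also have "\<dots> = ennreal (exp (- a\<^sup>2 / 2))"
    by (subst nn_integral_cmult) (auto simp: nn_integral_eq_integral)
  finally show ?thesis
    by (simp add: measure_def enn2real_leI)
qed

lemma gauss_Iic_le:
  assumes "0 \<le> a"
  shows "measure (gauss 1) {..-a} \<le> exp (- a\<^sup>2 / 2)"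
proof -
  have "emeasure (gauss 1) {..-a} = (\<integral>\<^sup>+x. ennreal (normal_density 0 1 x) * indicator {..-a} x \<partial>lborel)"
    unfolding gauss_def by (subst emeasure_density) auto
  also have "\<dots> = (\<integral>\<^sup>+x. ennreal (normal_density 0 1 (0 + (-1) * x)) * indicator {..-a} (0 + (-1) * x) \<partial>lborel)"
    by (subst nn_integral_real_affine[where t=0 and c="-1"]) auto
  also have "\<dots> = (\<integral>\<^sup>+x. ennreal (normal_density 0 1 x) * indicator {a..} x \<partial>lborel)"
    by (intro nn_integral_cong) (auto simp: std_normal_density_def split: split_indicator)
  also have "\<dots> = emeasure (gauss 1) {a..}"
    unfolding gauss_def by (subst emeasure_density) auto
  finally show ?thesis using gauss_Ici_le[OF assms] by (simp add: measure_def)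
qed

lemma measure_gauss_scale:
  assumes "0 < \<tau>" and [measurable]: "A \<in> sets borel"
  shows "measure (gauss \<tau>) A = measure (gauss 1) {x. \<tau> * x \<in> A}"
  unfolding gauss_eq_distr[OF assms(1)] by (subst measure_distr) (auto simp: vimage_def)

text \<open>Convolution with a centred normal law of standard deviation \<open>\<delta>\<close>. It
  removes atoms, so that inversion applies at every point, and multiplies the characteristic
  function by a rapidly decreasing factor.\<close>

definition gauss_smooth :: "real \<Rightarrow> real measure \<Rightarrow> real measure" where
  "gauss_smooth \<delta> M = distr (M \<Otimes>\<^sub>M gauss \<delta>) borel (\<lambda>(x, y). x + y)"

context
  fixes M :: "real measure" and \<delta> :: real
  assumes M: "real_distribution M" and \<delta>: "0 < \<delta>"
begin

interpretation M: real_distribution M by (rule M)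
interpretation G: prob_space "gauss \<delta>" by (rule prob_space_gauss[OF \<delta>])
interpretation MG: pair_prob_space M "gauss \<delta>" ..

lemma real_distribution_gauss_smooth: "real_distribution (gauss_smooth \<delta> M)"
  unfolding gauss_smooth_def
  by (rule MG.real_distribution_distr) (simp add: M.events_eq_borel cong: measurable_cong_sets)

lemma char_gauss_smooth:
  "char (gauss_smooth \<delta> M) t = char M t * of_real (exp (- (\<delta> * t)\<^sup>2 / 2))"
proof -
  have [measurable_cong]: "sets M = sets borel" by simp
  have "char (gauss_smooth \<delta> M) t = (CLINT z|M \<Otimes>\<^sub>M gauss \<delta>. iexp (t * (case z of (x, y) \<Rightarrow> x + y)))"
    unfolding char_def gauss_smooth_def by (subst integral_distr) auto
  also have "\<dots> = (CLINT z|M \<Otimes>\<^sub>M gauss \<delta>. (case z of (x, y) \<Rightarrow> iexp (t * x) * iexp (t * y)))"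
    by (intro Bochner_Integration.integral_cong) (auto simp: distrib_left exp_add split: prod.splits)
  also have "\<dots> = (CLINT x|M. CLINT y|gauss \<delta>. iexp (t * x) * iexp (t * y))"
  proof -
    have "integrable (M \<Otimes>\<^sub>M gauss \<delta>) (\<lambda>(x, y). iexp (t * x) * iexp (t * y))"
      by (rule MG.integrable_const_bound[where B=1]) (auto simp: norm_mult)
    from MG.integral_fst'[OF this] show ?thesis by simp
  qed
  also have "\<dots> = (CLINT x|M. iexp (t * x) * char (gauss \<delta>) t)"
    by (simp add: char_def)
  also have "\<dots> = char M t * char (gauss \<delta>) t"
    by (simp add: char_def)
  finally show ?thesis by (simp add: char_gauss[OF \<delta>])
qed

lemma gauss_smooth_singleton: "measure (gauss_smooth \<delta> M) {a} = 0"
proof -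
  have [measurable_cong]: "sets M = sets borel" by simp
  have "emeasure (gauss_smooth \<delta> M) {a} = emeasure (M \<Otimes>\<^sub>M gauss \<delta>) {z \<in> space (M \<Otimes>\<^sub>M gauss \<delta>). fst z + snd z = a}"
    unfolding gauss_smooth_def by (subst emeasure_distr) (auto simp: space_pair_measure intro!: arg_cong2[where f=emeasure])
  also have "\<dots> = (\<integral>\<^sup>+x. emeasure (gauss \<delta>) (Pair x -` {z \<in> space (M \<Otimes>\<^sub>M gauss \<delta>). fst z + snd z = a}) \<partial>M)"
    by (rule G.emeasure_pair_measure_alt) measurable
  also have "\<dots> = (\<integral>\<^sup>+x. 0 \<partial>M)"
  proof (rule nn_integral_cong)
    fix x
    have "Pair x -` {z \<in> space (M \<Otimes>\<^sub>M gauss \<delta>). fst z + snd z = a} = {a - x}"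
      by (auto simp: space_pair_measure)
    then show "emeasure (gauss \<delta>) (Pair x -` {z \<in> space (M \<Otimes>\<^sub>M gauss \<delta>). fst z + snd z = a}) = 0"
      using gauss_singleton[of \<delta> "a - x"] by (simp add: G.emeasure_eq_measure)
  qed
  finally show ?thesis by (simp add: measure_def)
qed

text \<open>If \<open>X \<le> b\<close>, then \<open>X + Y \<le> b + a\<close> or
  \<open>Y \<ge> a\<close>; if \<open>X + Y \<le> b - a\<close>, then \<open>X \<le> b\<close> or
  \<open>Y \<le> - a\<close>. The exponential bounds the tail of the noise \<open>Y\<close>.\<close>

lemma cdf_le_gauss_smooth:
  assumes "0 \<le> a"
  shows "cdf M b \<le> cdf (gauss_smooth \<delta> M) (b + a) + exp (- (a / \<delta>)\<^sup>2 / 2)"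
    and "cdf (gauss_smooth \<delta> M) (b - a) \<le> cdf M b + exp (- (a / \<delta>)\<^sup>2 / 2)"
proof -
  have [measurable_cong]: "sets M = sets borel" by simp
  let ?N = "M \<Otimes>\<^sub>M gauss \<delta>"
  have sm: "cdf (gauss_smooth \<delta> M) u = measure ?N {z \<in> space ?N. fst z + snd z \<le> u}" for u
    unfolding cdf_def gauss_smooth_def by (subst measure_distr) (auto simp: space_pair_measure intro!: arg_cong2[where f=measure])
  have X: "cdf M b = measure ?N {z \<in> space ?N. fst z \<le> b}"
  proof -
    have "{z \<in> space ?N. fst z \<le> b} = {..b} \<times> UNIV" by (auto simp: space_pair_measure)
    then show ?thesis using G.emeasure_space_1 G.emeasure_pair_measure_Times[of "{..b}" M UNIV] unfolding cdf_def measure_def by (simp del: G.emeasure_space_1)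
  qed
  have Y: "measure ?N {z \<in> space ?N. snd z \<in> B} = measure (gauss \<delta>) B" if "B \<in> sets borel" for B
  proof -
    have "{z \<in> space ?N. snd z \<in> B} = UNIV \<times> B" by (auto simp: space_pair_measure)
    then show ?thesis using M.emeasure_space_1 that G.emeasure_pair_measure_Times[of UNIV M B] unfolding measure_def by simp
  qed
  have ms: "{z \<in> space ?N. fst z + snd z \<le> u} \<in> sets ?N" "{z \<in> space ?N. fst z \<le> u} \<in> sets ?N"
    "{z \<in> space ?N. snd z \<in> {a..}} \<in> sets ?N" "{z \<in> space ?N. snd z \<in> {..-a}} \<in> sets ?N" for u
    by measurable
  have t1: "measure (gauss \<delta>) {a..} \<le> exp (- (a / \<delta>)\<^sup>2 / 2)"
  proof -
    have "{x. \<delta> * x \<in> {a..}} = {a / \<delta>..}" using \<delta> by (auto simp: field_simps)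
    then show ?thesis using gauss_Ici_le[of "a / \<delta>"] \<delta> assms by (subst measure_gauss_scale) simp_all
  qed
  have t2: "measure (gauss \<delta>) {..-a} \<le> exp (- (a / \<delta>)\<^sup>2 / 2)"
  proof -
    have "{x. \<delta> * x \<in> {..-a}} = {..-(a / \<delta>)}" using \<delta> by (auto simp: field_simps)
    then show ?thesis using gauss_Iic_le[of "a / \<delta>"] \<delta> assms by (subst measure_gauss_scale) simp_all
  qed
  have "cdf M b \<le> measure ?N ({z \<in> space ?N. fst z + snd z \<le> b + a} \<union> {z \<in> space ?N. snd z \<in> {a..}})"
    unfolding X by (rule MG.finite_measure_mono[OF _ sets.Un[OF ms(1) ms(3)]]) auto
  also have "\<dots> \<le> cdf (gauss_smooth \<delta> M) (b + a) + measure (gauss \<delta>) {a..}"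
    unfolding sm by (subst Y[symmetric], simp, rule measure_Un_le) (fact ms)+
  finally show "cdf M b \<le> cdf (gauss_smooth \<delta> M) (b + a) + exp (- (a / \<delta>)\<^sup>2 / 2)" using t1 by simp
  have "cdf (gauss_smooth \<delta> M) (b - a) \<le> measure ?N ({z \<in> space ?N. fst z \<le> b} \<union> {z \<in> space ?N. snd z \<in> {..-a}})"
    unfolding sm by (rule MG.finite_measure_mono[OF _ sets.Un[OF ms(2) ms(4)]]) auto
  also have "\<dots> \<le> cdf M b + measure (gauss \<delta>) {..-a}"
    unfolding X by (subst Y[symmetric], simp, rule measure_Un_le) (fact ms)+
  finally show "cdf (gauss_smooth \<delta> M) (b - a) \<le> cdf M b + exp (- (a / \<delta>)\<^sup>2 / 2)" using t2 by simp
qed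

end

text \<open>The normal law is smoothed as well, so that both characteristic functions carry the same
  damping factor. Passing to the smoothed laws and back moves the argument by \<open>2 * a\<close>
  in total, which the Lipschitz bound for the normal law pays for.\<close>

lemma cdf_diff_le_gauss_smooth:
  assumes M: "real_distribution M" and \<delta>: "0 < \<delta>" and a: "0 \<le> a"
    and E: "\<And>u. \<bar>cdf (gauss_smooth \<delta> M) u - cdf (gauss_smooth \<delta> (gauss 1)) u\<bar> \<le> E"
  shows "\<bar>cdf M b - cdf (gauss 1) b\<bar> \<le> E + 2 * a + 2 * exp (- (a / \<delta>)\<^sup>2 / 2)"
proof -
  interpret G: real_distribution "gauss 1" by (rule real_distribution_gauss) simp
  have lip: "cdf (gauss 1) (u + 2 * a) \<le> cdf (gauss 1) u + 2 * a" for u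
  proof (cases "a = 0")
    case False
    then show ?thesis using G.cdf_diff_eq[of u "u + 2 * a"] gauss_Ioc_le[of u "u + 2 * a"] a by simp
  qed simp
  note m = cdf_le_gauss_smooth[OF M \<delta> a] and g = cdf_le_gauss_smooth[OF real_distribution_gauss[of 1] \<delta> a]
  have "cdf M b \<le> cdf (gauss 1) b + (E + 2 * a + 2 * exp (- (a / \<delta>)\<^sup>2 / 2))"
    using m(1)[of b] E[of "b + a"] g(2)[of "b + 2 * a"] lip[of b] by (simp add: algebra_simps abs_le_iff)
  moreover have "cdf (gauss 1) b \<le> cdf M b + (E + 2 * a + 2 * exp (- (a / \<delta>)\<^sup>2 / 2))"
    using m(2)[of b] E[of "b - a"] g(1)[of "b - 2 * a"] lip[of "b - 2 * a"] by (simp add: algebra_simps abs_le_iff)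
  ultimately show ?thesis by (simp add: abs_le_iff)
qed

section \<open>A Berry--Esseen bound with a logarithmic loss\<close>

lemma abs_power3: "\<bar>t\<bar> ^ 3 = \<bar>t\<bar> * t\<^sup>2" for t :: real
  by (simp add: power3_eq_cube power2_eq_square mult.assoc)

text \<open>\<open>z ^ n - w ^ n\<close> is \<open>z - w\<close> times a sum of \<open>n\<close>
  products of \<open>n - 1\<close> factors, each factor of norm at most \<open>m\<close>.\<close>

lemma norm_power_diff_le:
  fixes z w :: "'a :: {real_normed_algebra_1, comm_ring_1}"
  assumes "norm z \<le> m" "norm w \<le> m"
  shows "norm (z ^ n - w ^ n) \<le> real n * m ^ (n - 1) * norm (z - w)"
proof -
  have m: "0 \<le> m" using assms(1) norm_ge_zero[of z] by linarith
  have "norm (z ^ n - w ^ n) = norm ((z - w) * (\<Sum>i<n. w ^ (n - Suc i) * z ^ i))"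
    by (simp add: power_diff_sumr2)
  also have "\<dots> \<le> norm (z - w) * norm (\<Sum>i<n. w ^ (n - Suc i) * z ^ i)"
    by (rule norm_mult_ineq)
  also have "norm (\<Sum>i<n. w ^ (n - Suc i) * z ^ i) \<le> (\<Sum>i<n. m ^ (n - 1))"
  proof (rule sum_norm_le)
    fix i assume "i \<in> {..<n}"
    then have e: "n - 1 = (n - Suc i) + i" by simp
    have "norm (w ^ (n - Suc i) * z ^ i) \<le> norm w ^ (n - Suc i) * norm z ^ i"
      by (intro order_trans[OF norm_mult_ineq] mult_mono norm_power_ineq) auto
    also have "\<dots> \<le> m ^ (n - Suc i) * m ^ i"
      using assms m by (intro mult_mono power_mono) auto
    finally show "norm (w ^ (n - Suc i) * z ^ i) \<le> m ^ (n - 1)"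
      unfolding e power_add .
  qed
  finally have "norm (z ^ n - w ^ n) \<le> norm (z - w) * (\<Sum>i<n. m ^ (n - 1))"
    by (simp add: mult_left_mono)
  then show ?thesis by (simp add: mult_ac)
qed

text \<open>The upper half inverts the quadratic Taylor bound for \<open>exp u\<close>: the product
  of \<open>1 - u + u\<^sup>2 / 2\<close> and \<open>1 + u + u\<^sup>2 / 2\<close> is
  \<open>1 + u ^ 4 / 4\<close>, hence at least one.\<close>

lemma exp_minus_quadratic:
  fixes u :: real assumes "0 \<le> u"
  shows "\<bar>exp (- u) - (1 - u)\<bar> \<le> u\<^sup>2 / 2"
proof -
  have "exp (- u) * (1 + u + u\<^sup>2 / 2) \<le> exp (- u) * exp u"
    using exp_lower_Taylor_quadratic[OF assms] by (intro mult_left_mono) auto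
  also have "\<dots> = 1" by (simp flip: exp_add)
  also have "\<dots> \<le> (1 - u + u\<^sup>2 / 2) * (1 + u + u\<^sup>2 / 2)"
    using assms by (simp add: algebra_simps power2_eq_square)
  finally have "exp (- u) \<le> 1 - u + u\<^sup>2 / 2"
    by (rule mult_right_le_imp_le) (use assms in \<open>auto intro: add_pos_nonneg\<close>)
  moreover have "1 - u \<le> exp (- u)" using exp_ge_add_one_self[of "-u"] by simp
  ultimately show ?thesis by simp
qed

lemma integral_exp_minus_square:
  assumes "0 < a"
  shows "has_bochner_integral lborel (\<lambda>t::real. exp (- (a * t\<^sup>2))) (sqrt (pi / a))"
proof -
  define \<tau> where "\<tau> = 1 / sqrt (2 * a)"
  have \<tau>: "0 < \<tau>" "\<tau>\<^sup>2 = 1 / (2 * a)" using assms by (auto simp: \<tau>_def power_divide)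
  have eq: "exp (- (a * t\<^sup>2)) = sqrt (pi / a) * (normal_density 0 \<tau> t * (t - 0) ^ (2 * 0))" for t
    using assms by (simp add: normal_density_def \<tau>(2))
  show ?thesis
    using has_bochner_integral_mult_right[OF normal_moment_even[OF \<tau>(1), of 0 0], of "sqrt (pi / a)"]
    unfolding eq by simp
qed

text \<open>The summand is a function on a probability space, not a law on the line, so that sums
  over the product space of source words can be treated as they stand.\<close>

locale standardized_summand = prob_space P for P :: "'a measure" +
  fixes f :: "'a \<Rightarrow> real"
  assumes f_meas [measurable]: "f \<in> borel_measurable P"
    and f_int: "integrable P f" and f2_int: "integrable P (\<lambda>x. (f x)\<^sup>2)"
    and f3_int: "integrable P (\<lambda>x. \<bar>f x\<bar> ^ 3)"
    and f_mean: "expectation f = 0" and f_var: "expectation (\<lambda>x. (f x)\<^sup>2) = 1"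
begin

definition norm_sum_law :: "nat \<Rightarrow> real measure" where
  "norm_sum_law n = distr (PiM {..<n} (\<lambda>_. P)) borel (\<lambda>x. (\<Sum>i<n. f (x i)) / sqrt (real n))"

lemma real_distribution_norm_sum_law: "real_distribution (norm_sum_law n)"
proof -
  have "prob_space (PiM {..<n} (\<lambda>_. P))" by (rule prob_space_PiM) (rule prob_space_axioms)
  then show ?thesis unfolding norm_sum_law_def
    by (rule prob_space.real_distribution_distr) simp
qed

lemma char_norm_sum_law:
  "char (norm_sum_law n) t = char (distr P borel f) (t / sqrt (real n)) ^ n"
proof -
  interpret S: product_sigma_finite "\<lambda>_::nat. P" ..
  have "char (norm_sum_law n) t = (CLINT x|PiM {..<n} (\<lambda>_. P). iexp (t * ((\<Sum>i<n. f (x i)) / sqrt (real n))))"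
    unfolding char_def norm_sum_law_def by (subst integral_distr) auto
  also have "\<dots> = (CLINT x|PiM {..<n} (\<lambda>_. P). (\<Prod>i<n. iexp (t / sqrt (real n) * f (x i))))"
  proof (intro Bochner_Integration.integral_cong refl)
    fix x
    have "t * ((\<Sum>i<n. f (x i)) / sqrt (real n)) = (\<Sum>i<n. t / sqrt (real n) * f (x i))"
      by (simp add: sum_distrib_left sum_divide_distrib)
    then show "iexp (t * ((\<Sum>i<n. f (x i)) / sqrt (real n))) = (\<Prod>i<n. iexp (t / sqrt (real n) * f (x i)))"
      by (simp only: of_real_sum sum_distrib_left exp_sum finite_lessThan)
  qed
  also have "\<dots> = (\<Prod>i<n. CLINT y|P. iexp (t / sqrt (real n) * f y))"
    by (rule S.product_integral_prod) (simp, rule integrable_iexp, auto)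
  also have "\<dots> = char (distr P borel f) (t / sqrt (real n)) ^ n"
    unfolding char_def by (subst integral_distr) auto
  finally show ?thesis .
qed

text \<open>The characteristic function and the Gaussian factor are both compared with
  \<open>1 - t\<^sup>2 / 2\<close>. The range of \<open>t\<close> forces
  \<open>\<bar>t\<bar> \<le> 1\<close> and \<open>\<rho> * \<bar>t\<bar> \<le> 1\<close> at once, so
  the cubic error is at most \<open>t\<^sup>2 / 6\<close> and the modulus at most
  \<open>1 - t\<^sup>2 / 3\<close>, which leaves room for
  \<open>exp (- t\<^sup>2 / 4)\<close>.\<close>

lemma char_summand_bounds:
  defines "\<rho> \<equiv> expectation (\<lambda>x. \<bar>f x\<bar> ^ 3)"
  assumes "\<bar>t\<bar> \<le> 1 / (1 + \<rho>)"
  shows "cmod (char (distr P borel f) t - of_real (exp (- t\<^sup>2 / 2))) \<le> (\<rho> / 6 + 1 / 8) * \<bar>t\<bar> ^ 3"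
    and "cmod (char (distr P borel f) t) \<le> exp (- t\<^sup>2 / 4)"
proof -
  let ?\<phi> = "char (distr P borel f) t"
  have \<rho>: "0 \<le> \<rho>" unfolding \<rho>_def by (rule integral_nonneg_AE) auto
  have "\<bar>t\<bar> * (1 + \<rho>) \<le> 1" using assms(2) \<rho> by (simp add: field_simps)
  moreover have "0 \<le> \<rho> * \<bar>t\<bar>" using \<rho> by simp
  ultimately have "\<bar>t\<bar> \<le> 1 \<and> \<rho> * \<bar>t\<bar> \<le> 1"
    unfolding distrib_left mult.commute[of \<rho>] by auto
  then have t\<rho>: "\<bar>t\<bar> \<le> 1" "\<rho> * \<bar>t\<bar> \<le> 1" by auto
  note cube = abs_power3[of t]
  have "cmod (?\<phi> - (1 - t\<^sup>2 * 1 / 2)) \<le> (t\<^sup>2 / 6) * expectation (\<lambda>x. min (6 * (f x)\<^sup>2) (\<bar>t\<bar> * \<bar>f x\<bar>^3))"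
    by (rule char_approx3') (auto simp: f_int f2_int f_mean f_var)
  also have "\<dots> \<le> (t\<^sup>2 / 6) * expectation (\<lambda>x. \<bar>t\<bar> * \<bar>f x\<bar>^3)"
    by (intro mult_left_mono integral_mono') (auto intro!: integrable_mult_right f3_int)
  also have "\<dots> = \<rho> / 6 * \<bar>t\<bar> ^ 3" by (simp add: \<rho>_def cube)
  finally have 1: "cmod (?\<phi> - of_real (1 - t\<^sup>2 / 2)) \<le> \<rho> / 6 * \<bar>t\<bar> ^ 3" by simp
  have "\<bar>exp (- (t\<^sup>2 / 2)) - (1 - t\<^sup>2 / 2)\<bar> \<le> (t\<^sup>2 / 2)\<^sup>2 / 2"
    by (rule exp_minus_quadratic) simp
  also have "\<dots> = \<bar>t\<bar> * \<bar>t\<bar> ^ 3 / 8" by (simp add: cube power2_eq_square)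
  also have "\<dots> \<le> 1 * \<bar>t\<bar> ^ 3 / 8" using t\<rho> by (intro divide_right_mono mult_right_mono) auto
  finally have 2: "cmod (of_real (exp (- t\<^sup>2 / 2)) - of_real (1 - t\<^sup>2 / 2)) \<le> 1 / 8 * \<bar>t\<bar> ^ 3"
    by (simp only: of_real_diff[symmetric] norm_of_real) simp
  show "cmod (?\<phi> - of_real (exp (- t\<^sup>2 / 2))) \<le> (\<rho> / 6 + 1 / 8) * \<bar>t\<bar> ^ 3"
    using norm_triangle_ineq4[of "?\<phi> - of_real (1 - t\<^sup>2 / 2)" "of_real (exp (- t\<^sup>2 / 2)) - of_real (1 - t\<^sup>2 / 2)"] 1 2
    by (simp add: algebra_simps)
  have "t\<^sup>2 \<le> 1" using t\<rho>(1) by (simp add: abs_square_le_1)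
  have "cmod ?\<phi> \<le> cmod (of_real (1 - t\<^sup>2 / 2)) + \<rho> / 6 * \<bar>t\<bar> ^ 3"
    using norm_triangle_sub[of ?\<phi> "of_real (1 - t\<^sup>2 / 2)"] 1 by simp
  also have "\<dots> = (1 - t\<^sup>2 / 2) + (\<rho> * \<bar>t\<bar>) / 6 * t\<^sup>2"
    unfolding norm_of_real using \<open>t\<^sup>2 \<le> 1\<close> by (simp add: cube)
  also have "\<dots> \<le> (1 - t\<^sup>2 / 2) + 1 / 6 * t\<^sup>2"
    using t\<rho> by (intro add_left_mono mult_right_mono) auto
  also have "\<dots> \<le> 1 + (- t\<^sup>2 / 4)" by simp
  also have "\<dots> \<le> exp (- t\<^sup>2 / 4)" by (rule exp_ge_add_one_self)
  finally show "cmod ?\<phi> \<le> exp (- t\<^sup>2 / 4)" .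
qed

text \<open>At \<open>s = t / sqrt n\<close> the error of one factor is a multiple of
  \<open>\<bar>s\<bar> ^ 3\<close>, and the \<open>n\<close>-th power multiplies it by
  \<open>n\<close>. One factor \<open>\<bar>t\<bar>\<close> is kept apart because the inversion
  kernel divides by it.\<close>

lemma char_norm_sum_law_diff:
  defines "\<rho> \<equiv> expectation (\<lambda>x. \<bar>f x\<bar> ^ 3)"
  assumes n: "2 \<le> n" and t: "\<bar>t\<bar> \<le> 1 / (1 + \<rho>) * sqrt (real n)"
  shows "cmod (char (norm_sum_law n) t - of_real (exp (- t\<^sup>2 / 2)))
     \<le> \<bar>t\<bar> * ((\<rho> / 6 + 1 / 8) / sqrt (real n) * (t\<^sup>2 * exp (- t\<^sup>2 / 8)))"
proof -
  define s where "s = t / sqrt (real n)"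
  let ?\<phi> = "char (distr P borel f) s"
  have n0: "0 < sqrt (real n)" using n by simp
  have s: "\<bar>s\<bar> \<le> 1 / (1 + \<rho>)" using t n0 by (simp add: s_def field_simps)
  have ns: "real n * s\<^sup>2 = t\<^sup>2" using n by (simp add: s_def power_divide)
  note b = char_summand_bounds[OF s[unfolded \<rho>_def], folded \<rho>_def]
  have e: "cmod (of_real (exp (- s\<^sup>2 / 2))) \<le> exp (- s\<^sup>2 / 4)" by simp
  have pe: "of_real (exp (- t\<^sup>2 / 2)) = (of_real (exp (- s\<^sup>2 / 2)) :: complex) ^ n"
    by (simp flip: of_real_power exp_of_nat_mult ns)
  have "cmod (char (norm_sum_law n) t - of_real (exp (- t\<^sup>2 / 2)))
      \<le> real n * exp (- s\<^sup>2 / 4) ^ (n - 1) * cmod (?\<phi> - of_real (exp (- s\<^sup>2 / 2)))"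
    unfolding char_norm_sum_law pe s_def[symmetric] by (rule norm_power_diff_le[OF b(2) e])
  also have "\<dots> \<le> real n * exp (- t\<^sup>2 / 8) * ((\<rho> / 6 + 1 / 8) * \<bar>s\<bar> ^ 3)"
  proof (intro mult_mono b(1))
    \<comment> \<open>Only \<open>n - 1\<close> factors decay; \<open>n - 1 \<ge> n / 2\<close>
      halves the exponent from \<open>t\<^sup>2 / 4\<close> to \<open>t\<^sup>2 / 8\<close>.\<close>
    have "real n / 2 \<le> real (n - 1)" using n by (simp add: of_nat_diff)
    then have "real n / 2 * (s\<^sup>2 / 4) \<le> real (n - 1) * (s\<^sup>2 / 4)" by (rule mult_right_mono) simp
    then have "real (n - 1) * (- s\<^sup>2 / 4) \<le> - t\<^sup>2 / 8" unfolding ns[symmetric] by simp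
    then show "exp (- s\<^sup>2 / 4) ^ (n - 1) \<le> exp (- t\<^sup>2 / 8)"
      by (simp flip: exp_of_nat_mult)
  qed auto
  also have "\<dots> = exp (- t\<^sup>2 / 8) * (\<rho> / 6 + 1 / 8) * (real n * \<bar>s\<bar> ^ 3)" by simp
  also have "real n * \<bar>s\<bar> ^ 3 = (real n * s\<^sup>2) * \<bar>s\<bar>"
    by (simp add: abs_power3)
  also have "\<dots> = t\<^sup>2 * (\<bar>t\<bar> / sqrt (real n))" unfolding ns by (simp add: s_def)
  finally show ?thesis by (simp add: mult_ac)
qed

text \<open>The characteristic function is controlled only for
  \<open>\<bar>t\<bar> \<le> c * sqrt n\<close>; beyond, the smoothing factor has to make the
  integrand negligible. For a normal kernel this takes a width exceeding \<open>1 / sqrt n\<close>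
  by a factor \<open>sqrt (ln n)\<close>, and cutting its tails costs another such factor. The
  product is the logarithmic loss.\<close>

theorem berry_esseen_log:
  "\<exists>C>0. \<forall>n\<ge>3. \<forall>b. \<bar>cdf (norm_sum_law n) b - cdf (gauss 1) b\<bar> \<le> C * ln (real n) / sqrt (real n)"
proof -
  define \<rho> where "\<rho> = expectation (\<lambda>x. \<bar>f x\<bar> ^ 3)"
  have \<rho>: "0 \<le> \<rho>" unfolding \<rho>_def by (rule integral_nonneg_AE) auto
  define c where "c = 1 / (1 + \<rho>)"
  define K where "K = \<rho> / 6 + 1 / 8"
  define J where "J = integral\<^sup>L lborel (\<lambda>t::real. t\<^sup>2 * exp (- t\<^sup>2 / 8))"
  have c: "0 < c" and K: "0 < K" using \<rho> by (auto simp: c_def K_def)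
  have Jint: "integrable lborel (\<lambda>t::real. t\<^sup>2 * exp (- t\<^sup>2 / 8))"
    using integrable_mult_right[OF integrable_normal_moment[of 2 0 2], of "sqrt (8 * pi)"]
    by (simp add: normal_density_def mult_ac)
  have J: "0 \<le> J" unfolding J_def by (rule integral_nonneg_AE) auto
  define C where "C = K * J + 6 + 4 / c"
  have C: "0 < C" using c K J by (simp add: C_def add_nonneg_pos)
  have "\<bar>cdf (norm_sum_law n) b - cdf (gauss 1) b\<bar> \<le> C * ln (real n) / sqrt (real n)" if n: "3 \<le> n" for n b
  proof -
    define l where "l = ln (real n)"
    define r where "r = sqrt (real n)"
    have "ln (exp 1) \<le> ln (real n)" using n exp_le by (subst ln_le_cancel_iff) auto
    then have l: "1 \<le> l" by (simp add: l_def)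
    have r: "1 < r" and rr: "r * r = real n" using n by (auto simp: r_def)
    \<comment> \<open>For \<open>\<bar>t\<bar> \<ge> c * r\<close> this gives \<open>(\<delta> *
      t)\<^sup>2 / 2 \<ge> l + \<delta>\<^sup>2 / 4 * t\<^sup>2\<close>: a gain of
      \<open>1 / n\<close>, with a Gaussian factor left over for integrability.\<close>
    define \<delta> where "\<delta> = 2 * sqrt l / (c * r)"
    have \<delta>: "0 < \<delta>" using l r c by (simp add: \<delta>_def)
    have \<delta>2: "\<delta>\<^sup>2 = 4 * l / (c\<^sup>2 * real n)" using l by (simp add: \<delta>_def power_divide power_mult_distrib r_def)
    \<comment> \<open>A shift of \<open>sqrt l\<close> standard deviations of the noise, so that
      each tail term is \<open>1 / r\<close>. The shift itself, of order \<open>l / r\<close>, is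
      the dominant error.\<close>
    define a where "a = \<delta> * sqrt l"
    have a: "0 \<le> a" "a = 2 * l / (c * r)" using \<delta> l c r by (auto simp: a_def \<delta>_def)
    have ea: "exp (- (a / \<delta>)\<^sup>2 / 2) = 1 / r"
    proof -
      have "(a / \<delta>)\<^sup>2 = l" using \<delta> l by (simp add: a_def)
      then show ?thesis using n
        by (simp add: l_def r_def exp_minus powr_half_sqrt[symmetric] powr_def field_simps)
    qed
    \<comment> \<open>The first summand bounds the difference for
      \<open>\<bar>t\<bar> \<le> c * r\<close>, the second one beyond, where
      \<open>1 \<le> \<bar>t\<bar> / (c * r)\<close> supplies the factor
      \<open>\<bar>t\<bar>\<close>.\<close>
    define H where "H = (\<lambda>t::real. K / r * (t\<^sup>2 * exp (- t\<^sup>2 / 8)) + 2 / (c * r * real n) * exp (- (\<delta>\<^sup>2 / 4 * t\<^sup>2)))"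
    have Hb: "has_bochner_integral lborel H (K / r * J + 2 / (c * r * real n) * sqrt (pi / (\<delta>\<^sup>2 / 4)))"
      unfolding H_def J_def using \<delta>
      by (intro has_bochner_integral_add has_bochner_integral_mult_right integral_exp_minus_square
          has_bochner_integral_integrable Jint) simp
    then have Hint: "integrable lborel H" by (rule integrable.intros)
    have "(\<integral>t. H t \<partial>lborel) = K / r * J + 2 / (c * r * real n) * sqrt (pi / (\<delta>\<^sup>2 / 4))"
      using Hb by (rule has_bochner_integral_integral_eq)
    also have "sqrt (pi / (\<delta>\<^sup>2 / 4)) = 2 * sqrt pi / \<delta>"
      using \<delta> by (simp add: real_sqrt_divide real_sqrt_mult)
    also have "2 / (c * r * real n) * (2 * sqrt pi / \<delta>) = 2 * sqrt pi / (real n * sqrt l)"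
      using c r l n by (simp add: \<delta>_def field_simps)
    also have "\<dots> \<le> 4 / r"
    proof -
      have "sqrt pi \<le> sqrt 4" using pi_less_4 by (intro real_sqrt_le_mono) simp
      then have "2 * sqrt pi \<le> 4" by simp
      moreover have "r * 1 \<le> real n * sqrt l" unfolding rr[symmetric] using r l by (intro mult_mono) auto
      ultimately show ?thesis using r by (intro frac_le) auto
    qed
    finally have IH: "(\<integral>t. H t \<partial>lborel) \<le> (K * J + 4) / r" by (simp add: add_divide_distrib)
    have Hnn: "0 \<le> H t" for t using K r c by (simp add: H_def)
    have E: "\<bar>cdf (gauss_smooth \<delta> (norm_sum_law n)) u - cdf (gauss_smooth \<delta> (gauss 1)) u\<bar> \<le> (K * J + 4) / r" for u
    proof -
      note R = real_distribution_norm_sum_law[of n] and G = real_distribution_gauss[of 1]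
      have "\<bar>cdf (gauss_smooth \<delta> (norm_sum_law n)) u - cdf (gauss_smooth \<delta> (gauss 1)) u\<bar> \<le> (\<integral>t. H t \<partial>lborel) / pi"
      proof (rule cdf_diff_le_char_integral[OF _ _ _ _ Hint Hnn])
        fix t :: real
        let ?d = "cmod (char (norm_sum_law n) t - of_real (exp (- t\<^sup>2 / 2)))"
        have "cmod (char (gauss_smooth \<delta> (norm_sum_law n)) t - char (gauss_smooth \<delta> (gauss 1)) t)
           = cmod ((char (norm_sum_law n) t - of_real (exp (- t\<^sup>2 / 2))) * of_real (exp (- (\<delta> * t)\<^sup>2 / 2)))"
          by (simp add: char_gauss_smooth[OF R \<delta>] char_gauss_smooth[OF G \<delta>] char_gauss left_diff_distrib)
        also have "\<dots> = ?d * exp (- (\<delta> * t)\<^sup>2 / 2)"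
          by (simp add: norm_mult)
        also have "\<dots> \<le> \<bar>t\<bar> * H t"
        proof (cases "\<bar>t\<bar> \<le> c * r")
          case True
          have "?d * exp (- (\<delta> * t)\<^sup>2 / 2) \<le> ?d * 1" by (intro mult_left_mono) auto
          also have "?d * 1 \<le> \<bar>t\<bar> * (K / r * (t\<^sup>2 * exp (- t\<^sup>2 / 8)))"
            using char_norm_sum_law_diff[of n t] n True by (simp add: K_def c_def \<rho>_def r_def)
          also have "\<dots> \<le> \<bar>t\<bar> * H t" using c r by (intro mult_left_mono) (auto simp: H_def)
          finally show ?thesis .
        next
          case False
          interpret R: real_distribution "norm_sum_law n" by fact
          have "?d \<le> cmod (char (norm_sum_law n) t) + cmod (of_real (exp (- t\<^sup>2 / 2)))"
            by (rule norm_triangle_ineq4)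
          also have "\<dots> \<le> 1 + 1" by (intro add_mono R.cmod_char_le_1) auto
          finally have d: "?d \<le> 2" by simp
          have "(c * r)\<^sup>2 \<le> \<bar>t\<bar>\<^sup>2" using False c r by (intro power_mono) auto
          then have "(c * r)\<^sup>2 \<le> t\<^sup>2" by simp
          then have "\<delta>\<^sup>2 * (c * r)\<^sup>2 \<le> \<delta>\<^sup>2 * t\<^sup>2" by (intro mult_left_mono) auto
          moreover have "\<delta>\<^sup>2 * (c * r)\<^sup>2 = 4 * l" using c n by (simp add: \<delta>2 power_mult_distrib r_def)
          ultimately have "- (\<delta> * t)\<^sup>2 / 2 \<le> - l + - (\<delta>\<^sup>2 / 4 * t\<^sup>2)" by (simp add: power_mult_distrib)
          then have "exp (- (\<delta> * t)\<^sup>2 / 2) \<le> exp (- l) * exp (- (\<delta>\<^sup>2 / 4 * t\<^sup>2))"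
            by (simp only: exp_add[symmetric] exp_le_cancel_iff)
          also have "exp (- l) = 1 / real n" using n by (simp add: l_def exp_minus field_simps)
          finally have "?d * exp (- (\<delta> * t)\<^sup>2 / 2) \<le> 2 * (1 / real n * exp (- (\<delta>\<^sup>2 / 4 * t\<^sup>2)))"
            using d by (intro mult_mono) auto
          also have "\<dots> = c * r * (2 / (c * r * real n) * exp (- (\<delta>\<^sup>2 / 4 * t\<^sup>2)))"
            using c r by simp
          also have "\<dots> \<le> \<bar>t\<bar> * H t"
            using False c r K by (intro mult_mono) (auto simp: H_def)
          finally show ?thesis .
        qed
        finally show "cmod (char (gauss_smooth \<delta> (norm_sum_law n)) t - char (gauss_smooth \<delta> (gauss 1)) t) \<le> \<bar>t\<bar> * H t" .
      qed (use R G \<delta> in \<open>auto intro: real_distribution_gauss_smooth gauss_smooth_singleton\<close>)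
      also have "\<dots> \<le> (\<integral>t. H t \<partial>lborel) / 1"
        using pi_gt3 by (intro divide_left_mono integral_nonneg_AE) (auto simp: Hnn)
      finally show ?thesis using IH by simp
    qed
    have "\<bar>cdf (norm_sum_law n) b - cdf (gauss 1) b\<bar> \<le> (K * J + 4) / r + 2 * a + 2 * exp (- (a / \<delta>)\<^sup>2 / 2)"
      by (rule cdf_diff_le_gauss_smooth[OF real_distribution_norm_sum_law \<delta> a(1) E])
    also have "\<dots> = (K * J + 6 + 4 / c * l) / r"
      unfolding ea unfolding a(2) using r c by (simp add: field_simps)
    also have "\<dots> \<le> C * l / r"
    proof (intro divide_right_mono)
      have "(K * J + 6) * 1 \<le> (K * J + 6) * l" using K J l by (intro mult_left_mono) auto
      then show "K * J + 6 + 4 / c * l \<le> C * l" by (simp add: C_def algebra_simps)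
    qed (use r in simp)
    finally show ?thesis by (simp add: l_def r_def)
  qed
  then show ?thesis using C by blast
qed

end

section \<open>Rotation and tilting of Gaussian vectors\<close>

lemma sigma_finite_gauss: "0 < \<tau> \<Longrightarrow> sigma_finite_measure (gauss \<tau>)"
  using prob_space_gauss[of \<tau>] by (simp add: prob_space_imp_sigma_finite)

lemma product_sigma_finite_gauss: "0 < \<tau> \<Longrightarrow> product_sigma_finite (\<lambda>_::nat. gauss \<tau>)"
  by (simp add: product_sigma_finite_def sigma_finite_gauss)

lemma prob_space_PiM_gauss: "0 < \<tau> \<Longrightarrow> prob_space (PiM {..<n::nat} (\<lambda>_. gauss \<tau>))"
  by (intro prob_space_PiM prob_space_gauss)

lemma sets_PiM_gauss [measurable_cong]: "sets (PiM I (\<lambda>_. gauss \<tau>)) = sets (PiM I (\<lambda>_. borel))"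
  by (intro sets_PiM_cong) auto

text \<open>For \<open>a \<noteq> 0\<close> the rotation is done by two affine substitutions in one
  variable with Fubini in between: \<open>u = a * x + b * y\<close> for fixed \<open>y\<close>,
  where \<open>a\<^sup>2 + b\<^sup>2 = 1\<close> turns the second coordinate into
  \<open>(y - b * u) / a\<close>, and then that coordinate for fixed \<open>u\<close>. The factors
  \<open>1 / \<bar>a\<bar>\<close> and \<open>\<bar>a\<bar>\<close> cancel. For \<open>a = 0\<close>
  it is a quarter turn, made of a swap and reflections.\<close>

lemma nn_integral_lborel_rotate:
  fixes F :: "real \<times> real \<Rightarrow> ennreal"
  assumes [measurable]: "F \<in> borel_measurable (borel \<Otimes>\<^sub>M borel)"
    and ab: "a\<^sup>2 + b\<^sup>2 = 1"
  shows "(\<integral>\<^sup>+x. \<integral>\<^sup>+y. F (a * x + b * y, a * y - b * x) \<partial>lborel \<partial>lborel) = (\<integral>\<^sup>+x. \<integral>\<^sup>+y. F (x, y) \<partial>lborel \<partial>lborel)"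
proof (cases "a = 0")
  case False
  have "(\<integral>\<^sup>+x. \<integral>\<^sup>+y. F (a * x + b * y, a * y - b * x) \<partial>lborel \<partial>lborel)
     = (\<integral>\<^sup>+y. \<integral>\<^sup>+x. F (a * x + b * y, a * y - b * x) \<partial>lborel \<partial>lborel)"
    by (rule lborel_pair.Fubini'[where f="\<lambda>x y. F (a * x + b * y, a * y - b * x)", symmetric]) simp
  also have "\<dots> = (\<integral>\<^sup>+y. ennreal \<bar>1 / a\<bar> * (\<integral>\<^sup>+u. F (u, (y - b * u) / a) \<partial>lborel) \<partial>lborel)"
  proof (rule nn_integral_cong)
    fix y :: real
    have eq1: "a * (- b * y / a + 1 / a * u) + b * y = u" for u
      using False by (simp add: field_simps)
    have "a * y - b * (- b * y / a + 1 / a * u) = ((a\<^sup>2 + b\<^sup>2) * y - b * u) / a" for u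
      using False by (simp add: field_simps power2_eq_square)
    then have eq2: "a * y - b * (- b * y / a + 1 / a * u) = (y - b * u) / a" for u
      by (simp only: ab mult_1)
    show "(\<integral>\<^sup>+x. F (a * x + b * y, a * y - b * x) \<partial>lborel) = ennreal \<bar>1 / a\<bar> * (\<integral>\<^sup>+u. F (u, (y - b * u) / a) \<partial>lborel)"
      using False by (subst nn_integral_real_affine[where t="- b * y / a" and c="1 / a"]) (simp_all only: eq1 eq2, auto)
  qed
  also have "\<dots> = ennreal \<bar>1 / a\<bar> * (\<integral>\<^sup>+y. \<integral>\<^sup>+u. F (u, (y - b * u) / a) \<partial>lborel \<partial>lborel)"
    by (rule nn_integral_cmult) measurable
  also have "(\<integral>\<^sup>+y. \<integral>\<^sup>+u. F (u, (y - b * u) / a) \<partial>lborel \<partial>lborel) = (\<integral>\<^sup>+u. \<integral>\<^sup>+y. F (u, (y - b * u) / a) \<partial>lborel \<partial>lborel)"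
    by (rule lborel_pair.Fubini'[where f="\<lambda>u y. F (u, (y - b * u) / a)"]) simp
  also have "\<dots> = (\<integral>\<^sup>+u. ennreal \<bar>a\<bar> * (\<integral>\<^sup>+v. F (u, v) \<partial>lborel) \<partial>lborel)"
  proof (rule nn_integral_cong)
    fix u :: real
    have eq: "(b * u + a * v - b * u) / a = v" for v using False by simp
    show "(\<integral>\<^sup>+y. F (u, (y - b * u) / a) \<partial>lborel) = ennreal \<bar>a\<bar> * (\<integral>\<^sup>+v. F (u, v) \<partial>lborel)"
      using False by (subst nn_integral_real_affine[where t="b * u" and c=a]) (simp_all only: eq, auto)
  qed
  also have "\<dots> = ennreal \<bar>a\<bar> * (\<integral>\<^sup>+u. \<integral>\<^sup>+v. F (u, v) \<partial>lborel \<partial>lborel)"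
    by (rule nn_integral_cmult) measurable
  also have "ennreal \<bar>1 / a\<bar> * (ennreal \<bar>a\<bar> * (\<integral>\<^sup>+u. \<integral>\<^sup>+v. F (u, v) \<partial>lborel \<partial>lborel)) = (\<integral>\<^sup>+u. \<integral>\<^sup>+v. F (u, v) \<partial>lborel \<partial>lborel)"
    using False by (simp add: mult.assoc[symmetric] ennreal_mult[symmetric])
  finally show ?thesis .
next
  case True
  have b: "b * b = 1" using True ab by (simp add: power2_eq_square)
  then have b0: "b \<noteq> 0" "\<bar>b\<bar> = 1" using ab True abs_square_eq_1[of b] by auto
  have bb: "b * (b * v) = v" for v using b by (simp add: mult.assoc[symmetric])
  have "(\<integral>\<^sup>+x. \<integral>\<^sup>+y. F (a * x + b * y, a * y - b * x) \<partial>lborel \<partial>lborel) = (\<integral>\<^sup>+x. \<integral>\<^sup>+y. F (b * y, - b * x) \<partial>lborel \<partial>lborel)"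
    using True by simp
  also have "\<dots> = (\<integral>\<^sup>+x. \<integral>\<^sup>+y. F (y, - b * x) \<partial>lborel \<partial>lborel)"
    by (rule nn_integral_cong, subst nn_integral_real_affine[where t=0 and c=b]) (use b0 bb in auto)
  also have "\<dots> = (\<integral>\<^sup>+y. \<integral>\<^sup>+x. F (y, - b * x) \<partial>lborel \<partial>lborel)"
    by (rule lborel_pair.Fubini'[where f="\<lambda>y x. F (y, - b * x)"]) simp
  also have "\<dots> = (\<integral>\<^sup>+y. \<integral>\<^sup>+x. F (y, x) \<partial>lborel \<partial>lborel)"
    by (rule nn_integral_cong, subst nn_integral_real_affine[where t=0 and c="-b"]) (use b0 bb in auto)
  finally show ?thesis .
qed

text \<open>The product density depends on \<open>x\<^sup>2 + y\<^sup>2\<close> only, so the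
  invariance of Lebesgue measure carries over.\<close>

lemma nn_integral_gauss_rotate:
  fixes F :: "real \<times> real \<Rightarrow> ennreal"
  assumes \<tau>: "0 < \<tau>" and [measurable]: "F \<in> borel_measurable (borel \<Otimes>\<^sub>M borel)"
    and ab: "a\<^sup>2 + b\<^sup>2 = 1"
  shows "(\<integral>\<^sup>+x. \<integral>\<^sup>+y. F (a * x + b * y, a * y - b * x) \<partial>gauss \<tau> \<partial>gauss \<tau>) = (\<integral>\<^sup>+x. \<integral>\<^sup>+y. F (x, y) \<partial>gauss \<tau> \<partial>gauss \<tau>)"
proof -
  interpret G: sigma_finite_measure "gauss \<tau>" by (rule sigma_finite_gauss[OF \<tau>])
  define w where "w = (\<lambda>(x, y). ennreal (normal_density 0 \<tau> x * normal_density 0 \<tau> y))"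
  have [measurable]: "w \<in> borel_measurable (borel \<Otimes>\<^sub>M borel)" unfolding w_def by measurable
  have dens: "(\<integral>\<^sup>+x. \<integral>\<^sup>+y. H (x, y) \<partial>gauss \<tau> \<partial>gauss \<tau>) = (\<integral>\<^sup>+x. \<integral>\<^sup>+y. w (x, y) * H (x, y) \<partial>lborel \<partial>lborel)"
    if [measurable]: "H \<in> borel_measurable (borel \<Otimes>\<^sub>M borel)" for H :: "real \<times> real \<Rightarrow> ennreal"
  proof -
    have "(\<integral>\<^sup>+x. \<integral>\<^sup>+y. H (x, y) \<partial>gauss \<tau> \<partial>gauss \<tau>) = (\<integral>\<^sup>+x. ennreal (normal_density 0 \<tau> x) * (\<integral>\<^sup>+y. H (x, y) \<partial>gauss \<tau>) \<partial>lborel)"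
      by (rule nn_integral_gauss) measurable
    also have "\<dots> = (\<integral>\<^sup>+x. \<integral>\<^sup>+y. w (x, y) * H (x, y) \<partial>lborel \<partial>lborel)"
      by (intro nn_integral_cong)
        (simp add: nn_integral_gauss nn_integral_cmult[symmetric] w_def ennreal_mult mult.assoc)
    finally show ?thesis .
  qed
  have winv: "w (x, y) = w (a * x + b * y, a * y - b * x)" for x y
  proof -
    have "(a * x + b * y)\<^sup>2 + (a * y - b * x)\<^sup>2 = (a\<^sup>2 + b\<^sup>2) * (x\<^sup>2 + y\<^sup>2)"
      by (simp add: power2_eq_square algebra_simps)
    then have e: "(a * x + b * y)\<^sup>2 + (a * y - b * x)\<^sup>2 = x\<^sup>2 + y\<^sup>2" using ab by simp
    have "exp (- (u\<^sup>2 + v\<^sup>2) / (2 * \<tau>\<^sup>2)) = exp (- u\<^sup>2 / (2 * \<tau>\<^sup>2)) * exp (- v\<^sup>2 / (2 * \<tau>\<^sup>2))" for u v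
      by (simp add: exp_add[symmetric] add_divide_distrib diff_divide_distrib)
    then have "normal_density 0 \<tau> u * normal_density 0 \<tau> v
        = 1 / sqrt (2 * pi * \<tau>\<^sup>2) * (1 / sqrt (2 * pi * \<tau>\<^sup>2)) * exp (- (u\<^sup>2 + v\<^sup>2) / (2 * \<tau>\<^sup>2))" for u v
      by (simp only: normal_density_def diff_0_right) (simp only: mult_ac)
    then show ?thesis unfolding w_def by (simp add: e del: minus_add_distrib)
  qed
  have "(\<integral>\<^sup>+x. \<integral>\<^sup>+y. F (a * x + b * y, a * y - b * x) \<partial>gauss \<tau> \<partial>gauss \<tau>)
    = (\<integral>\<^sup>+x. \<integral>\<^sup>+y. w (x, y) * F (a * x + b * y, a * y - b * x) \<partial>lborel \<partial>lborel)"
    using dens[of "\<lambda>(x, y). F (a * x + b * y, a * y - b * x)"] by simp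
  also have "\<dots> = (\<integral>\<^sup>+x. \<integral>\<^sup>+y. w (a * x + b * y, a * y - b * x) * F (a * x + b * y, a * y - b * x) \<partial>lborel \<partial>lborel)"
    by (subst winv) rule
  also have "\<dots> = (\<integral>\<^sup>+x. \<integral>\<^sup>+y. w (x, y) * F (x, y) \<partial>lborel \<partial>lborel)"
    using nn_integral_lborel_rotate[of "\<lambda>z. w z * F z", OF _ ab] by simp
  also have "\<dots> = (\<integral>\<^sup>+x. \<integral>\<^sup>+y. F (x, y) \<partial>gauss \<tau> \<partial>gauss \<tau>)" by (rule dens[symmetric]) simp
  finally show ?thesis .
qed

lemma nn_integral_PiM_gauss_Suc:
  assumes \<tau>: "0 < \<tau>" and [measurable]: "f \<in> borel_measurable (PiM {..<Suc n} (\<lambda>_. borel))"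
  shows "(\<integral>\<^sup>+x. f x \<partial>PiM {..<Suc n} (\<lambda>_. gauss \<tau>)) = (\<integral>\<^sup>+y. \<integral>\<^sup>+x. f (x(n := y)) \<partial>PiM {..<n} (\<lambda>_. gauss \<tau>) \<partial>gauss \<tau>)"
proof -
  interpret product_sigma_finite "\<lambda>_::nat. gauss \<tau>" by (rule product_sigma_finite_gauss[OF \<tau>])
  have "f \<in> borel_measurable (PiM (insert n {..<n}) (\<lambda>_. gauss \<tau>))"
    unfolding lessThan_Suc[symmetric] by measurable
  from product_nn_integral_insert_rev[OF _ _ this] show ?thesis
    unfolding lessThan_Suc by simp
qed

text \<open>Rotating the coefficient vector onto one axis, one coordinate plane at a time.\<close>

lemma nn_integral_gauss_linear_quadratic:
  fixes F :: "real \<times> real \<Rightarrow> ennreal" and c :: "nat \<Rightarrow> real"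
  assumes \<tau>: "0 < \<tau>" and F: "F \<in> borel_measurable (borel \<Otimes>\<^sub>M borel)"
  shows "(\<integral>\<^sup>+z. F (\<Sum>i<Suc m. c i * z i, \<Sum>i<Suc m. (z i)\<^sup>2) \<partial>PiM {..<Suc m} (\<lambda>_. gauss \<tau>))
    = (\<integral>\<^sup>+z. \<integral>\<^sup>+v. F (sqrt (\<Sum>i<Suc m. (c i)\<^sup>2) * z, z\<^sup>2 + (\<Sum>i<m. (v i)\<^sup>2)) \<partial>PiM {..<m} (\<lambda>_. gauss \<tau>) \<partial>gauss \<tau>)"
  using F
proof (induction m arbitrary: F)
  case 0
  note [measurable] = 0
  \<comment> \<open>In one dimension only the sign of the coefficient has to change, by symmetry of
    the density.\<close>
  have neg: "(\<integral>\<^sup>+z. F (c 0 * z, z\<^sup>2) \<partial>gauss \<tau>) = (\<integral>\<^sup>+z. F (\<bar>c 0\<bar> * z, z\<^sup>2) \<partial>gauss \<tau>)"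
  proof (cases "0 \<le> c 0")
    case False
    have "(\<integral>\<^sup>+z. F (c 0 * z, z\<^sup>2) \<partial>gauss \<tau>) = (\<integral>\<^sup>+z. ennreal (normal_density 0 \<tau> z) * F (c 0 * z, z\<^sup>2) \<partial>lborel)"
      by (rule nn_integral_gauss) simp
    also have "\<dots> = (\<integral>\<^sup>+z. ennreal (normal_density 0 \<tau> z) * F (\<bar>c 0\<bar> * z, z\<^sup>2) \<partial>lborel)"
      using False by (subst nn_integral_real_affine[where t=0 and c="-1"]) (auto simp: normal_density_def)
    also have "\<dots> = (\<integral>\<^sup>+z. F (\<bar>c 0\<bar> * z, z\<^sup>2) \<partial>gauss \<tau>)"
      by (rule nn_integral_gauss[symmetric]) simp
    finally show ?thesis .
  qed simp
  show ?case
    by (subst nn_integral_PiM_gauss_Suc[OF \<tau>]) (simp_all add: neg PiM_empty)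
next
  case (Suc m)
  note [measurable] = Suc.prems
  interpret G: sigma_finite_measure "gauss \<tau>" by (rule sigma_finite_gauss[OF \<tau>])
  interpret P: prob_space "PiM {..<m} (\<lambda>_. gauss \<tau>)" by (rule prob_space_PiM_gauss[OF \<tau>])
  interpret GP: pair_sigma_finite "gauss \<tau>" "PiM {..<m} (\<lambda>_. gauss \<tau>)" ..
  interpret GG: pair_sigma_finite "gauss \<tau>" "gauss \<tau>" ..
  define A where "A = sqrt (\<Sum>i<Suc m. (c i)\<^sup>2)"
  define B where "B = c (Suc m)"
  define r where "r = sqrt (\<Sum>i<Suc (Suc m). (c i)\<^sup>2)"
  have A2: "A\<^sup>2 = (\<Sum>i<Suc m. (c i)\<^sup>2)" unfolding A_def by (rule real_sqrt_pow2) (simp add: sum_nonneg)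
  have r2: "r\<^sup>2 = A\<^sup>2 + B\<^sup>2" unfolding r_def A2 B_def by (subst real_sqrt_pow2, rule sum_nonneg) simp_all
  let ?P = "PiM {..<m} (\<lambda>_. gauss \<tau>)" and ?G = "gauss \<tau>"
  define S where "S = (\<lambda>v::nat \<Rightarrow> real. \<Sum>i<m. (v i)\<^sup>2)"
  have [measurable]: "S \<in> borel_measurable ?P" unfolding S_def by measurable
  have "(\<integral>\<^sup>+z. F (\<Sum>i<Suc (Suc m). c i * z i, \<Sum>i<Suc (Suc m). (z i)\<^sup>2) \<partial>PiM {..<Suc (Suc m)} (\<lambda>_. ?G))
    = (\<integral>\<^sup>+y. \<integral>\<^sup>+z. F ((\<Sum>i<Suc m. c i * z i) + B * y, (\<Sum>i<Suc m. (z i)\<^sup>2) + y\<^sup>2) \<partial>PiM {..<Suc m} (\<lambda>_. ?G) \<partial>?G)"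
    by (subst nn_integral_PiM_gauss_Suc[OF \<tau>]) (simp_all add: B_def)
  also have "\<dots> = (\<integral>\<^sup>+y. \<integral>\<^sup>+z. \<integral>\<^sup>+v. F (A * z + B * y, z\<^sup>2 + S v + y\<^sup>2) \<partial>?P \<partial>?G \<partial>?G)"
  proof (rule nn_integral_cong)
    fix y :: real
    show "(\<integral>\<^sup>+z. F ((\<Sum>i<Suc m. c i * z i) + B * y, (\<Sum>i<Suc m. (z i)\<^sup>2) + y\<^sup>2) \<partial>PiM {..<Suc m} (\<lambda>_. ?G))
       = (\<integral>\<^sup>+z. \<integral>\<^sup>+v. F (A * z + B * y, z\<^sup>2 + S v + y\<^sup>2) \<partial>?P \<partial>?G)"
      using Suc.IH[of "\<lambda>(p, q). F (p + B * y, q + y\<^sup>2)"] by (simp add: A_def S_def)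
  qed
  also have "\<dots> = (\<integral>\<^sup>+z. \<integral>\<^sup>+y. \<integral>\<^sup>+v. F (A * z + B * y, z\<^sup>2 + S v + y\<^sup>2) \<partial>?P \<partial>?G \<partial>?G)"
    by (rule GG.Fubini'[where f="\<lambda>z y. \<integral>\<^sup>+v. F (A * z + B * y, z\<^sup>2 + S v + y\<^sup>2) \<partial>?P"]) measurable
  \<comment> \<open>For \<open>r = 0\<close> there is no direction to rotate to, but then
    \<open>A = B = 0\<close> and both sides agree. Otherwise \<open>A / r\<close> and
    \<open>B / r\<close> are the cosine and sine of a rotation in the plane of \<open>z\<close> and
    \<open>y\<close>.\<close>
  also have "\<dots> = (\<integral>\<^sup>+z. \<integral>\<^sup>+y. \<integral>\<^sup>+v. F (r * z, z\<^sup>2 + y\<^sup>2 + S v) \<partial>?P \<partial>?G \<partial>?G)"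
  proof (cases "r = 0")
    case True
    then have "A = 0" "B = 0" using r2 by (auto simp: sum_power2_eq_zero_iff)
    then show ?thesis using True by (simp add: add_ac)
  next
    case False
    define H where "H = (\<lambda>(z, y). \<integral>\<^sup>+v. F (r * z, z\<^sup>2 + y\<^sup>2 + S v) \<partial>?P)"
    have H [measurable]: "H \<in> borel_measurable (borel \<Otimes>\<^sub>M borel)" unfolding H_def by measurable
    have "(A / r)\<^sup>2 + (B / r)\<^sup>2 = (A\<^sup>2 + B\<^sup>2) / r\<^sup>2" by (simp add: power_divide add_divide_distrib)
    then have ab: "(A / r)\<^sup>2 + (B / r)\<^sup>2 = 1" using False by (simp flip: r2)
    have e: "H (A / r * z + B / r * y, A / r * y - B / r * z) = (\<integral>\<^sup>+v. F (A * z + B * y, z\<^sup>2 + S v + y\<^sup>2) \<partial>?P)" for z y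
    proof -
      have "(p * z + q * y)\<^sup>2 + (p * y - q * z)\<^sup>2 = (p\<^sup>2 + q\<^sup>2) * (z\<^sup>2 + y\<^sup>2)" for p q :: real
        by (simp add: power2_eq_square algebra_simps)
      from this[of "A / r" "B / r"]
      have "(A / r * z + B / r * y)\<^sup>2 + (A / r * y - B / r * z)\<^sup>2 = ((A / r)\<^sup>2 + (B / r)\<^sup>2) * (z\<^sup>2 + y\<^sup>2)" .
      also have "\<dots> = z\<^sup>2 + y\<^sup>2" by (simp only: ab mult_1)
      finally have q: "(A / r * z + B / r * y)\<^sup>2 + (A / r * y - B / r * z)\<^sup>2 = z\<^sup>2 + y\<^sup>2" .
      have p: "r * (A / r * z + B / r * y) = A * z + B * y" using False by (simp add: field_simps)
      show ?thesis unfolding H_def prod.case p q by (simp add: add_ac)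
    qed
    show ?thesis using nn_integral_gauss_rotate[OF \<tau> H ab] unfolding e by (simp add: H_def)
  qed
  also have "\<dots> = (\<integral>\<^sup>+z. \<integral>\<^sup>+v. F (r * z, z\<^sup>2 + (\<Sum>i<Suc m. (v i)\<^sup>2)) \<partial>PiM {..<Suc m} (\<lambda>_. ?G) \<partial>?G)"
  proof (rule nn_integral_cong)
    fix z :: real
    show "(\<integral>\<^sup>+y. \<integral>\<^sup>+v. F (r * z, z\<^sup>2 + y\<^sup>2 + S v) \<partial>?P \<partial>?G) = (\<integral>\<^sup>+v. F (r * z, z\<^sup>2 + (\<Sum>i<Suc m. (v i)\<^sup>2)) \<partial>PiM {..<Suc m} (\<lambda>_. ?G))"
      by (subst nn_integral_PiM_gauss_Suc[OF \<tau>]) (simp_all add: S_def add_ac)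
  qed
  finally show ?case by (simp add: r_def)
qed

text \<open>The density of the standard Gaussian law relative to its dilation by \<open>sqrt r\<close> (exponential tilting).\<close>

lemma nn_integral_gauss_tilt:
  fixes F :: "real \<Rightarrow> ennreal"
  assumes r: "0 < r" and F: "F \<in> borel_measurable borel"
  shows "(\<integral>\<^sup>+v. F (\<Sum>i<m. (v i)\<^sup>2) \<partial>PiM {..<m} (\<lambda>_. gauss 1))
    = (\<integral>\<^sup>+v. ennreal (sqrt r ^ m * exp ((1 - r) / 2 * (\<Sum>i<m. (v i)\<^sup>2))) * F (r * (\<Sum>i<m. (v i)\<^sup>2)) \<partial>PiM {..<m} (\<lambda>_. gauss 1))"
  using F
proof (induction m arbitrary: F)
  case 0
  then show ?case by (simp add: PiM_empty)
next
  case (Suc m)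
  note [measurable] = Suc.prems
  let ?P = "PiM {..<m} (\<lambda>_. gauss 1)" and ?G = "gauss 1"
  interpret P: prob_space ?P by (rule prob_space_PiM_gauss) simp
  define S where "S = (\<lambda>v::nat \<Rightarrow> real. \<Sum>i<m. (v i)\<^sup>2)"
  have [measurable]: "S \<in> borel_measurable ?P" unfolding S_def by measurable
  \<comment> \<open>A single coordinate, by substituting \<open>sqrt r * y\<close> for
    \<open>y\<close>; the induction multiplies the weights.\<close>
  have one: "(\<integral>\<^sup>+y. h (y\<^sup>2) \<partial>?G) = (\<integral>\<^sup>+y. ennreal (sqrt r * exp ((1 - r) / 2 * y\<^sup>2)) * h (r * y\<^sup>2) \<partial>?G)"
    if [measurable]: "h \<in> borel_measurable borel" for h :: "real \<Rightarrow> ennreal"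
  proof -
    have d: "sqrt r * normal_density 0 1 (sqrt r * y) = normal_density 0 1 y * (sqrt r * exp ((1 - r) / 2 * y\<^sup>2))" for y
      using r by (simp add: std_normal_density_def power_mult_distrib field_simps exp_diff exp_minus exp_add[symmetric])
    have "(\<integral>\<^sup>+y. h (y\<^sup>2) \<partial>?G) = (\<integral>\<^sup>+y. ennreal (normal_density 0 1 y) * h (y\<^sup>2) \<partial>lborel)"
      by (rule nn_integral_gauss) simp
    also have "\<dots> = ennreal \<bar>sqrt r\<bar> * (\<integral>\<^sup>+y. ennreal (normal_density 0 1 (0 + sqrt r * y)) * h ((0 + sqrt r * y)\<^sup>2) \<partial>lborel)"
      using r by (subst nn_integral_real_affine[where t=0 and c="sqrt r"]) auto
    also have "\<dots> = (\<integral>\<^sup>+y. ennreal (sqrt r) * (ennreal (normal_density 0 1 (sqrt r * y)) * h (r * y\<^sup>2)) \<partial>lborel)"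
      using r by (subst nn_integral_cmult) (auto simp: power_mult_distrib)
    also have "\<dots> = (\<integral>\<^sup>+y. ennreal (normal_density 0 1 y) * (ennreal (sqrt r * exp ((1 - r) / 2 * y\<^sup>2)) * h (r * y\<^sup>2)) \<partial>lborel)"
      using r by (intro nn_integral_cong) (simp add: mult.assoc[symmetric] ennreal_mult[symmetric] d)
    also have "\<dots> = (\<integral>\<^sup>+y. ennreal (sqrt r * exp ((1 - r) / 2 * y\<^sup>2)) * h (r * y\<^sup>2) \<partial>?G)"
      by (rule nn_integral_gauss[symmetric]) simp
    finally show ?thesis .
  qed
  have "(\<integral>\<^sup>+v. F (\<Sum>i<Suc m. (v i)\<^sup>2) \<partial>PiM {..<Suc m} (\<lambda>_. ?G)) = (\<integral>\<^sup>+y. \<integral>\<^sup>+v. F (S v + y\<^sup>2) \<partial>?P \<partial>?G)"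
    by (subst nn_integral_PiM_gauss_Suc) (simp_all add: S_def)
  also have "\<dots> = (\<integral>\<^sup>+y. \<integral>\<^sup>+v. ennreal (sqrt r ^ m * exp ((1 - r) / 2 * S v)) * F (r * S v + y\<^sup>2) \<partial>?P \<partial>?G)"
    using Suc.IH[of "\<lambda>s. F (s + y\<^sup>2)" for y] by (simp add: S_def)
  also have "\<dots> = (\<integral>\<^sup>+y. ennreal (sqrt r * exp ((1 - r) / 2 * y\<^sup>2)) * (\<integral>\<^sup>+v. ennreal (sqrt r ^ m * exp ((1 - r) / 2 * S v)) * F (r * S v + r * y\<^sup>2) \<partial>?P) \<partial>?G)"
    by (rule one) measurable
  also have "\<dots> = (\<integral>\<^sup>+y. \<integral>\<^sup>+v. ennreal (sqrt r ^ Suc m * exp ((1 - r) / 2 * (S v + y\<^sup>2))) * F (r * (S v + y\<^sup>2)) \<partial>?P \<partial>?G)"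
  proof (rule nn_integral_cong)
    fix y :: real
    have "ennreal (sqrt r * exp ((1 - r) / 2 * y\<^sup>2)) * (ennreal (sqrt r ^ m * exp ((1 - r) / 2 * S v)) * F (r * S v + r * y\<^sup>2))
        = ennreal (sqrt r ^ Suc m * exp ((1 - r) / 2 * (S v + y\<^sup>2))) * F (r * (S v + y\<^sup>2))" for v
    proof -
      have "(sqrt r * exp ((1 - r) / 2 * y\<^sup>2)) * (sqrt r ^ m * exp ((1 - r) / 2 * S v)) = sqrt r ^ Suc m * exp ((1 - r) / 2 * (S v + y\<^sup>2))"
        by (simp add: distrib_left exp_add)
      then have "ennreal (sqrt r * exp ((1 - r) / 2 * y\<^sup>2)) * ennreal (sqrt r ^ m * exp ((1 - r) / 2 * S v)) = ennreal (sqrt r ^ Suc m * exp ((1 - r) / 2 * (S v + y\<^sup>2)))"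
        using r by (subst ennreal_mult[symmetric]) auto
      then show ?thesis by (simp only: mult.assoc[symmetric] distrib_left)
    qed
    then show "ennreal (sqrt r * exp ((1 - r) / 2 * y\<^sup>2)) * (\<integral>\<^sup>+v. ennreal (sqrt r ^ m * exp ((1 - r) / 2 * S v)) * F (r * S v + r * y\<^sup>2) \<partial>?P)
        = (\<integral>\<^sup>+v. ennreal (sqrt r ^ Suc m * exp ((1 - r) / 2 * (S v + y\<^sup>2))) * F (r * (S v + y\<^sup>2)) \<partial>?P)"
      by (subst nn_integral_cmult[symmetric]) simp_all
  qed
  also have "\<dots> = (\<integral>\<^sup>+v. ennreal (sqrt r ^ Suc m * exp ((1 - r) / 2 * (\<Sum>i<Suc m. (v i)\<^sup>2))) * F (r * (\<Sum>i<Suc m. (v i)\<^sup>2)) \<partial>PiM {..<Suc m} (\<lambda>_. ?G))"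
    by (subst nn_integral_PiM_gauss_Suc) (simp_all add: S_def)
  finally show ?case .
qed

section \<open>Sums of squares\<close>

text \<open>On the interval the density is at least its value at \<open>m\<close>, and
  \<open>sqrt (2 * pi) \<le> 3\<close>.\<close>

lemma gauss_Ioc_ge:
  assumes "a \<le> b" "\<bar>a\<bar> \<le> m" "\<bar>b\<bar> \<le> m"
  shows "(b - a) * exp (- m\<^sup>2 / 2) / 3 \<le> measure (gauss 1) {a<..b}"
proof -
  interpret G: prob_space "gauss 1" by (rule prob_space_gauss) simp
  have "ennreal ((b - a) * exp (- m\<^sup>2 / 2) / 3) = (\<integral>\<^sup>+x. ennreal (exp (- m\<^sup>2 / 2) / 3) * indicator {a<..b} x \<partial>lborel)"
    using assms(1) by (subst nn_integral_cmult_indicator) (auto simp: ennreal_mult[symmetric])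
  also have "\<dots> \<le> (\<integral>\<^sup>+x. ennreal (normal_density 0 1 x) * indicator {a<..b} x \<partial>lborel)"
  proof (rule nn_integral_mono)
    fix x :: real
    have "exp (- m\<^sup>2 / 2) / 3 \<le> normal_density 0 1 x" if "x \<in> {a<..b}"
    proof -
      have "\<bar>x\<bar> \<le> m" using that assms by auto
      then have "x\<^sup>2 \<le> m\<^sup>2" using power_mono[of "\<bar>x\<bar>" m 2] by simp
      then have 1: "exp (- m\<^sup>2 / 2) \<le> exp (- x\<^sup>2 / 2)" by simp
      have "sqrt (2 * pi) \<le> sqrt (3\<^sup>2)" using pi_less_4 by (intro real_sqrt_le_mono) simp
      then have "exp (- m\<^sup>2 / 2) / 3 \<le> exp (- x\<^sup>2 / 2) / sqrt (2 * pi)"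
        using 1 by (intro frac_le) auto
      then show ?thesis by (simp add: std_normal_density_def)
    qed
    then show "ennreal (exp (- m\<^sup>2 / 2) / 3) * indicator {a<..b} x \<le> ennreal (normal_density 0 1 x) * indicator {a<..b} x"
      by (auto split: split_indicator intro!: ennreal_leI)
  qed
  also have "\<dots> = emeasure (gauss 1) {a<..b}"
    unfolding gauss_def by (subst emeasure_density) auto
  finally show ?thesis by (simp add: G.emeasure_eq_measure)
qed

lemma Qfun_eq: "Qfun x = 1 - cdf (gauss 1) x"
proof -
  interpret G: real_distribution "gauss 1" by (rule real_distribution_gauss) simp
  have "{x<..} = space (gauss 1) - {..x}" by auto
  then show ?thesis unfolding Qfun_def std_gauss_eq cdf_def by (simp only:) (rule G.prob_compl, simp)
qed

text \<open>\<open>Qinv\<close> is a definite description, so existence and uniqueness are both due: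
  the first follows from continuity (no atoms) and the intermediate value theorem, the second from
  positivity of the density.\<close>

lemma Qfun_Qinv:
  assumes "0 < e" "e < 1"
  shows "Qfun (Qinv e) = e"
proof -
  interpret G: real_distribution "gauss 1" by (rule real_distribution_gauss) simp
  have cont: "isCont (cdf (gauss 1)) x" for x
    using G.isCont_cdf gauss_singleton by blast
  have strict: "cdf (gauss 1) x < cdf (gauss 1) y" if "x < y" for x y
  proof -
    have "0 < (y - x) * exp (- (max \<bar>x\<bar> \<bar>y\<bar>)\<^sup>2 / 2) / 3" using that by simp
    also have "\<dots> \<le> measure (gauss 1) {x<..y}" using that by (intro gauss_Ioc_ge) auto
    finally show ?thesis using G.cdf_diff_eq[OF that] by simp
  qed
  have "\<forall>\<^sub>F x in at_bot. cdf (gauss 1) x < 1 - e"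
    using G.cdf_lim_at_bot assms by (intro order_tendstoD(2)[where y=0]) auto
  then obtain a where a: "cdf (gauss 1) a < 1 - e" by (auto simp: eventually_at_bot_linorder)
  have "\<forall>\<^sub>F x in at_top. 1 - e < cdf (gauss 1) x"
    using G.cdf_lim_at_top_prob assms by (intro order_tendstoD(1)[where y=1]) auto
  then obtain b where b: "1 - e < cdf (gauss 1) b" by (auto simp: eventually_at_top_linorder)
  have "a \<le> b" using a b G.cdf_nondecreasing[of b a] by (cases "a \<le> b") auto
  then obtain x where x: "cdf (gauss 1) x = 1 - e"
    using IVT[of "cdf (gauss 1)" a "1 - e" b] a b cont by auto
  have "\<exists>!x. Qfun x = e"
  proof (rule ex1I[of _ x])
    show "Qfun x = e" using x by (simp add: Qfun_eq)
  next
    fix y assume "Qfun y = e"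
    then have "cdf (gauss 1) y = cdf (gauss 1) x" using x by (simp add: Qfun_eq)
    then show "y = x" using strict[of x y] strict[of y x] by (cases x y rule: linorder_cases) auto
  qed
  then show ?thesis unfolding Qinv_def by (rule theI')
qed

text \<open>Within distance one of \<open>q\<close> the normal density stays above a constant
  depending on \<open>q\<close> only. This slope converts errors in probability into shifts of the
  quantile.\<close>

lemma Qfun_shift:
  assumes "0 \<le> h" "h \<le> 1"
  shows "Qfun (q + h) \<le> Qfun q - h * (exp (- (\<bar>q\<bar> + 1)\<^sup>2 / 2) / 3)"
    and "Qfun q + h * (exp (- (\<bar>q\<bar> + 1)\<^sup>2 / 2) / 3) \<le> Qfun (q - h)"
proof -
  interpret G: real_distribution "gauss 1" by (rule real_distribution_gauss) simp
  have d: "cdf (gauss 1) y - cdf (gauss 1) x = measure (gauss 1) {x<..y}" if "x \<le> y" for x y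
    using that G.cdf_diff_eq[of x y] by (cases "x = y") auto
  show "Qfun (q + h) \<le> Qfun q - h * (exp (- (\<bar>q\<bar> + 1)\<^sup>2 / 2) / 3)"
  proof -
    have "(q + h - q) * exp (- (\<bar>q\<bar> + 1)\<^sup>2 / 2) / 3 \<le> measure (gauss 1) {q<..q + h}"
      using assms by (intro gauss_Ioc_ge) auto
    then show ?thesis using d[of q "q + h"] assms by (simp add: Qfun_eq)
  qed
  show "Qfun q + h * (exp (- (\<bar>q\<bar> + 1)\<^sup>2 / 2) / 3) \<le> Qfun (q - h)"
  proof -
    have "(q - (q - h)) * exp (- (\<bar>q\<bar> + 1)\<^sup>2 / 2) / 3 \<le> measure (gauss 1) {q - h<..q}"
      using assms by (intro gauss_Ioc_ge) auto
    then show ?thesis using d[of "q - h" q] assms by (simp add: Qfun_eq)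
  qed
qed

section \<open>Normal approximation for sums of squares\<close>

lemma integrable_square_of_power4:
  fixes P :: "real measure"
  assumes "finite_measure P" "sets P = sets borel" "integrable P (\<lambda>x. x ^ 4)"
  shows "integrable P (\<lambda>x. x\<^sup>2)"
proof -
  interpret finite_measure P by fact
  have [measurable_cong]: "sets P = sets borel" by fact
  have "integrable P (\<lambda>x. 1 + x ^ 4)" using assms(3) by simp
  then show ?thesis
  proof (rule Bochner_Integration.integrable_bound)
    have "norm (x\<^sup>2) \<le> norm (1 + x ^ 4)" for x :: real
    proof -
      have "0 \<le> (x\<^sup>2 - 1)\<^sup>2" by simp
      then have "2 * x\<^sup>2 \<le> 1 + x ^ 4" by (simp add: power2_diff)
      moreover have "0 \<le> x\<^sup>2" by simp
      ultimately have "x\<^sup>2 \<le> 1 + x ^ 4" by linarith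
      then show ?thesis by simp
    qed
    then show "AE x in P. norm (x\<^sup>2) \<le> norm (1 + x ^ 4)" by simp
  qed simp
qed

text \<open>The difference of two nonnegative numbers is in modulus at most the larger one, so the
  sixth moment of \<open>x\<close> controls the third absolute moment of
  \<open>x\<^sup>2 - s2\<close>. The lemma serves the source and, with moments \<open>1\<close> and
  \<open>3\<close>, chi-square sums.\<close>

lemma sum_squares_berry_esseen:
  fixes P :: "real measure"
  defines "s2 \<equiv> \<integral>x. x\<^sup>2 \<partial>P" and "z \<equiv> \<integral>x. x ^ 4 \<partial>P"
  assumes P: "prob_space P" and sP: "sets P = sets borel"
    and i4: "integrable P (\<lambda>x. x ^ 4)" and i6: "integrable P (\<lambda>x. x ^ 6)" and pos: "s2\<^sup>2 < z"
  shows "\<exists>C>0. \<forall>n\<ge>3. \<forall>b. \<bar>measure (PiM {..<n} (\<lambda>_. P)) {x \<in> space (PiM {..<n} (\<lambda>_. P)).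
     b * sqrt (real n * (z - s2\<^sup>2)) < (\<Sum>i<n. (x i)\<^sup>2) - real n * s2} - Qfun b\<bar> \<le> C * ln (real n) / sqrt (real n)"
proof -
  interpret prob_space P by fact
  have [measurable_cong]: "sets P = sets borel" by fact
  have i2: "integrable P (\<lambda>x. x\<^sup>2)" using integrable_square_of_power4[OF _ sP i4] finite_measure_axioms by simp
  define d where "d = sqrt (z - s2\<^sup>2)"
  have d: "0 < d" "d\<^sup>2 = z - s2\<^sup>2" using pos by (auto simp: d_def)
  have s2: "0 \<le> s2" unfolding s2_def by (rule integral_nonneg_AE) auto
  define f where "f = (\<lambda>x::real. (x\<^sup>2 - s2) / d)"
  have sq: "(x\<^sup>2 - s2)\<^sup>2 = x ^ 4 - 2 * s2 * x\<^sup>2 + s2\<^sup>2" for x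
    by (simp add: power2_diff)
  have "expectation (\<lambda>x. x ^ 4 - 2 * s2 * x\<^sup>2 + s2\<^sup>2) = z - 2 * s2 * s2 + s2\<^sup>2"
    using i2 i4 by (simp add: s2_def[symmetric] z_def[symmetric] prob_space)
  then have ex: "expectation (\<lambda>x. x ^ 4 - 2 * s2 * x\<^sup>2 + s2\<^sup>2) = z - s2\<^sup>2"
    by (simp add: power2_eq_square)
  have f2: "(f x)\<^sup>2 = (x ^ 4 - 2 * s2 * x\<^sup>2 + s2\<^sup>2) / d\<^sup>2" for x unfolding f_def power_divide sq ..
  interpret F: standardized_summand P f
  proof
    show "f \<in> borel_measurable P" unfolding f_def by measurable
    show "integrable P f" unfolding f_def using i2 by simp
    show "integrable P (\<lambda>x. (f x)\<^sup>2)" unfolding f2 using i2 i4 by simp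
    show "expectation f = 0" unfolding f_def using i2 by (simp add: s2_def prob_space)
    show "expectation (\<lambda>x. (f x)\<^sup>2) = 1"
      unfolding f2 using d pos by (simp add: ex)
    show "integrable P (\<lambda>x. \<bar>f x\<bar> ^ 3)"
    proof (rule Bochner_Integration.integrable_bound)
      show "integrable P (\<lambda>x. (x ^ 6 + s2 ^ 3) / d ^ 3)" using i6 by simp
      have "\<bar>x\<^sup>2 - s2\<bar> ^ 3 \<le> x ^ 6 + s2 ^ 3" for x
      proof (cases "s2 \<le> x\<^sup>2")
        case True
        then have "\<bar>x\<^sup>2 - s2\<bar> ^ 3 \<le> (x\<^sup>2) ^ 3" using s2 by (intro power_mono) auto
        also have "\<dots> \<le> x ^ 6 + s2 ^ 3" using s2 by simp
        finally show ?thesis .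
      next
        case False
        then have "\<bar>x\<^sup>2 - s2\<bar> ^ 3 \<le> s2 ^ 3" by (intro power_mono) auto
        also have "\<dots> \<le> x ^ 6 + s2 ^ 3" by simp
        finally show ?thesis .
      qed
      then show "AE x in P. norm (\<bar>f x\<bar> ^ 3) \<le> norm ((x ^ 6 + s2 ^ 3) / d ^ 3)"
        using d s2 by (auto simp: f_def power_divide power_abs intro!: divide_right_mono)
    qed (simp add: f_def)
  qed
  obtain C where C: "C > 0" "\<And>n b. n \<ge> 3 \<Longrightarrow> \<bar>cdf (F.norm_sum_law n) b - cdf (gauss 1) b\<bar> \<le> C * ln (real n) / sqrt (real n)"
    using F.berry_esseen_log by blast
  have "\<bar>measure (PiM {..<n} (\<lambda>_. P)) {x \<in> space (PiM {..<n} (\<lambda>_. P)).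
     b * sqrt (real n * (z - s2\<^sup>2)) < (\<Sum>i<n. (x i)\<^sup>2) - real n * s2} - Qfun b\<bar> \<le> C * ln (real n) / sqrt (real n)"
    if n: "n \<ge> 3" for n b
  proof -
    let ?N = "PiM {..<n} (\<lambda>_. P)"
    interpret N: prob_space ?N by (rule prob_space_PiM) (rule prob_space_axioms)
    have s: "(\<Sum>i<n. f (x i)) / sqrt (real n) = ((\<Sum>i<n. (x i)\<^sup>2) - real n * s2) / (d * sqrt (real n))" for x
      by (simp add: f_def sum_divide_distrib[symmetric] sum_subtractf)
    have "cdf (F.norm_sum_law n) b = measure ?N {x \<in> space ?N. (\<Sum>i<n. f (x i)) / sqrt (real n) \<le> b}"
      unfolding cdf_def F.norm_sum_law_def by (subst measure_distr) (auto intro!: arg_cong2[where f=measure])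
    also have "{x \<in> space ?N. (\<Sum>i<n. f (x i)) / sqrt (real n) \<le> b} = space ?N - {x \<in> space ?N.
     b * sqrt (real n * (z - s2\<^sup>2)) < (\<Sum>i<n. (x i)\<^sup>2) - real n * s2}"
      unfolding s using n d(1) by (auto simp: pos_divide_le_eq real_sqrt_mult d_def mult_ac)
    also have "measure ?N \<dots> = 1 - measure ?N {x \<in> space ?N.
     b * sqrt (real n * (z - s2\<^sup>2)) < (\<Sum>i<n. (x i)\<^sup>2) - real n * s2}"
      by (rule N.prob_compl) measurable
    finally show ?thesis using C(2)[OF n, of b] by (simp add: Qfun_eq abs_le_iff)
  qed
  then show ?thesis using C(1) by blast
qed

text \<open>The case of a constant modulus, as for a source with two opposite values: the
  nonnegative variable \<open>(x\<^sup>2 - s2)\<^sup>2\<close> has expectation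
  \<open>z - s2\<^sup>2 \<le> 0\<close>.\<close>

lemma AE_sum_squares_of_zero_variance:
  fixes P :: "real measure"
  defines "s2 \<equiv> \<integral>x. x\<^sup>2 \<partial>P" and "z \<equiv> \<integral>x. x ^ 4 \<partial>P"
  assumes P: "prob_space P" and sP: "sets P = sets borel"
    and i4: "integrable P (\<lambda>x. x ^ 4)" and zero: "z \<le> s2\<^sup>2"
  shows "AE x in PiM {..<n} (\<lambda>_. P). (\<Sum>i<n. (x i)\<^sup>2) = real n * s2"
proof -
  interpret prob_space P by fact
  have [measurable_cong]: "sets P = sets borel" by fact
  have i2: "integrable P (\<lambda>x. x\<^sup>2)" using integrable_square_of_power4[OF _ sP i4] finite_measure_axioms by simp
  have sq: "(x\<^sup>2 - s2)\<^sup>2 = x ^ 4 - 2 * s2 * x\<^sup>2 + s2\<^sup>2" for x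
    by (simp add: power2_diff)
  have "expectation (\<lambda>x. x ^ 4 - 2 * s2 * x\<^sup>2 + s2\<^sup>2) = z - 2 * s2 * s2 + s2\<^sup>2"
    using i2 i4 by (simp add: s2_def[symmetric] z_def[symmetric] prob_space)
  then have ex: "expectation (\<lambda>x. x ^ 4 - 2 * s2 * x\<^sup>2 + s2\<^sup>2) = z - s2\<^sup>2"
    by (simp add: power2_eq_square)
  have int: "integrable P (\<lambda>x. (x\<^sup>2 - s2)\<^sup>2)" unfolding sq using i2 i4 by simp
  have "expectation (\<lambda>x. (x\<^sup>2 - s2)\<^sup>2) = z - s2\<^sup>2"
    unfolding sq by (rule ex)
  moreover have "0 \<le> expectation (\<lambda>x. (x\<^sup>2 - s2)\<^sup>2)" by (rule integral_nonneg_AE) auto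
  ultimately have "expectation (\<lambda>x. (x\<^sup>2 - s2)\<^sup>2) = 0" using zero by simp
  then have "AE x in P. x\<^sup>2 = s2"
    using integral_nonneg_eq_0_iff_AE[OF int] by simp
  then have "AE x in PiM {..<n} (\<lambda>_. P). (x i)\<^sup>2 = s2" if "i < n" for i
    using that by (intro AE_PiM_component[where P="\<lambda>y. y\<^sup>2 = s2"]) (auto intro: prob_space_axioms)
  then have "AE x in PiM {..<n} (\<lambda>_. P). \<forall>i\<in>{..<n}. (x i)\<^sup>2 = s2"
    by (intro AE_finite_allI) auto
  then show ?thesis by eventually_elim simp
qed

section \<open>From covering probabilities to codebook sizes\<close>

locale memoryless_source = prob_space P for P :: "real measure" +
  fixes s2 z :: real
  assumes sets_P: "sets P = sets borel"
    and int4: "integrable P (\<lambda>x. x ^ 4)" and int6: "integrable P (\<lambda>x. x ^ 6)"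
    and s2_eq: "s2 = (\<integral>x. x\<^sup>2 \<partial>P)" and z_eq: "z = (\<integral>x. x ^ 4 \<partial>P)"
    and s2_pos: "0 < s2"
begin

declare sets_P [measurable_cong]

text \<open>With \<open>X\<close> the squared norm of the source word, this is the linear part of
  \<open>real n / 2 * ln (X / (real n * s2))\<close> around \<open>X = real n * s2\<close>.\<close>

definition T :: "nat \<Rightarrow> (nat \<Rightarrow> real) \<Rightarrow> real" where
  "T n x = ((\<Sum>i<n. (x i)\<^sup>2) - real n * s2) / (2 * s2)"

abbreviation V :: real where "V \<equiv> dispersion s2 z"

section \<open>Fluctuations of the source power\<close>

lemma prob_space_source: "prob_space (source_n P n)"
  unfolding source_n_def by (rule prob_space_PiM) (rule prob_space_axioms)

lemma sets_source [measurable_cong]: "sets (source_n P n) = sets (PiM {..<n} (\<lambda>_. borel))"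
  unfolding source_n_def by (rule sets_PiM_cong) (auto simp: sets_P)

lemma T_measurable [measurable]: "T n \<in> borel_measurable (source_n P n)"
  unfolding T_def by measurable

lemma dispersion_nonneg: "0 \<le> V"
proof -
  have i2: "integrable P (\<lambda>x. x\<^sup>2)"
    using integrable_square_of_power4[OF finite_measure_axioms sets_P int4] .
  have "0 \<le> variance (\<lambda>x. x\<^sup>2)" by (rule variance_positive)
  also have "\<dots> = z - s2\<^sup>2" using int4 i2 by (subst variance_eq) (simp_all add: s2_eq z_eq)
  finally show ?thesis by (simp add: dispersion_def)
qed

lemma T_berry_esseen:
  assumes "0 < V"
  shows "\<exists>C>0. \<forall>n\<ge>3. \<forall>b. \<bar>measure (source_n P n) {x \<in> space (source_n P n). b * sqrt (real n * V) < T n x} - Qfun b\<bar>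
     \<le> C * ln (real n) / sqrt (real n)"
proof -
  have "s2\<^sup>2 < z" using assms s2_pos by (simp add: dispersion_def zero_less_divide_iff)
  moreover have "b * sqrt (real n * (z - s2\<^sup>2)) < (\<Sum>i<n. (x i)\<^sup>2) - real n * s2 \<longleftrightarrow> b * sqrt (real n * V) < T n x" for n b x
  proof -
    have "sqrt (real n * V) = sqrt (real n * (z - s2\<^sup>2)) / (2 * s2)"
      using s2_pos by (simp add: dispersion_def real_sqrt_divide real_sqrt_mult)
    then show ?thesis using s2_pos by (simp add: T_def divide_less_cancel)
  qed
  ultimately show ?thesis
    using sum_squares_berry_esseen[OF prob_space_axioms sets_P int4 int6]
    by (simp add: s2_eq[symmetric] z_eq[symmetric] source_n_def)
qed

lemma AE_T_zero:
  assumes "V = 0"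
  shows "AE x in source_n P n. T n x = 0"
proof -
  have "z \<le> s2\<^sup>2" using assms s2_pos by (simp add: dispersion_def)
  then show ?thesis
    using AE_sum_squares_of_zero_variance[OF prob_space_axioms sets_P int4, of n]
    unfolding s2_eq[symmetric] z_eq[symmetric] source_n_def T_def by simp
qed

text \<open>A margin of order \<open>ln n / sqrt n\<close> in probability is bought by a threshold
  shift of order \<open>ln n\<close>. The factor \<open>c\<close> is arbitrary so that exceptional
  sets of that size can be charged to the margin.\<close>

lemma T_quantile:
  assumes eps: "0 < eps" "eps < 1" and c: "0 < c"
  shows "\<exists>C>0. \<forall>\<^sub>F n in sequentially.
     measure (source_n P n) {x \<in> space (source_n P n). sqrt (real n * V) * Qinv eps + C * ln (real n) < T n x}
        \<le> eps - c * ln (real n) / sqrt (real n) \<and>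
     eps + c * ln (real n) / sqrt (real n)
        \<le> measure (source_n P n) {x \<in> space (source_n P n). sqrt (real n * V) * Qinv eps - C * ln (real n) < T n x}"
proof (cases "V = 0")
  case True
  \<comment> \<open>Here \<open>T\<close> is almost surely zero, so the thresholds
    \<open>ln n\<close> and \<open>- ln n\<close> are exceeded with probability zero and one. What
    remains is that the margin fits between \<open>eps\<close> and both ends of the unit
    interval.\<close>
  have "\<forall>\<^sub>F n in sequentially. c * ln (real n) / sqrt (real n) < min eps (1 - eps)"
    by (rule order_tendstoD(2)[where y=0]) (use eps in \<open>real_asymp, auto\<close>)
  then have "\<forall>\<^sub>F n in sequentially.
     measure (source_n P n) {x \<in> space (source_n P n). 1 * ln (real n) < T n x}
        \<le> eps - c * ln (real n) / sqrt (real n) \<and>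
     eps + c * ln (real n) / sqrt (real n)
        \<le> measure (source_n P n) {x \<in> space (source_n P n). - 1 * ln (real n) < T n x}"
    using eventually_ge_at_top[of 3]
  proof eventually_elim
    case (elim n)
    interpret N: prob_space "source_n P n" by (rule prob_space_source)
    have "0 < ln (real n)" using elim by simp
    then have "N.prob {x \<in> space (source_n P n). 1 * ln (real n) < T n x} = 0"
      "N.prob {x \<in> space (source_n P n). - 1 * ln (real n) < T n x} = 1"
      using AE_T_zero[OF True, of n] by (subst N.prob_Collect_eq_0 N.prob_Collect_eq_1; auto)+
    then show ?case using elim by simp
  qed
  then show ?thesis using True by (intro exI[of _ 1]) simp
next
  case False
  then have V: "0 < V" using dispersion_nonneg by simp
  obtain CB where CB: "CB > 0" "\<And>n b. n \<ge> 3 \<Longrightarrow> \<bar>measure (source_n P n) {x \<in> space (source_n P n). b * sqrt (real n * V) < T n x} - Qfun b\<bar>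
     \<le> CB * ln (real n) / sqrt (real n)"
    using T_berry_esseen[OF V] by blast
  define q where "q = Qinv eps"
  have q: "Qfun q = eps" unfolding q_def by (rule Qfun_Qinv[OF eps])
  define \<kappa> where "\<kappa> = exp (- (\<bar>q\<bar> + 1)\<^sup>2 / 2) / 3"
  have \<kappa>: "0 < \<kappa>" by (simp add: \<kappa>_def)
  \<comment> \<open>\<open>\<kappa>\<close> is the lower bound for the slope near \<open>q\<close>.
    The shift \<open>h\<close> is chosen such that \<open>h * \<kappa>\<close> equals the margin
    plus the Berry--Esseen error; \<open>C * ln n\<close> is this shift in the scale of
    \<open>T\<close>.\<close>
  define C where "C = (c + CB) / \<kappa> * sqrt V"
  have C: "0 < C" using c CB \<kappa> V by (simp add: C_def)
  have "\<forall>\<^sub>F n in sequentially. (c + CB) / \<kappa> * (ln (real n) / sqrt (real n)) < 1"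
    by (rule order_tendstoD(2)[where y=0]) (real_asymp, simp)
  then have "\<forall>\<^sub>F n in sequentially.
     measure (source_n P n) {x \<in> space (source_n P n). sqrt (real n * V) * q + C * ln (real n) < T n x}
        \<le> eps - c * ln (real n) / sqrt (real n) \<and>
     eps + c * ln (real n) / sqrt (real n)
        \<le> measure (source_n P n) {x \<in> space (source_n P n). sqrt (real n * V) * q - C * ln (real n) < T n x}"
    using eventually_ge_at_top[of 3]
  proof eventually_elim
    case (elim n)
    define h where "h = (c + CB) / \<kappa> * (ln (real n) / sqrt (real n))"
    have h: "0 \<le> h" "h \<le> 1" using elim c CB \<kappa> by (auto simp: h_def)
    have hk: "h * \<kappa> = c * ln (real n) / sqrt (real n) + CB * ln (real n) / sqrt (real n)"
      using \<kappa> by (simp add: h_def add_divide_distrib distrib_right)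
    have "h * sqrt (real n * V) = C * ln (real n)"
      using elim by (simp add: h_def C_def real_sqrt_mult)
    then have e: "sqrt (real n * V) * q + C * ln (real n) = (q + h) * sqrt (real n * V)"
      "sqrt (real n * V) * q - C * ln (real n) = (q - h) * sqrt (real n * V)"
      by (auto simp: algebra_simps)
    show ?case
      unfolding e using CB(2)[of n "q + h"] CB(2)[of n "q - h"] elim Qfun_shift[OF h, of q] hk
      unfolding q \<kappa>_def[symmetric] by auto
  qed
  then show ?thesis using C unfolding q_def by blast
qed

text \<open>At \<open>sqrt (ln n)\<close> standard deviations the normal tail is at most
  \<open>1 / sqrt n\<close>, below the Berry--Esseen error, which is charged once on each
  side.\<close>

lemma T_tail:
  "\<exists>A\<ge>0. \<exists>c>0. \<forall>\<^sub>F n in sequentially.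
     measure (source_n P n) {x \<in> space (source_n P n). A * sqrt (real n * ln (real n)) < \<bar>T n x\<bar>} \<le> c * ln (real n) / sqrt (real n)"
proof (cases "V = 0")
  case True
  have "\<forall>\<^sub>F n in sequentially.
     measure (source_n P n) {x \<in> space (source_n P n). 0 * sqrt (real n * ln (real n)) < \<bar>T n x\<bar>} \<le> 1 * ln (real n) / sqrt (real n)"
    using eventually_ge_at_top[of 3]
  proof eventually_elim
    case (elim n)
    interpret N: prob_space "source_n P n" by (rule prob_space_source)
    have "N.prob {x \<in> space (source_n P n). 0 * sqrt (real n * ln (real n)) < \<bar>T n x\<bar>} = 0"
      using AE_T_zero[OF True, of n] by (subst N.prob_Collect_eq_0) auto
    then show ?case using elim by simp
  qed
  then show ?thesis by (intro exI[of _ 0] conjI exI[of _ 1]) auto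
next
  case False
  then have V: "0 < V" using dispersion_nonneg by simp
  obtain CB where CB: "CB > 0" "\<And>n b. n \<ge> 3 \<Longrightarrow> \<bar>measure (source_n P n) {x \<in> space (source_n P n). b * sqrt (real n * V) < T n x} - Qfun b\<bar>
     \<le> CB * ln (real n) / sqrt (real n)"
    using T_berry_esseen[OF V] by blast
  have "\<forall>\<^sub>F n in sequentially.
     measure (source_n P n) {x \<in> space (source_n P n). sqrt V * sqrt (real n * ln (real n)) < \<bar>T n x\<bar>} \<le> (2 * CB + 2) * ln (real n) / sqrt (real n)"
    using eventually_ge_at_top[of 3]
  proof eventually_elim
    case (elim n)
    interpret N: prob_space "source_n P n" by (rule prob_space_source)
    interpret G: real_distribution "gauss 1" by (rule real_distribution_gauss) simp
    let ?A = "\<lambda>b. {x \<in> space (source_n P n). b * sqrt (real n * V) < T n x}"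
    have m: "?A b \<in> sets (source_n P n)" for b by measurable
    define b where "b = sqrt (ln (real n))"
    have "ln (exp 1) \<le> ln (real n)" using elim exp_le by (subst ln_le_cancel_iff) auto
    then have l: "1 \<le> ln (real n)" by simp
    have b: "0 \<le> b" "b\<^sup>2 = ln (real n)" using l by (auto simp: b_def)
    have e: "exp (- b\<^sup>2 / 2) = 1 / sqrt (real n)"
      using elim unfolding b(2) by (simp add: exp_minus powr_half_sqrt[symmetric] powr_def field_simps)
    have Q1: "Qfun b \<le> 1 / sqrt (real n)"
    proof -
      have "Qfun b \<le> measure (gauss 1) {b..}"
        unfolding Qfun_def std_gauss_eq by (rule G.finite_measure_mono) auto
      then show ?thesis using gauss_Ici_le[OF b(1)] e by simp
    qed
    have Q2: "1 - Qfun (- b) \<le> 1 / sqrt (real n)"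
      using gauss_Iic_le[OF b(1)] e by (simp add: Qfun_eq cdf_def)
    have "{x \<in> space (source_n P n). sqrt V * sqrt (real n * ln (real n)) < \<bar>T n x\<bar>} \<subseteq> ?A b \<union> (space (source_n P n) - ?A (- b))"
      by (auto simp: b_def real_sqrt_mult mult_ac)
    then have "N.prob {x \<in> space (source_n P n). sqrt V * sqrt (real n * ln (real n)) < \<bar>T n x\<bar>}
       \<le> N.prob (?A b \<union> (space (source_n P n) - ?A (- b)))"
      by (rule N.finite_measure_mono) (intro sets.Un sets.compl_sets m)
    also have "\<dots> \<le> N.prob (?A b) + N.prob (space (source_n P n) - ?A (- b))"
      by (intro measure_Un_le sets.compl_sets m)
    also have "N.prob (space (source_n P n) - ?A (- b)) = 1 - N.prob (?A (- b))"
      by (rule N.prob_compl[OF m])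
    also have "N.prob (?A b) + (1 - N.prob (?A (- b))) \<le> 2 * (CB * ln (real n) / sqrt (real n)) + 2 * (1 / sqrt (real n))"
      using CB(2)[OF elim, of b] CB(2)[OF elim, of "- b"] Q1 Q2 unfolding abs_le_iff by linarith
    also have "\<dots> \<le> 2 * (CB * ln (real n) / sqrt (real n)) + 2 * (ln (real n) / sqrt (real n))"
      using l by (intro add_left_mono mult_left_mono divide_right_mono) auto
    finally show ?case by (simp add: algebra_simps add_divide_distrib)
  qed
  then show ?thesis using CB(1) V by (intro exI[of _ "sqrt V"] conjI exI[of _ "2 * CB + 2"]) auto
qed

text \<open>Let \<open>p\<close> be the covering probability of a source word. If
  \<open>M * p \<ge> n\<close>, then \<open>(1 - p) ^ M \<le> exp (- (M * p)) \<le> 1 / n\<close>;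
  if \<open>M * p \<le> 1 / n\<close>, then \<open>(1 - p) ^ M \<ge> 1 - 1 / n\<close> by
  Bernoulli's inequality. Hence the expectation is nearly the probability that \<open>T\<close>
  exceeds a threshold, and the gap between the two regimes is only a factor \<open>n\<^sup>2\<close>
  in \<open>M\<close>.\<close>

theorem M_star_asymptotics:
  fixes C :: "nat \<Rightarrow> (nat \<Rightarrow> real) measure" and L D eps :: real
  assumes eps: "0 < eps" "eps < 1" and L: "0 < L"
    and prob: "\<And>n. prob_space (C n)"
    and meas: "\<And>n. cover_prob C D n \<in> borel_measurable (source_n P n)"
    and bounds: "\<And>A. 0 \<le> A \<Longrightarrow> \<exists>K\<ge>0. \<forall>\<^sub>F n in sequentially. \<forall>x\<in>space (source_n P n). \<bar>T n x\<bar> \<le> A * sqrt (real n * ln (real n)) \<longrightarrow>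
       exp (- real n / 2 * L - T n x - K * ln (real n)) \<le> cover_prob C D n x \<and>
       cover_prob C D n x \<le> exp (- real n / 2 * L - T n x + K * ln (real n))"
  shows "(\<lambda>n. ln (real (M_star P C D eps n)) - real n / 2 * L - sqrt (real n * V) * Qinv eps) \<in> O(\<lambda>n. ln (real n))"
proof -
  obtain A c1 where A: "0 \<le> A" and c1: "0 < c1" and
    tail: "\<forall>\<^sub>F n in sequentially. measure (source_n P n) {x \<in> space (source_n P n). A * sqrt (real n * ln (real n)) < \<bar>T n x\<bar>}
       \<le> c1 * ln (real n) / sqrt (real n)"
    using T_tail by blast
  obtain K where K: "0 \<le> K" and bnd: "\<forall>\<^sub>F n in sequentially. \<forall>x\<in>space (source_n P n). \<bar>T n x\<bar> \<le> A * sqrt (real n * ln (real n)) \<longrightarrow>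
       exp (- real n / 2 * L - T n x - K * ln (real n)) \<le> cover_prob C D n x \<and>
       cover_prob C D n x \<le> exp (- real n / 2 * L - T n x + K * ln (real n))"
    using bounds[OF A] by blast
  define q where "q = Qinv eps"
  \<comment> \<open>Margin \<open>c1 + 1\<close>: \<open>c1\<close> for the words outside the window
    of \<open>T\<close>, one for the terms \<open>1 / n\<close>.\<close>
  obtain B where B: "0 < B" and quant: "\<forall>\<^sub>F n in sequentially.
     measure (source_n P n) {x \<in> space (source_n P n). sqrt (real n * V) * q + B * ln (real n) < T n x}
        \<le> eps - (c1 + 1) * ln (real n) / sqrt (real n) \<and>
     eps + (c1 + 1) * ln (real n) / sqrt (real n)
        \<le> measure (source_n P n) {x \<in> space (source_n P n). sqrt (real n * V) * q - B * ln (real n) < T n x}"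
    using T_quantile[OF eps, of "c1 + 1"] c1 unfolding q_def by auto
  \<comment> \<open>\<open>B\<close> pays for the quantile, \<open>K\<close> for the covering
    exponent, and \<open>1\<close> for the factor \<open>n\<close> in the conditions
    \<open>M * p \<ge> n\<close> and \<open>M * p \<le> 1 / n\<close>.\<close>
  define R where "R = B + K + 1"
  \<comment> \<open>Eventually \<open>exp u \<ge> 1\<close>, so that rounding the codebook size up
    to an integer at most doubles it.\<close>
  have "\<forall>\<^sub>F n in sequentially. 0 \<le> real n / 2 * L + (sqrt (real n * V) * q + R * ln (real n))"
  proof -
    have "\<forall>\<^sub>F n in sequentially. 0 \<le> real n / 2 * L + sqrt (real n) * (sqrt V * q) + R * ln (real n)"
      using L by real_asymp
    then show ?thesis by (simp add: real_sqrt_mult mult_ac add_ac)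
  qed
  then have "\<forall>\<^sub>F n in sequentially. norm (ln (real (M_star P C D eps n)) - real n / 2 * L - sqrt (real n * V) * q) \<le> (R + 1) * norm (ln (real n))"
    using tail bnd quant eventually_ge_at_top[of 3]
  proof eventually_elim
    case (elim n)
    let ?N = "source_n P n" and ?g = "cover_prob C D n"
    interpret N: prob_space ?N by (rule prob_space_source)
    interpret Cn: prob_space "C n" by (rule prob)
    note [measurable] = meas[of n]
    define l where "l = ln (real n)"
    define A1 where "A1 = {x \<in> space ?N. sqrt (real n * V) * q + B * l < T n x}"
    define A1' where "A1' = {x \<in> space ?N. sqrt (real n * V) * q - B * l < T n x}"
    define A2 where "A2 = {x \<in> space ?N. A * sqrt (real n * l) < \<bar>T n x\<bar>}"
    have [measurable]: "A1 \<in> sets ?N" "A1' \<in> sets ?N" "A2 \<in> sets ?N" unfolding A1_def A1'_def A2_def by measurable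
    have n3: "3 \<le> n" using elim by simp
    have "ln (exp 1) \<le> ln (real n)" using n3 exp_le by (subst ln_le_cancel_iff) auto
    then have l1: "1 \<le> l" by (simp add: l_def)
    have g01: "0 \<le> ?g x" "?g x \<le> 1" for x unfolding cover_prob_def by auto
    \<comment> \<open>The strict inequality yields the contradiction in the lower bound.\<close>
    have inv: "1 / real n < l / sqrt (real n)"
    proof -
      have "sqrt (real n) * 1 < sqrt (real n) * sqrt (real n)" using n3 by (intro mult_strict_left_mono) auto
      then have "1 / real n < 1 / sqrt (real n)" using n3 by (intro divide_strict_left_mono) auto
      also have "\<dots> \<le> l / sqrt (real n)" using l1 by (intro divide_right_mono) auto
      finally show ?thesis .
    qed
    have pA1: "N.prob A1 \<le> eps - (c1 + 1) * l / sqrt (real n)" and pA1': "eps + (c1 + 1) * l / sqrt (real n) \<le> N.prob A1'"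
      and pA2: "N.prob A2 \<le> c1 * l / sqrt (real n)"
      using elim unfolding A1_def A1'_def A2_def l_def by auto
    have split: "(c1 + 1) * l / sqrt (real n) = c1 * l / sqrt (real n) + l / sqrt (real n)"
      by (simp add: algebra_simps add_divide_distrib)
    have int: "integrable ?N (\<lambda>x. (1 - ?g x) ^ M)" for M
      using g01 by (intro N.integrable_const_bound[where B=1]) (auto intro!: power_le_one simp: abs_le_iff power_le_one)
    have hbi: "has_bochner_integral ?N (indicator S :: _ \<Rightarrow> real) (N.prob S)" if "S \<in> sets ?N" for S
      using that by (intro has_bochner_integral_real_indicator) (auto simp: less_top[symmetric])
    have hbc: "has_bochner_integral ?N (\<lambda>x. 1 / real n) (1 / real n)"
      using has_bochner_integral_integrable[of ?N "\<lambda>x. 1 / real n"] by (simp add: N.prob_space)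
    define u where "u = real n / 2 * L + (sqrt (real n * V) * q + R * l)"
    define u' where "u' = real n / 2 * L + (sqrt (real n * V) * q - R * l)"
    define M where "M = nat \<lceil>exp u\<rceil>"
    have Mge: "exp u \<le> real M" unfolding M_def by linarith
    have ex: "excess_prob P C D n M \<le> eps"
    proof -
      have "excess_prob P C D n M \<le> (\<integral>x. indicator A1 x + indicator A2 x + 1 / real n \<partial>?N)"
        unfolding excess_prob_def
      proof (rule integral_mono[OF int])
        show "integrable ?N (\<lambda>x. indicator A1 x + indicator A2 x + 1 / real n)"
          by (intro Bochner_Integration.integrable_add integrable_real_indicator) (auto simp: less_top[symmetric])
      next
        fix x assume x: "x \<in> space ?N"
        have le1: "(1 - ?g x) ^ M \<le> 1" using g01[of x] by (intro power_le_one) auto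
        show "(1 - ?g x) ^ M \<le> indicator A1 x + indicator A2 x + 1 / real n"
        proof (cases "x \<in> A1 \<or> x \<in> A2")
          case True
          then show ?thesis using le1 by (auto split: split_indicator intro: order_trans[OF le1])
        next
          case False
          have lo: "exp (- real n / 2 * L - T n x - K * l) \<le> ?g x"
            using elim(3) x False unfolding A2_def l_def by auto
          have "real n = exp l" using n3 by (simp add: l_def)
          also have "\<dots> \<le> exp (u + (- real n / 2 * L - T n x - K * l))"
            using False x by (auto simp: A1_def u_def R_def algebra_simps)
          also have "\<dots> \<le> real M * ?g x" unfolding exp_add using Mge lo by (intro mult_mono) auto
          finally have Mg: "real n \<le> real M * ?g x" .
          have "(1 - ?g x) ^ M \<le> exp (- ?g x) ^ M"
            using g01[of x] exp_ge_add_one_self[of "- ?g x"] by (intro power_mono) auto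
          also have "\<dots> = exp (- (real M * ?g x))" by (simp flip: exp_of_nat_mult)
          also have "\<dots> \<le> exp (- l)" using Mg ln_bound[of "real n"] n3 by (simp add: l_def)
          also have "\<dots> = 1 / real n" using n3 by (simp add: l_def exp_minus field_simps)
          finally show ?thesis using False by simp
        qed
      qed
      also have "\<dots> = N.prob A1 + N.prob A2 + 1 / real n"
        by (intro has_bochner_integral_integral_eq has_bochner_integral_add hbi hbc) measurable
      also have "\<dots> \<le> eps" using pA1 pA2 inv split by linarith
      finally show ?thesis .
    qed
    define Ms where "Ms = M_star P C D eps n"
    have exs: "excess_prob P C D n Ms \<le> eps" unfolding Ms_def M_star_def using ex by (rule LeastI)
    have MsM: "Ms \<le> M" unfolding Ms_def M_star_def using ex by (rule Least_le)
    \<comment> \<open>A codebook of at most \<open>exp u'\<close> words has excess probability above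
      \<open>eps\<close>. This also makes \<open>Ms\<close> positive, without which
      \<open>ln\<close> of it would be a default value.\<close>
    have lower: "exp u' < real Ms"
    proof (rule ccontr)
      assume "\<not> exp u' < real Ms"
      then have Msle: "real Ms \<le> exp u'" by simp
      have "N.prob A1' - N.prob A2 - 1 / real n = (\<integral>x. indicator A1' x - indicator A2 x - 1 / real n \<partial>?N)"
        by (intro has_bochner_integral_integral_eq[symmetric] has_bochner_integral_diff hbi hbc) measurable
      also have "\<dots> \<le> excess_prob P C D n Ms"
        unfolding excess_prob_def
      proof (rule integral_mono[OF _ int])
        show "integrable ?N (\<lambda>x. indicator A1' x - indicator A2 x - 1 / real n)"
          by (intro Bochner_Integration.integrable_diff integrable_real_indicator) (auto simp: less_top[symmetric])
      next
        fix x assume x: "x \<in> space ?N"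
        have ge0: "0 \<le> (1 - ?g x) ^ Ms" using g01[of x] by simp
        show "indicator A1' x - indicator A2 x - 1 / real n \<le> (1 - ?g x) ^ Ms"
        proof (cases "x \<in> A1' \<and> x \<notin> A2")
          case False
          then have "indicator A1' x - indicator A2 x - 1 / real n \<le> (0::real)"
            by (auto split: split_indicator intro: order_trans[of _ 0])
          then show ?thesis using ge0 by linarith
        next
          case True
          have hi: "?g x \<le> exp (- real n / 2 * L - T n x + K * l)"
            using elim(3) x True unfolding A2_def l_def by auto
          have "real Ms * ?g x \<le> exp u' * exp (- real n / 2 * L - T n x + K * l)"
            using Msle hi g01[of x] by (intro mult_mono) auto
          also have "\<dots> = exp (u' + (- real n / 2 * L - T n x + K * l))" by (simp add: exp_add)
          also have "\<dots> \<le> exp (- l)" using True x by (auto simp: A1'_def u'_def R_def algebra_simps)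
          also have "\<dots> = 1 / real n" using n3 by (simp add: l_def exp_minus field_simps)
          finally have "1 - 1 / real n \<le> 1 + real Ms * (- ?g x)" by simp
          also have "\<dots> \<le> (1 + (- ?g x)) ^ Ms" using g01[of x] by (intro Bernoulli_inequality) auto
          finally show ?thesis using True by simp
        qed
      qed
      finally show False using exs pA1' pA2 inv split by linarith
    qed
    have Ms0: "0 < real Ms" using lower exp_gt_zero[of u'] by linarith
    have lo: "u' \<le> ln (real Ms)" using lower Ms0 by (simp add: ln_ge_iff)
    have "real Ms \<le> real M" using MsM by simp
    also have "\<dots> \<le> exp u + 1" unfolding M_def by (simp add: of_nat_nat)
    also have "\<dots> \<le> 2 * exp u" using elim(1) unfolding u_def l_def by simp
    finally have "ln (real Ms) \<le> ln (2 * exp u)" using Ms0 by (subst ln_le_cancel_iff) auto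
    also have "\<dots> = ln 2 + u" by (simp add: ln_mult)
    also have "\<dots> \<le> l + u" using l1 ln_2_less_1 by simp
    finally have "\<bar>ln (real Ms) - real n / 2 * L - sqrt (real n * V) * q\<bar> \<le> (R + 1) * l"
      using lo l1 by (auto simp: u_def u'_def abs_le_iff algebra_simps)
    then show ?case using l1 by (simp add: Ms_def l_def)
  qed
  then show ?thesis unfolding q_def by (rule bigoI)
qed

end

section \<open>From the expansion to the rates\<close>

lemma rates_of_log_asymptotics:
  fixes M :: "nat \<Rightarrow> nat"
  assumes "(\<lambda>n. ln (real (M n)) - real n / 2 * ln (s2 / D) - sqrt (real n * V) * q) \<in> O(\<lambda>n. ln (real n))"
  shows "second_order_rate M s2 D = ereal (sqrt V * q)"
    and "(\<lambda>n. ln (real (M n)) / real n) \<longlonglongrightarrow> ln (s2 / D) / 2"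
proof -
  define r where "r = (\<lambda>n. ln (real (M n)) - real n / 2 * ln (s2 / D) - sqrt (real n * V) * q)"
  have r: "r \<in> O(\<lambda>n. ln (real n))" using assms unfolding r_def .
  have "(\<lambda>n::nat. ln (real n)) \<in> o(\<lambda>n. sqrt (real n))" by real_asymp
  from landau_o.big_small_trans[OF r this] have r1: "(\<lambda>n. r n / sqrt (real n)) \<longlonglongrightarrow> 0" by (rule smalloD_tendsto)
  have "(\<lambda>n::nat. ln (real n)) \<in> o(\<lambda>n. real n)" by real_asymp
  from landau_o.big_small_trans[OF r this] have r2: "(\<lambda>n. r n / real n) \<longlonglongrightarrow> 0" by (rule smalloD_tendsto)
  have "(\<lambda>n. sqrt V * q + r n / sqrt (real n)) \<longlonglongrightarrow> sqrt V * q + 0" by (intro tendsto_intros r1)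
  moreover have "\<forall>\<^sub>F n in sequentially. sqrt V * q + r n / sqrt (real n) = (ln (real (M n)) - real n / 2 * ln (s2 / D)) / sqrt (real n)"
    using eventually_gt_at_top[of 0]
    by eventually_elim (simp add: r_def real_sqrt_mult diff_divide_distrib)
  ultimately have "(\<lambda>n. (ln (real (M n)) - real n / 2 * ln (s2 / D)) / sqrt (real n)) \<longlonglongrightarrow> sqrt V * q"
    using Lim_transform_eventually by fastforce
  then have "(\<lambda>n. ereal ((ln (real (M n)) - real n / 2 * ln (s2 / D)) / sqrt (real n))) \<longlonglongrightarrow> ereal (sqrt V * q)"
    by simp
  \<comment> \<open>The normalised sequence converges, so the upper limit is its limit.\<close>
  then show "second_order_rate M s2 D = ereal (sqrt V * q)"
    unfolding second_order_rate_def by (intro lim_imp_Limsup) auto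
  have "(\<lambda>n::nat. 1 / sqrt (real n)) \<longlonglongrightarrow> 0" by real_asymp
  then have "(\<lambda>n. ln (s2 / D) / 2 + sqrt V * q * (1 / sqrt (real n)) + r n / real n) \<longlonglongrightarrow> ln (s2 / D) / 2 + sqrt V * q * 0 + 0"
    by (intro tendsto_intros r2)
  moreover have "\<forall>\<^sub>F n in sequentially. ln (s2 / D) / 2 + sqrt V * q * (1 / sqrt (real n)) + r n / real n = ln (real (M n)) / real n"
    using eventually_gt_at_top[of 0]
  proof eventually_elim
    case (elim n)
    have "sqrt (real n) / real n = 1 / sqrt (real n)" using elim by (simp add: real_div_sqrt field_simps)
    moreover have "sqrt (real n * V) * q / real n = sqrt V * q * (sqrt (real n) / real n)"
      by (simp add: real_sqrt_mult)
    ultimately have "sqrt (real n * V) * q / real n = sqrt V * q * (1 / sqrt (real n))"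
      by (simp only:)
    then show ?case using elim by (simp add: r_def diff_divide_distrib)
  qed
  ultimately show "(\<lambda>n. ln (real (M n)) / real n) \<longlonglongrightarrow> ln (s2 / D) / 2"
    using Lim_transform_eventually by fastforce
qed

section \<open>Covering probability of the spherical codebook\<close>

text \<open>The covering probability is the measure of a section of a measurable set in the product.
  This makes the bounded integrand of \<open>excess_prob\<close> integrable, so that it can be
  estimated pointwise.\<close>

lemma cover_prob_measurable:
  assumes "prob_space (C n)" and sets_C: "sets (C n) = sets (PiM {..<n} (\<lambda>_. borel))"
    and sets_N: "sets N = sets (PiM {..<n} (\<lambda>_. borel))"
  shows "cover_prob C D n \<in> borel_measurable N"
proof -
  interpret C: prob_space "C n" by fact
  note [measurable_cong] = sets_C sets_N
  let ?Q = "{z \<in> space (N \<Otimes>\<^sub>M C n). dist_n n (fst z) (snd z) \<le> D}"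
  have Q: "?Q \<in> sets (N \<Otimes>\<^sub>M C n)" unfolding dist_n_def by measurable
  have "(\<lambda>x. enn2real (emeasure (C n) (Pair x -` ?Q))) \<in> borel_measurable N"
    using C.measurable_emeasure_Pair[OF Q] by measurable
  moreover have "cover_prob C D n x = enn2real (emeasure (C n) (Pair x -` ?Q))" if "x \<in> space N" for x
    unfolding cover_prob_def measure_def using that
    by (intro arg_cong[where f=enn2real] arg_cong2[where f=emeasure]) (auto simp: space_pair_measure)
  ultimately show ?thesis by (subst measurable_cong) auto
qed

lemma prob_space_sp_codeword: "prob_space (sp_codeword s n)"
  and sets_sp_codeword: "sets (sp_codeword s n) = sets (PiM {..<n} (\<lambda>_. borel))"
proof -
  show "prob_space (sp_codeword s n)"
    unfolding sp_codeword_def std_gauss_eq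
    by (rule prob_space.prob_space_distr[OF prob_space_PiM_gauss]) (simp, measurable)
qed (simp add: sp_codeword_def)

lemma iid_codeword_eq: "iid_codeword s n = PiM {..<n} (\<lambda>_. gauss (sqrt s))"
  by (simp add: iid_codeword_def gauss_def)

lemma prob_space_iid_codeword: "0 < s \<Longrightarrow> prob_space (iid_codeword s n)"
  and sets_iid_codeword: "sets (iid_codeword s n) = sets (PiM {..<n} (\<lambda>_. borel))"
  unfolding iid_codeword_eq by (rule prob_space_PiM_gauss, simp) (rule sets_PiM_gauss)

text \<open>With \<open>h = 1 / (1 + a)\<close> one has
  \<open>(a + h)\<^sup>2 \<le> a\<^sup>2 + 3\<close>, so the density loses only a constant factor.
  The short interval thus has the order of the whole tail above \<open>a\<close>, and at the same
  time it localises the variable.\<close>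

lemma gauss_Ioc_near_ge:
  assumes "0 \<le> a"
  shows "exp (- 3 / 2) / 3 * (exp (- a\<^sup>2 / 2) / (1 + a)) \<le> measure (gauss 1) {a<..a + 1 / (1 + a)}"
proof -
  define h where "h = 1 / (1 + a)"
  have h: "0 \<le> h" "h \<le> 1" "a * h \<le> 1" using assms by (auto simp: h_def field_simps)
  have "h\<^sup>2 \<le> 1" using h by (simp add: power_le_one)
  moreover have "(a + h)\<^sup>2 = a\<^sup>2 + 2 * (a * h) + h\<^sup>2" by (simp add: power2_sum)
  ultimately have "- a\<^sup>2 / 2 + - 3 / 2 \<le> - (a + h)\<^sup>2 / 2" using h(3) by simp
  then have "exp (- a\<^sup>2 / 2) * exp (- 3 / 2) \<le> exp (- (a + h)\<^sup>2 / 2)"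
    by (simp only: exp_add[symmetric] exp_le_cancel_iff)
  then have "h * (exp (- a\<^sup>2 / 2) * exp (- 3 / 2)) \<le> h * exp (- (a + h)\<^sup>2 / 2)"
    using h(1) by (rule mult_left_mono)
  moreover have "(a + h - a) * exp (- (a + h)\<^sup>2 / 2) / 3 \<le> measure (gauss 1) {a<..a + h}"
    using assms h by (intro gauss_Ioc_ge) auto
  ultimately have "h * (exp (- a\<^sup>2 / 2) * exp (- 3 / 2)) / 3 \<le> measure (gauss 1) {a<..a + h}" by simp
  moreover have "h * (exp (- a\<^sup>2 / 2) * exp (- 3 / 2)) / 3 = exp (- 3 / 2) / 3 * (exp (- a\<^sup>2 / 2) / (1 + a))"
    by (simp add: h_def mult_ac)
  ultimately show ?thesis by (simp only: h_def)
qed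

text \<open>The Laplace transform of a chi-square variable, read off from the tilting identity with
  \<open>r = 1 + k\<close> for the constant function one.\<close>

lemma nn_integral_gauss_exp_sum_squares:
  assumes "0 \<le> k"
  shows "(\<integral>\<^sup>+v. ennreal (exp (- k * (\<Sum>i<m. (v i)\<^sup>2) / 2)) \<partial>PiM {..<m} (\<lambda>_. gauss 1)) = ennreal (1 / sqrt (1 + k) ^ m)"
proof -
  interpret P: prob_space "PiM {..<m} (\<lambda>_. gauss 1)" by (rule prob_space_PiM_gauss) simp
  define I where "I = (\<integral>\<^sup>+v. ennreal (exp (- k * (\<Sum>i<m. (v i)\<^sup>2) / 2)) \<partial>PiM {..<m} (\<lambda>_. gauss 1))"
  define q where "q = sqrt (1 + k) ^ m"
  have q: "0 < q" using assms by (simp add: q_def)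
  have "1 = (\<integral>\<^sup>+v. ennreal q * ennreal (exp (- k * (\<Sum>i<m. (v i)\<^sup>2) / 2)) \<partial>PiM {..<m} (\<lambda>_. gauss 1))"
    using nn_integral_gauss_tilt[of "1 + k" "\<lambda>_. 1" m] assms P.emeasure_space_1 by (simp add: ennreal_mult q_def)
  also have "\<dots> = ennreal q * I"
    unfolding I_def by (rule nn_integral_cmult) measurable
  finally have e: "ennreal q * I = 1" by simp
  have "ennreal (1 / q) * (ennreal q * I) = (ennreal (1 / q) * ennreal q) * I"
    by (simp only: mult.assoc)
  also have "ennreal (1 / q) * ennreal q = 1"
    using q by (simp flip: ennreal_mult)
  finally have "I = ennreal (1 / q)" unfolding e by simp
  then show ?thesis by (simp only: I_def q_def)
qed

text \<open>The squared norm of the codeword is left as an uncancelled quotient, so that the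
  identity also holds at the null vector, where the normalised vector is \<open>0\<close> by the
  convention for division.\<close>

lemma sp_cover_prob_nn_integral:
  fixes x :: "nat \<Rightarrow> real" and s D :: real and m :: nat
  defines "n \<equiv> Suc m" and "X \<equiv> \<Sum>i<Suc m. (x i)\<^sup>2"
  assumes s: "0 < s"
  shows "ennreal (cover_prob (sp_codeword s) D n x) = (\<integral>\<^sup>+v. emeasure (gauss 1)
     {z. X - 2 * sqrt (real n * s) * (sqrt X * z) / sqrt (z\<^sup>2 + (\<Sum>i<m. (v i)\<^sup>2))
        + real n * s * (z\<^sup>2 + (\<Sum>i<m. (v i)\<^sup>2)) / (z\<^sup>2 + (\<Sum>i<m. (v i)\<^sup>2)) \<le> real n * D} \<partial>PiM {..<m} (\<lambda>_. gauss 1))"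
proof -
  let ?G = "PiM {..<n} (\<lambda>_. gauss 1)" and ?P = "PiM {..<m} (\<lambda>_. gauss 1)"
  interpret Pn: prob_space ?G by (rule prob_space_PiM_gauss) simp
  interpret P: prob_space ?P by (rule prob_space_PiM_gauss) simp
  interpret G: prob_space "gauss 1" by (rule prob_space_gauss) simp
  interpret GP: pair_sigma_finite "gauss 1" ?P ..
  define c where "c = sqrt (real n * s)"
  have c2: "c\<^sup>2 = real n * s" using s by (simp add: c_def)
  have n0: "0 < real n" by (simp add: n_def)
  define B where "B = {(p, q). X - 2 * c * p / sqrt q + real n * s * q / q \<le> real n * D}"
  have B [measurable]: "B \<in> sets (borel \<Otimes>\<^sub>M borel)"
  proof -
    have "{z \<in> space (borel \<Otimes>\<^sub>M borel). X - 2 * c * fst z / sqrt (snd z) + real n * s * snd z / snd z \<le> real n * D} \<in> sets (borel \<Otimes>\<^sub>M borel)"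
      by measurable
    also have "{z \<in> space (borel \<Otimes>\<^sub>M borel). X - 2 * c * fst z / sqrt (snd z) + real n * s * snd z / snd z \<le> real n * D} = B"
      by (auto simp: B_def space_pair_measure)
    finally show ?thesis .
  qed
  define f where "f = (\<lambda>z::nat \<Rightarrow> real. restrict (\<lambda>i. c * z i / sqrt (\<Sum>j<n. (z j)\<^sup>2)) {..<n})"
  have [measurable]: "f \<in> measurable ?G (PiM {..<n} (\<lambda>_. borel))" unfolding f_def by measurable
  have d: "dist_n n x (f z) \<le> D \<longleftrightarrow> (\<Sum>i<n. x i * z i, \<Sum>i<n. (z i)\<^sup>2) \<in> B" for z
  proof -
    define S where "S = (\<Sum>j<n. (z j)\<^sup>2)"
    have S: "0 \<le> S" unfolding S_def by (simp add: sum_nonneg)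
    have "(\<Sum>i<n. (x i - f z i)\<^sup>2) = (\<Sum>i<n. (x i)\<^sup>2 - 2 * c * (x i * z i) / sqrt S + c\<^sup>2 * (z i)\<^sup>2 / S)"
      using S by (intro sum.cong refl) (simp add: f_def S_def[symmetric] power2_diff power_divide power_mult_distrib mult_ac)
    also have "\<dots> = X - 2 * c * (\<Sum>i<n. x i * z i) / sqrt S + c\<^sup>2 * S / S"
      unfolding X_def S_def n_def
      by (simp only: sum.distrib sum_subtractf sum_divide_distrib[symmetric] sum_distrib_left[symmetric])
    finally show ?thesis using n0 unfolding dist_n_def B_def c2 S_def by (simp add: pos_divide_le_eq mult.commute)
  qed
  have m1: "{y \<in> space (PiM {..<n} (\<lambda>_. borel)). dist_n n x y \<le> D} \<in> sets (PiM {..<n} (\<lambda>_. borel))"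
    unfolding dist_n_def by measurable
  have "cover_prob (sp_codeword s) D n x = measure ?G {z \<in> space ?G. dist_n n x (f z) \<le> D}"
    unfolding cover_prob_def sp_codeword_def std_gauss_eq c_def[symmetric] f_def[symmetric] space_distr
    using m1 by (subst measure_distr) (auto intro!: arg_cong2[where f=measure] simp: space_PiM f_def)
  also have "\<dots> = measure ?G {z \<in> space ?G. (\<Sum>i<n. x i * z i, \<Sum>i<n. (z i)\<^sup>2) \<in> B}" unfolding d ..
  finally have "ennreal (cover_prob (sp_codeword s) D n x) = emeasure ?G {z \<in> space ?G. (\<Sum>i<n. x i * z i, \<Sum>i<n. (z i)\<^sup>2) \<in> B}"
    by (simp add: Pn.emeasure_eq_measure)
  also have "\<dots> = (\<integral>\<^sup>+z. indicator {z \<in> space ?G. (\<Sum>i<n. x i * z i, \<Sum>i<n. (z i)\<^sup>2) \<in> B} z \<partial>?G)"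
    by (rule nn_integral_indicator[symmetric]) measurable
  also have "\<dots> = (\<integral>\<^sup>+z. indicator B (\<Sum>i<n. x i * z i, \<Sum>i<n. (z i)\<^sup>2) \<partial>?G)"
    by (intro nn_integral_cong) (auto split: split_indicator)
  also have "\<dots> = (\<integral>\<^sup>+z. \<integral>\<^sup>+v. indicator B (sqrt X * z, z\<^sup>2 + (\<Sum>i<m. (v i)\<^sup>2)) \<partial>?P \<partial>gauss 1)"
    unfolding n_def X_def by (rule nn_integral_gauss_linear_quadratic) auto
  \<comment> \<open>For a fixed orthogonal part \<open>v\<close>, what remains is a normal
    probability on the line.\<close>
  also have "\<dots> = (\<integral>\<^sup>+v. \<integral>\<^sup>+z. indicator B (sqrt X * z, z\<^sup>2 + (\<Sum>i<m. (v i)\<^sup>2)) \<partial>gauss 1 \<partial>?P)"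
    by (rule GP.Fubini'[symmetric]) measurable
  also have "\<dots> = (\<integral>\<^sup>+v. emeasure (gauss 1) {z. (sqrt X * z, z\<^sup>2 + (\<Sum>i<m. (v i)\<^sup>2)) \<in> B} \<partial>?P)"
  proof (rule nn_integral_cong)
    fix v
    have "{z \<in> space (gauss 1). (sqrt X * z, z\<^sup>2 + (\<Sum>i<m. (v i)\<^sup>2)) \<in> B} \<in> sets (gauss 1)" by measurable
    then have "(\<integral>\<^sup>+z. indicator {z. (sqrt X * z, z\<^sup>2 + (\<Sum>i<m. (v i)\<^sup>2)) \<in> B} z \<partial>gauss 1) = emeasure (gauss 1) {z. (sqrt X * z, z\<^sup>2 + (\<Sum>i<m. (v i)\<^sup>2)) \<in> B}"
      by (intro nn_integral_indicator) simp
    then show "(\<integral>\<^sup>+z. indicator B (sqrt X * z, z\<^sup>2 + (\<Sum>i<m. (v i)\<^sup>2)) \<partial>gauss 1) = emeasure (gauss 1) {z. (sqrt X * z, z\<^sup>2 + (\<Sum>i<m. (v i)\<^sup>2)) \<in> B}"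
      by (simp add: indicator_def)
  qed
  finally show ?thesis unfolding B_def c_def by simp
qed

text \<open>The codeword covers \<open>x\<close> iff the Gaussian vector defining its direction lies in a cone around \<open>x\<close>
  whose half-angle has cosine \<open>\<rho>\<close>; here \<open>z\<close> is its component along \<open>x\<close> and \<open>R\<close> the orthogonal part.\<close>

lemma cone_condition:
  fixes z R c X E \<rho> :: real
  assumes c: "0 < c" and X: "0 < X" and R: "0 \<le> R" and \<rho>: "0 < \<rho>" "\<rho> < 1" "X + E = 2 * c * sqrt X * \<rho>"
    and E: "E = c\<^sup>2 - e"
  defines "k \<equiv> sqrt (\<rho>\<^sup>2 / (1 - \<rho>\<^sup>2))"
  shows "X - 2 * c * (sqrt X * z) / sqrt (z\<^sup>2 + R\<^sup>2) + c\<^sup>2 * (z\<^sup>2 + R\<^sup>2) / (z\<^sup>2 + R\<^sup>2) \<le> e \<Longrightarrow> k * R \<le> z"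
    and "k * R < z \<Longrightarrow> X - 2 * c * (sqrt X * z) / sqrt (z\<^sup>2 + R\<^sup>2) + c\<^sup>2 * (z\<^sup>2 + R\<^sup>2) / (z\<^sup>2 + R\<^sup>2) \<le> e"
proof -
  define Q where "Q = sqrt (z\<^sup>2 + R\<^sup>2)"
  have Q2: "Q\<^sup>2 = z\<^sup>2 + R\<^sup>2" by (simp add: Q_def)
  have \<rho>2: "0 < 1 - \<rho>\<^sup>2" using \<rho> by (simp add: power_less_one_iff abs_square_less_1)
  have k: "0 < k" "k\<^sup>2 * (1 - \<rho>\<^sup>2) = \<rho>\<^sup>2" using \<rho> \<rho>2 by (auto simp: k_def)
  \<comment> \<open>Law of cosines: the distortion condition says that \<open>z / Q\<close>, the
    cosine of the angle to \<open>x\<close>, is at least \<open>\<rho>\<close>.\<close>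
  have main: "X - 2 * c * (sqrt X * z) / sqrt (z\<^sup>2 + R\<^sup>2) + c\<^sup>2 * (z\<^sup>2 + R\<^sup>2) / (z\<^sup>2 + R\<^sup>2) \<le> e \<longleftrightarrow> \<rho> * Q \<le> z"
    if "z\<^sup>2 + R\<^sup>2 \<noteq> 0"
  proof -
    have "0 < z\<^sup>2 + R\<^sup>2" using that sum_power2_ge_zero[of z R] by linarith
    then have Q0: "0 < Q" unfolding Q_def by (rule real_sqrt_gt_zero)
    have "X - 2 * c * (sqrt X * z) / sqrt (z\<^sup>2 + R\<^sup>2) + c\<^sup>2 * (z\<^sup>2 + R\<^sup>2) / (z\<^sup>2 + R\<^sup>2) = X - 2 * c * (sqrt X * z) / Q + c\<^sup>2"
      using that by (simp add: Q_def)
    also have "\<dots> \<le> e \<longleftrightarrow> X + E \<le> 2 * c * (sqrt X * z) / Q" unfolding E by auto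
    also have "\<dots> \<longleftrightarrow> (2 * c * sqrt X) * \<rho> \<le> (2 * c * sqrt X) * (z / Q)" unfolding \<rho>(3) by (simp add: mult.assoc)
    also have "\<dots> \<longleftrightarrow> \<rho> \<le> z / Q" using c X by (subst mult_le_cancel_left_pos) auto
    also have "\<dots> \<longleftrightarrow> \<rho> * Q \<le> z" using Q0 by (simp add: pos_le_divide_eq)
    finally show ?thesis .
  qed
  have sq: "(k * R)\<^sup>2 \<le> z\<^sup>2 \<longleftrightarrow> (\<rho> * Q)\<^sup>2 \<le> z\<^sup>2"
  proof -
    have "(k * R)\<^sup>2 \<le> z\<^sup>2 \<longleftrightarrow> (1 - \<rho>\<^sup>2) * (k\<^sup>2 * R\<^sup>2) \<le> (1 - \<rho>\<^sup>2) * z\<^sup>2"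
      using \<rho>2 by (simp add: power_mult_distrib)
    also have "(1 - \<rho>\<^sup>2) * (k\<^sup>2 * R\<^sup>2) = \<rho>\<^sup>2 * R\<^sup>2" using k(2) by (simp add: mult_ac flip: mult.assoc)
    also have "\<rho>\<^sup>2 * R\<^sup>2 \<le> (1 - \<rho>\<^sup>2) * z\<^sup>2 \<longleftrightarrow> (\<rho> * Q)\<^sup>2 \<le> z\<^sup>2"
      unfolding power_mult_distrib Q2 by (simp add: algebra_simps)
    finally show ?thesis .
  qed
  have Qnn: "0 \<le> Q" by (simp add: Q_def)
  \<comment> \<open>At the null vector the claim is \<open>0 \<le> 0\<close>; in the converse the
    strict inequality excludes that vector.\<close>
  { assume a: "X - 2 * c * (sqrt X * z) / sqrt (z\<^sup>2 + R\<^sup>2) + c\<^sup>2 * (z\<^sup>2 + R\<^sup>2) / (z\<^sup>2 + R\<^sup>2) \<le> e"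
    show "k * R \<le> z"
    proof (cases "z\<^sup>2 + R\<^sup>2 = 0")
      case True
      then show ?thesis by (simp add: sum_power2_eq_zero_iff)
    next
      case False
      then have "\<rho> * Q \<le> z" using a main by blast
      moreover then have "0 \<le> z" using \<rho>(1) Qnn by (meson mult_nonneg_nonneg order_trans less_imp_le)
      ultimately have "(\<rho> * Q)\<^sup>2 \<le> z\<^sup>2" using \<rho>(1) Qnn by (intro power_mono) auto
      then have "(k * R)\<^sup>2 \<le> z\<^sup>2" using sq by blast
      then show ?thesis using \<open>0 \<le> z\<close> by (rule power2_le_imp_le)
    qed }
  { assume a: "k * R < z"
    have "0 \<le> k * R" using k R by simp
    then have z: "0 < z" using a by linarith
    then have ne: "z\<^sup>2 + R\<^sup>2 \<noteq> 0" by (simp add: sum_power2_eq_zero_iff)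
    have "(k * R)\<^sup>2 \<le> z\<^sup>2" using a \<open>0 \<le> k * R\<close> by (intro power_mono) auto
    then have "(\<rho> * Q)\<^sup>2 \<le> z\<^sup>2" using sq by blast
    then have "\<rho> * Q \<le> z" by (rule power2_le_imp_le) (use z in simp)
    then show "X - 2 * c * (sqrt X * z) / sqrt (z\<^sup>2 + R\<^sup>2) + c\<^sup>2 * (z\<^sup>2 + R\<^sup>2) / (z\<^sup>2 + R\<^sup>2) \<le> e"
      using main[OF ne] by blast }
qed

text \<open>For a fixed orthogonal part of norm \<open>R\<close> the cone is a half-line above
  \<open>sqrt k * R\<close>. Its normal probability is at most
  \<open>exp (- k * R\<^sup>2 / 2)\<close>, and at least a constant times this over
  \<open>1 + sqrt k * R\<close>. Integration yields the Laplace transform with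
  \<open>m = n - 1\<close> degrees of freedom. Cutting at \<open>R = n\<close>, far above the
  typical \<open>sqrt n\<close>, makes the polynomial factor uniform; the subtracted exponential is
  the price of the cut.\<close>

lemma sp_cover_prob_bounds:
  fixes x :: "nat \<Rightarrow> real" and s D \<rho> :: real and m :: nat
  defines "n \<equiv> Suc m" and "X \<equiv> \<Sum>i<Suc m. (x i)\<^sup>2" and "k \<equiv> \<rho>\<^sup>2 / (1 - \<rho>\<^sup>2)"
  assumes s: "0 < s" and X: "0 < X" and \<rho>: "0 < \<rho>" "\<rho> < 1"
    and eq: "X + real n * s - real n * D = 2 * sqrt (real n * s) * sqrt X * \<rho>"
  shows "cover_prob (sp_codeword s) D n x \<le> sqrt (1 - \<rho>\<^sup>2) ^ m"
    and "exp (- 3 / 2) / 3 / (1 + sqrt k * real n) * (sqrt (1 - \<rho>\<^sup>2) ^ m - exp (- k * (real n)\<^sup>2 / 2)) \<le> cover_prob (sp_codeword s) D n x"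
proof -
  let ?P = "PiM {..<m} (\<lambda>_. gauss 1)"
  interpret P: prob_space ?P by (rule prob_space_PiM_gauss) simp
  interpret G: prob_space "gauss 1" by (rule prob_space_gauss) simp
  define c where "c = sqrt (real n * s)"
  have c: "0 < c" "c\<^sup>2 = real n * s" using s by (auto simp: c_def n_def)
  have \<rho>2: "0 < 1 - \<rho>\<^sup>2" using \<rho> by (simp add: power_less_one_iff abs_square_less_1)
  have k: "0 < k" using \<rho> \<rho>2 by (simp add: k_def)
  have k1: "1 + k = 1 / (1 - \<rho>\<^sup>2)" using \<rho>2 by (simp add: k_def field_simps)
  have pw: "1 / sqrt (1 + k) ^ m = sqrt (1 - \<rho>\<^sup>2) ^ m"
    unfolding k1 by (simp add: real_sqrt_divide power_divide)
  define R where "R = (\<lambda>v::nat \<Rightarrow> real. sqrt (\<Sum>i<m. (v i)\<^sup>2))"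
  have R: "0 \<le> R v" "(R v)\<^sup>2 = (\<Sum>i<m. (v i)\<^sup>2)" for v by (auto simp: R_def sum_nonneg)
  have [measurable]: "R \<in> borel_measurable ?P" unfolding R_def by measurable
  define Z where "Z = (\<lambda>v. {z. X - 2 * c * (sqrt X * z) / sqrt (z\<^sup>2 + (R v)\<^sup>2) + c\<^sup>2 * (z\<^sup>2 + (R v)\<^sup>2) / (z\<^sup>2 + (R v)\<^sup>2) \<le> real n * D})"
  have cov: "ennreal (cover_prob (sp_codeword s) D n x) = (\<integral>\<^sup>+v. emeasure (gauss 1) (Z v) \<partial>?P)"
    unfolding Z_def R c(2) unfolding c_def n_def X_def by (rule sp_cover_prob_nn_integral[OF s])
  have Zm: "Z v \<in> sets (gauss 1)" for v
  proof -
    have "{z \<in> space borel. X - 2 * c * (sqrt X * z) / sqrt (z\<^sup>2 + (R v)\<^sup>2) + c\<^sup>2 * (z\<^sup>2 + (R v)\<^sup>2) / (z\<^sup>2 + (R v)\<^sup>2) \<le> real n * D} \<in> sets borel"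
      by measurable
    then show ?thesis by (simp add: Z_def)
  qed
  have E: "X + (real n * s - real n * D) = 2 * c * sqrt X * \<rho>" using eq by (simp add: c_def)
  have E': "real n * s - real n * D = c\<^sup>2 - real n * D" using c by simp
  note cone = cone_condition[OF c(1) X R(1) \<rho> E E', folded k_def]
  have up: "emeasure (gauss 1) (Z v) \<le> ennreal (exp (- k * (\<Sum>i<m. (v i)\<^sup>2) / 2))" for v
  proof -
    have "Z v \<subseteq> {sqrt k * R v..}" unfolding Z_def by (intro subsetI) (simp only: mem_Collect_eq atLeast_iff, erule cone(1))
    then have "G.prob (Z v) \<le> G.prob {sqrt k * R v..}" by (rule G.finite_measure_mono) simp
    also have "\<dots> \<le> exp (- (sqrt k * R v)\<^sup>2 / 2)" using k R(1)[of v] by (intro gauss_Ici_le) simp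
    also have "(sqrt k * R v)\<^sup>2 = k * (\<Sum>i<m. (v i)\<^sup>2)" using k by (simp add: power_mult_distrib R)
    finally show ?thesis by (simp add: G.emeasure_eq_measure)
  qed
  have "ennreal (cover_prob (sp_codeword s) D n x) \<le> (\<integral>\<^sup>+v. ennreal (exp (- k * (\<Sum>i<m. (v i)\<^sup>2) / 2)) \<partial>?P)"
    unfolding cov by (rule nn_integral_mono) (rule up)
  also have "\<dots> = ennreal (sqrt (1 - \<rho>\<^sup>2) ^ m)" using k by (subst nn_integral_gauss_exp_sum_squares) (auto simp: pw)
  finally show "cover_prob (sp_codeword s) D n x \<le> sqrt (1 - \<rho>\<^sup>2) ^ m" using \<rho>2 by (simp add: ennreal_le_iff)
  define c0 where "c0 = exp (- 3 / 2) / 3 / (1 + sqrt k * real n)"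
  have c0: "0 < c0" using k by (auto simp: c0_def add_pos_nonneg)
  have lo: "ennreal (c0 * exp (- k * (\<Sum>i<m. (v i)\<^sup>2) / 2)) \<le> emeasure (gauss 1) (Z v) + ennreal (c0 * exp (- k * (real n)\<^sup>2 / 2))" for v
  proof -
    define a where "a = sqrt k * R v"
    have a: "0 \<le> a" using k R(1)[of v] by (simp add: a_def)
    have a2: "a\<^sup>2 = k * (\<Sum>i<m. (v i)\<^sup>2)" using k by (simp add: a_def power_mult_distrib R)
    have "{a<..a + 1 / (1 + a)} \<subseteq> Z v" unfolding Z_def a_def
      by (intro subsetI) (simp only: mem_Collect_eq greaterThanAtMost_iff, erule conjE, erule cone(2))
    then have "G.prob {a<..a + 1 / (1 + a)} \<le> G.prob (Z v)" by (rule G.finite_measure_mono[OF _ Zm])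
    then have p: "exp (- 3 / 2) / 3 * (exp (- a\<^sup>2 / 2) / (1 + a)) \<le> G.prob (Z v)"
      using gauss_Ioc_near_ge[OF a] by simp
    have "c0 * exp (- k * (\<Sum>i<m. (v i)\<^sup>2) / 2) \<le> G.prob (Z v) + c0 * exp (- k * (real n)\<^sup>2 / 2)"
    proof (cases "R v \<le> real n")
      case True
      then have "a \<le> sqrt k * real n" using k by (simp add: a_def)
      then have "exp (- 3 / 2) / 3 * exp (- a\<^sup>2 / 2) / (1 + sqrt k * real n) \<le> exp (- 3 / 2) / 3 * exp (- a\<^sup>2 / 2) / (1 + a)"
        using a by (intro divide_left_mono) (auto intro!: mult_pos_pos)
      then have "c0 * exp (- a\<^sup>2 / 2) \<le> G.prob (Z v)" using p by (simp add: c0_def)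
      moreover have "0 \<le> c0 * exp (- k * (real n)\<^sup>2 / 2)" using c0 by simp
      ultimately show ?thesis using a2 by simp
    next
      case False
      then have "(real n)\<^sup>2 \<le> (R v)\<^sup>2" by (intro power_mono) auto
      then have "k * (real n)\<^sup>2 \<le> k * (R v)\<^sup>2" using k by (intro mult_left_mono) auto
      then have "exp (- k * (\<Sum>i<m. (v i)\<^sup>2) / 2) \<le> exp (- k * (real n)\<^sup>2 / 2)" by (simp add: R)
      then have "c0 * exp (- k * (\<Sum>i<m. (v i)\<^sup>2) / 2) \<le> c0 * exp (- k * (real n)\<^sup>2 / 2)" using c0 by (intro mult_left_mono) auto
      then show ?thesis by (simp add: add_increasing)
    qed
    then show ?thesis using c0 by (simp add: G.emeasure_eq_measure flip: ennreal_plus)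
  qed
  have mZ: "(\<lambda>v. emeasure (gauss 1) (Z v)) \<in> borel_measurable ?P"
  proof -
    have "{w \<in> space (?P \<Otimes>\<^sub>M gauss 1). X - 2 * c * (sqrt X * snd w) / sqrt ((snd w)\<^sup>2 + (R (fst w))\<^sup>2) + c\<^sup>2 * ((snd w)\<^sup>2 + (R (fst w))\<^sup>2) / ((snd w)\<^sup>2 + (R (fst w))\<^sup>2) \<le> real n * D}
        \<in> sets (?P \<Otimes>\<^sub>M gauss 1)" (is "?W \<in> _") by measurable
    from G.measurable_emeasure_Pair[OF this]
    have "(\<lambda>v. emeasure (gauss 1) (Pair v -` ?W)) \<in> borel_measurable ?P" .
    moreover have "Pair v -` ?W = Z v" if "v \<in> space ?P" for v using that by (auto simp: Z_def space_pair_measure)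
    ultimately show ?thesis by (subst (asm) measurable_cong[where g="\<lambda>v. emeasure (gauss 1) (Z v)"]) auto
  qed
  have "ennreal (c0 * sqrt (1 - \<rho>\<^sup>2) ^ m) = ennreal c0 * (\<integral>\<^sup>+v. ennreal (exp (- k * (\<Sum>i<m. (v i)\<^sup>2) / 2)) \<partial>?P)"
    using k c0 \<rho>2 by (subst nn_integral_gauss_exp_sum_squares) (auto simp: pw ennreal_mult)
  also have "\<dots> = (\<integral>\<^sup>+v. ennreal (c0 * exp (- k * (\<Sum>i<m. (v i)\<^sup>2) / 2)) \<partial>?P)"
    using c0 by (subst nn_integral_cmult[symmetric]) (auto simp: ennreal_mult)
  also have "\<dots> \<le> (\<integral>\<^sup>+v. emeasure (gauss 1) (Z v) + ennreal (c0 * exp (- k * (real n)\<^sup>2 / 2)) \<partial>?P)"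
    by (rule nn_integral_mono) (rule lo)
  also have "\<dots> = ennreal (cover_prob (sp_codeword s) D n x) + ennreal (c0 * exp (- k * (real n)\<^sup>2 / 2))"
    unfolding cov using mZ by (subst nn_integral_add) (auto simp: P.emeasure_space_1)
  also have "\<dots> = ennreal (cover_prob (sp_codeword s) D n x + c0 * exp (- k * (real n)\<^sup>2 / 2))"
    using c0 by (simp add: cover_prob_def)
  finally have "c0 * sqrt (1 - \<rho>\<^sup>2) ^ m \<le> cover_prob (sp_codeword s) D n x + c0 * exp (- k * (real n)\<^sup>2 / 2)"
    using c0 by (subst (asm) ennreal_le_iff) (auto simp: cover_prob_def)
  then show "exp (- 3 / 2) / 3 / (1 + sqrt k * real n) * (sqrt (1 - \<rho>\<^sup>2) ^ m - exp (- k * (real n)\<^sup>2 / 2)) \<le> cover_prob (sp_codeword s) D n x"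
    unfolding c0_def[symmetric] by (simp add: right_diff_distrib)
qed

section \<open>Covering probability of the Gaussian codebook\<close>

text \<open>Chernoff's bound with multiplier \<open>1 / (2 * D)\<close>, the optimal one for a word
  of squared norm \<open>n * (s + D)\<close>. With it each coordinate integral is a convolution of
  normal laws of variances \<open>D\<close> and \<open>s\<close>, and the exponent comes out
  exactly, with no restriction on \<open>x\<close>.\<close>

lemma iid_cover_prob_le:
  fixes x :: "nat \<Rightarrow> real"
  assumes s: "0 < s" and D: "0 < D" and n: "0 < n"
  shows "cover_prob (iid_codeword s) D n x
    \<le> exp (- real n / 2 * ln ((s + D) / D) - ((\<Sum>i<n. (x i)\<^sup>2) - real n * (s + D)) / (2 * (s + D)))"
proof -
  let ?G = "PiM {..<n} (\<lambda>_. gauss (sqrt s))"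
  interpret G: prob_space ?G by (rule prob_space_PiM_gauss) (use s in simp)
  interpret S: product_sigma_finite "\<lambda>_::nat. gauss (sqrt s)" by (rule product_sigma_finite_gauss) (use s in simp)
  have one: "(\<integral>\<^sup>+y. ennreal (exp (1 / 2 - (a - y)\<^sup>2 / (2 * D))) \<partial>gauss (sqrt s))
      = ennreal (exp (1 / 2 - ln ((s + D) / D) / 2 - a\<^sup>2 / (2 * (s + D))))" for a
  proof -
    have sd: "(sqrt D)\<^sup>2 + (sqrt s)\<^sup>2 = s + D" using s D by simp
    have "(\<integral>\<^sup>+y. ennreal (exp (1 / 2 - (a - y)\<^sup>2 / (2 * D))) \<partial>gauss (sqrt s))
      = (\<integral>\<^sup>+y. ennreal (normal_density 0 (sqrt s) y) * ennreal (exp (1 / 2 - (a - y)\<^sup>2 / (2 * D))) \<partial>lborel)"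
      by (rule nn_integral_gauss) simp
    also have "\<dots> = (\<integral>\<^sup>+y. ennreal (exp (1 / 2) * sqrt (2 * pi * D)) * ennreal (normal_density 0 (sqrt D) (a - y) * normal_density 0 (sqrt s) y) \<partial>lborel)"
    proof (rule nn_integral_cong)
      fix y
      have "exp (1 / 2 - (a - y)\<^sup>2 / (2 * D)) = exp (1 / 2) * sqrt (2 * pi * D) * normal_density 0 (sqrt D) (a - y)"
        using D exp_add[of "1 / 2" "- ((a - y)\<^sup>2 / (2 * D))"] by (simp add: normal_density_def)
      then show "ennreal (normal_density 0 (sqrt s) y) * ennreal (exp (1 / 2 - (a - y)\<^sup>2 / (2 * D)))
        = ennreal (exp (1 / 2) * sqrt (2 * pi * D)) * ennreal (normal_density 0 (sqrt D) (a - y) * normal_density 0 (sqrt s) y)"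
        using D by (simp add: ennreal_mult[symmetric] mult_ac)
    qed
    also have "\<dots> = ennreal (exp (1 / 2) * sqrt (2 * pi * D)) * (\<integral>\<^sup>+y. ennreal (normal_density 0 (sqrt D) (a - y) * normal_density 0 (sqrt s) y) \<partial>lborel)"
      by (rule nn_integral_cmult) measurable
    also have "\<dots> = ennreal (exp (1 / 2) * sqrt (2 * pi * D)) * ennreal (normal_density 0 (sqrt (s + D)) a)"
      using fun_cong[OF conv_normal_density_zero_mean[of "sqrt D" "sqrt s"], of a] s D unfolding sd by simp
    also have "\<dots> = ennreal (exp (1 / 2) * sqrt (2 * pi * D) * normal_density 0 (sqrt (s + D)) a)"
      using D by (simp add: ennreal_mult)
    also have "exp (1 / 2) * sqrt (2 * pi * D) * normal_density 0 (sqrt (s + D)) a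
        = exp (1 / 2 - ln ((s + D) / D) / 2 - a\<^sup>2 / (2 * (s + D)))"
    proof -
      have "exp (ln ((s + D) / D) / 2) = sqrt ((s + D) / D)"
        using s D by (simp add: powr_half_sqrt[symmetric] powr_def)
      moreover have "exp (1 / 2 - l - b) = exp (1 / 2) / exp l * exp (- b)" for l b :: real
        using exp_add[of "1 / 2 - l" "- b"] exp_diff[of "1 / 2" l] by simp
      ultimately show ?thesis using s D
        by (simp add: normal_density_def real_sqrt_divide real_sqrt_mult)
    qed
    finally show ?thesis .
  qed
  have "{y \<in> space ?G. dist_n n x y \<le> D} \<in> sets ?G" unfolding dist_n_def by measurable
  then have "ennreal (cover_prob (iid_codeword s) D n x) = (\<integral>\<^sup>+y. indicator {y \<in> space ?G. dist_n n x y \<le> D} y \<partial>?G)"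
    unfolding cover_prob_def iid_codeword_eq by (simp add: G.emeasure_eq_measure)
  also have "\<dots> \<le> (\<integral>\<^sup>+y. (\<Prod>i<n. ennreal (exp (1 / 2 - (x i - y i)\<^sup>2 / (2 * D)))) \<partial>?G)"
  proof (rule nn_integral_mono)
    fix y
    have "(\<Prod>i<n. ennreal (exp (1 / 2 - (x i - y i)\<^sup>2 / (2 * D)))) = ennreal (exp (\<Sum>i<n. 1 / 2 - (x i - y i)\<^sup>2 / (2 * D)))"
      by (simp add: prod_ennreal exp_sum)
    also have "(\<Sum>i<n. 1 / 2 - (x i - y i)\<^sup>2 / (2 * D)) = (real n * D - (\<Sum>i<n. (x i - y i)\<^sup>2)) / (2 * D)"
      using D by (simp add: sum_subtractf sum_divide_distrib[symmetric] diff_divide_distrib)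
    finally have e: "(\<Prod>i<n. ennreal (exp (1 / 2 - (x i - y i)\<^sup>2 / (2 * D)))) = ennreal (exp ((real n * D - (\<Sum>i<n. (x i - y i)\<^sup>2)) / (2 * D)))" .
    show "indicator {y \<in> space ?G. dist_n n x y \<le> D} y \<le> (\<Prod>i<n. ennreal (exp (1 / 2 - (x i - y i)\<^sup>2 / (2 * D))))"
      unfolding e using n D by (auto split: split_indicator simp: dist_n_def field_simps)
  qed
  also have "\<dots> = (\<Prod>i<n. \<integral>\<^sup>+y. ennreal (exp (1 / 2 - (x i - y)\<^sup>2 / (2 * D))) \<partial>gauss (sqrt s))"
    by (rule S.product_nn_integral_prod) auto
  also have "\<dots> = ennreal (exp (\<Sum>i<n. 1 / 2 - ln ((s + D) / D) / 2 - (x i)\<^sup>2 / (2 * (s + D))))"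
    unfolding one by (simp add: prod_ennreal exp_sum)
  also have "(\<Sum>i<n. 1 / 2 - ln ((s + D) / D) / 2 - (x i)\<^sup>2 / (2 * (s + D)))
      = - real n / 2 * ln ((s + D) / D) - ((\<Sum>i<n. (x i)\<^sup>2) - real n * (s + D)) / (2 * (s + D))"
  proof -
    have "real n * u / (2 * u) = real n / 2" if "u \<noteq> 0" for u using that by simp
    from this[of "s + D"] have e: "real n * (s + D) / (2 * (s + D)) = real n / 2" using s D by linarith
    have "(\<Sum>i<n. 1 / 2 - ln ((s + D) / D) / 2 - (x i)\<^sup>2 / (2 * (s + D)))
        = real n * (1 / 2 - ln ((s + D) / D) / 2) - (\<Sum>i<n. (x i)\<^sup>2) / (2 * (s + D))"
      by (simp add: sum_subtractf sum_divide_distrib[symmetric])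
    also have "\<dots> = - real n / 2 * ln ((s + D) / D) - ((\<Sum>i<n. (x i)\<^sup>2) / (2 * (s + D)) - real n / 2)"
      by (simp add: right_diff_distrib)
    finally show ?thesis unfolding diff_divide_distrib e .
  qed
  finally show ?thesis by (simp add: ennreal_le_iff)
qed

section \<open>Chi-square sums near and below their mean\<close>

lemma nn_integral_gauss_scale_sum_squares:
  fixes F :: "real \<Rightarrow> ennreal" and m :: nat
  assumes \<tau>: "0 < \<tau>" and F: "F \<in> borel_measurable borel"
  shows "(\<integral>\<^sup>+v. F (\<Sum>i<m. (v i)\<^sup>2) \<partial>PiM {..<m} (\<lambda>_. gauss \<tau>)) = (\<integral>\<^sup>+v. F (\<tau>\<^sup>2 * (\<Sum>i<m. (v i)\<^sup>2)) \<partial>PiM {..<m} (\<lambda>_. gauss 1))"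
  using F
proof (induction m arbitrary: F)
  case 0
  then show ?case by (simp add: PiM_empty)
next
  case (Suc m)
  note [measurable] = Suc.prems
  interpret P: prob_space "PiM {..<m} (\<lambda>_. gauss 1)" by (rule prob_space_PiM_gauss) simp
  have "(\<integral>\<^sup>+v. F (\<Sum>i<Suc m. (v i)\<^sup>2) \<partial>PiM {..<Suc m} (\<lambda>_. gauss \<tau>))
      = (\<integral>\<^sup>+y. \<integral>\<^sup>+v. F ((\<Sum>i<m. (v i)\<^sup>2) + y\<^sup>2) \<partial>PiM {..<m} (\<lambda>_. gauss \<tau>) \<partial>gauss \<tau>)"
    by (subst nn_integral_PiM_gauss_Suc[OF \<tau>]) simp_all
  also have "\<dots> = (\<integral>\<^sup>+y. \<integral>\<^sup>+v. F (\<tau>\<^sup>2 * (\<Sum>i<m. (v i)\<^sup>2) + y\<^sup>2) \<partial>PiM {..<m} (\<lambda>_. gauss 1) \<partial>gauss \<tau>)"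
    using Suc.IH[of "\<lambda>s. F (s + y\<^sup>2)" for y] by simp
  also have "\<dots> = (\<integral>\<^sup>+y. \<integral>\<^sup>+v. F (\<tau>\<^sup>2 * (\<Sum>i<m. (v i)\<^sup>2) + (\<tau> * y)\<^sup>2) \<partial>PiM {..<m} (\<lambda>_. gauss 1) \<partial>gauss 1)"
    by (rule nn_integral_gauss_scale[OF \<tau>]) measurable
  also have "\<dots> = (\<integral>\<^sup>+v. F (\<tau>\<^sup>2 * (\<Sum>i<Suc m. (v i)\<^sup>2)) \<partial>PiM {..<Suc m} (\<lambda>_. gauss 1))"
    by (subst nn_integral_PiM_gauss_Suc) (simp_all add: distrib_left power_mult_distrib)
  finally show ?case .
qed

text \<open>A window of length \<open>C * ln m\<close> ending at the mean has probability of order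
  \<open>ln m / sqrt m\<close>. The Berry--Esseen errors at its two ends have the same order, so
  \<open>C\<close> must be large enough to beat them.\<close>

lemma chi_square_window:
  "\<exists>C>0. \<forall>\<^sub>F m in sequentially. 1 / real m \<le>
     measure (PiM {..<m} (\<lambda>_. gauss 1)) {v \<in> space (PiM {..<m} (\<lambda>_. gauss 1)). (\<Sum>i<m. (v i)\<^sup>2) \<in> {real m - C * ln (real m)..real m}}"
proof -
  interpret G: prob_space "gauss 1" by (rule prob_space_gauss) simp
  have int: "integrable (gauss 1) (\<lambda>x. x ^ k)" for k
    using integrable_std_normal_distribution_moment[of k] by (simp add: gauss_def)
  have mom: "(\<integral>x. x ^ (2 * k) \<partial>gauss 1) = fact (2 * k) / (2 ^ k * fact k)" for k
    using std_normal_distribution_even_moments(1)[of k] by (simp add: gauss_def)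
  have m2: "(\<integral>x. x\<^sup>2 \<partial>gauss 1) = 1" using mom[of 1] by simp
  have m4: "(\<integral>x. x ^ 4 \<partial>gauss 1) = 3" using mom[of 2] by (simp add: fact_numeral)
  obtain CB where CB: "CB > 0" "\<And>n b. n \<ge> 3 \<Longrightarrow> \<bar>measure (PiM {..<n} (\<lambda>_. gauss 1)) {x \<in> space (PiM {..<n} (\<lambda>_. gauss 1)).
     b * sqrt (real n * 2) < (\<Sum>i<n. (x i)\<^sup>2) - real n} - Qfun b\<bar> \<le> CB * ln (real n) / sqrt (real n)"
    using sum_squares_berry_esseen[OF G.prob_space_axioms _ int int] unfolding m2 m4 by auto
  define \<kappa> where "\<kappa> = exp (- (\<bar>0::real\<bar> + 1)\<^sup>2 / 2) / (3::real)"
  have \<kappa>: "0 < \<kappa>" by (simp add: \<kappa>_def)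
  \<comment> \<open>\<open>2 * CB\<close> covers the errors at both ends, the summand
    \<open>1\<close> leaves \<open>ln m / sqrt m\<close>, and \<open>sqrt 2\<close> is the standard
    deviation of a squared normal variable.\<close>
  define C where "C = (2 * CB + 1) / \<kappa> * sqrt 2"
  have C: "0 < C" using CB \<kappa> by (simp add: C_def)
  have "\<forall>\<^sub>F m in sequentially. (2 * CB + 1) / \<kappa> * (ln (real m) / sqrt (real m)) < 1"
    by (rule order_tendstoD(2)[where y=0]) (real_asymp, simp)
  then have "\<forall>\<^sub>F m in sequentially. 1 / real m \<le>
     measure (PiM {..<m} (\<lambda>_. gauss 1)) {v \<in> space (PiM {..<m} (\<lambda>_. gauss 1)). (\<Sum>i<m. (v i)\<^sup>2) \<in> {real m - C * ln (real m)..real m}}"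
    using eventually_ge_at_top[of 3]
  proof eventually_elim
    case (elim m)
    let ?P = "PiM {..<m} (\<lambda>_. gauss 1)"
    interpret P: prob_space ?P by (rule prob_space_PiM_gauss) simp
    define l where "l = ln (real m)"
    have "ln (exp 1) \<le> ln (real m)" using elim exp_le by (subst ln_le_cancel_iff) auto
    then have l: "1 \<le> l" by (simp add: l_def)
    define h where "h = (2 * CB + 1) / \<kappa> * (l / sqrt (real m))"
    have h: "0 \<le> h" "h \<le> 1" using elim CB \<kappa> l by (auto simp: h_def l_def)
    have hk: "h * \<kappa> = 2 * (CB * l / sqrt (real m)) + l / sqrt (real m)"
      using \<kappa> by (simp add: h_def add_divide_distrib distrib_right)
    have hC: "h * sqrt (real m * 2) = C * l"
      using elim by (simp add: h_def C_def real_sqrt_mult)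
    define A where "A = (\<lambda>b. {x \<in> space ?P. b * sqrt (real m * 2) < (\<Sum>i<m. (x i)\<^sup>2) - real m})"
    have CBA: "\<bar>P.prob (A b) - Qfun b\<bar> \<le> CB * l / sqrt (real m)" for b
      unfolding A_def l_def by (rule CB(2)[OF elim(2)])
    have mA: "A b \<in> sets ?P" for b unfolding A_def by measurable
    have sub: "A 0 \<subseteq> A (0 - h)" 
    proof -
      have "0 \<le> h * sqrt (real m * 2)" using h(1) by simp
      then show ?thesis unfolding A_def by auto
    qed
    have "1 / real m \<le> l / sqrt (real m)"
    proof -
      have "sqrt (real m) * 1 \<le> sqrt (real m) * sqrt (real m)" using elim by (intro mult_left_mono) auto
      then have "1 / real m \<le> 1 / sqrt (real m)" using elim by (intro divide_left_mono) auto
      also have "\<dots> \<le> l / sqrt (real m)" using l by (intro divide_right_mono) auto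
      finally show ?thesis .
    qed
    also have "\<dots> \<le> P.prob (A (0 - h)) - P.prob (A 0)"
      using CBA[of 0] CBA[of "0 - h"] Qfun_shift(2)[OF h, of 0] hk
      unfolding \<kappa>_def[symmetric] abs_le_iff by linarith
    also have "\<dots> = P.prob (A (0 - h) - A 0)"
      by (rule P.finite_measure_Diff[OF mA mA sub, symmetric])
    also have "\<dots> \<le> P.prob {v \<in> space ?P. (\<Sum>i<m. (v i)\<^sup>2) \<in> {real m - C * l..real m}}"
      using hC by (intro P.finite_measure_mono) (auto simp: A_def)
    finally show ?case by (simp add: l_def)
  qed
  then show ?thesis using C by blast
qed

text \<open>Tilting by \<open>r\<close> makes the rare event typical: it becomes the event that the
  sum is at most its mean \<open>m\<close>. On the window the weight is smallest at the lower end
  \<open>m - w\<close>, as \<open>r \<le> 1\<close>. Only \<open>w\<close> and \<open>p\<close> are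
  lost against the large deviation exponent.\<close>

lemma chi_square_lower_tail_ge:
  fixes m :: nat and r w p :: real
  assumes r: "0 < r" "r \<le> 1" and w: "0 \<le> w"
    and p: "p \<le> measure (PiM {..<m} (\<lambda>_. gauss 1)) {v \<in> space (PiM {..<m} (\<lambda>_. gauss 1)). (\<Sum>i<m. (v i)\<^sup>2) \<in> {real m - w..real m}}"
  shows "sqrt r ^ m * exp ((1 - r) / 2 * (real m - w)) * p
     \<le> measure (PiM {..<m} (\<lambda>_. gauss 1)) {v \<in> space (PiM {..<m} (\<lambda>_. gauss 1)). (\<Sum>i<m. (v i)\<^sup>2) \<le> r * real m}"
proof -
  let ?P = "PiM {..<m} (\<lambda>_. gauss 1)"
  interpret P: prob_space ?P by (rule prob_space_PiM_gauss) simp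
  define W where "W = {v \<in> space ?P. (\<Sum>i<m. (v i)\<^sup>2) \<in> {real m - w..real m}}"
  define c where "c = sqrt r ^ m * exp ((1 - r) / 2 * (real m - w))"
  have c: "0 \<le> c" using r by (simp add: c_def)
  have [measurable]: "W \<in> sets ?P" unfolding W_def by measurable
  have mL: "{v \<in> space ?P. (\<Sum>i<m. (v i)\<^sup>2) \<le> r * real m} \<in> sets ?P" by measurable
  have "ennreal (c * P.prob W) = (\<integral>\<^sup>+v. ennreal c * indicator W v \<partial>?P)"
    using c by (simp add: nn_integral_cmult_indicator P.emeasure_eq_measure ennreal_mult)
  also have "\<dots> \<le> (\<integral>\<^sup>+v. ennreal (sqrt r ^ m * exp ((1 - r) / 2 * (\<Sum>i<m. (v i)\<^sup>2))) * indicator {..r * real m} (r * (\<Sum>i<m. (v i)\<^sup>2)) \<partial>?P)"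
  proof (rule nn_integral_mono)
    fix v
    show "ennreal c * indicator W v \<le> ennreal (sqrt r ^ m * exp ((1 - r) / 2 * (\<Sum>i<m. (v i)\<^sup>2))) * indicator {..r * real m} (r * (\<Sum>i<m. (v i)\<^sup>2))"
    proof (cases "v \<in> W")
      case True
      then have S: "real m - w \<le> (\<Sum>i<m. (v i)\<^sup>2)" "(\<Sum>i<m. (v i)\<^sup>2) \<le> real m" by (auto simp: W_def)
      have "(1 - r) / 2 * (real m - w) \<le> (1 - r) / 2 * (\<Sum>i<m. (v i)\<^sup>2)" using r S by (intro mult_left_mono) auto
      then have "c \<le> sqrt r ^ m * exp ((1 - r) / 2 * (\<Sum>i<m. (v i)\<^sup>2))" unfolding c_def using r by (intro mult_left_mono) auto
      moreover have "r * (\<Sum>i<m. (v i)\<^sup>2) \<le> r * real m" using r S by simp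
      ultimately show ?thesis using True by (simp add: ennreal_leI)
    qed simp
  qed
  also have "\<dots> = (\<integral>\<^sup>+v. indicator {..r * real m} (\<Sum>i<m. (v i)\<^sup>2) \<partial>?P)"
    by (rule nn_integral_gauss_tilt[symmetric]) (use r in auto)
  also have "\<dots> = (\<integral>\<^sup>+v. indicator {v \<in> space ?P. (\<Sum>i<m. (v i)\<^sup>2) \<le> r * real m} v \<partial>?P)"
    by (intro nn_integral_cong) (auto split: split_indicator)
  also have "\<dots> = ennreal (P.prob {v \<in> space ?P. (\<Sum>i<m. (v i)\<^sup>2) \<le> r * real m})"
    using mL by (simp add: P.emeasure_eq_measure)
  finally have "c * P.prob W \<le> P.prob {v \<in> space ?P. (\<Sum>i<m. (v i)\<^sup>2) \<le> r * real m}"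
    by (simp add: ennreal_le_iff)
  moreover have "c * p \<le> c * P.prob W" using p c unfolding W_def by (intro mult_left_mono) auto
  ultimately show ?thesis by (simp add: c_def)
qed

text \<open>The component along \<open>x\<close> is put into a short interval above
  \<open>sqrt s * a\<close> and the orthogonal part into a ball; by independence the probabilities
  multiply. The second assumption on \<open>a\<close> says that the interval reaches no farther
  beyond \<open>sqrt X\<close> than its lower end lies below, so the lower end is the worst
  case.\<close>

lemma iid_cover_prob_ge:
  fixes x :: "nat \<Rightarrow> real" and s D a q :: real and m :: nat
  defines "n \<equiv> Suc m" and "X \<equiv> \<Sum>i<Suc m. (x i)\<^sup>2"
  assumes s: "0 < s" and a: "0 \<le> a" "sqrt s * (a + 1 / (1 + a)) \<le> 2 * sqrt X - sqrt s * a"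
    and q: "s * q \<le> real n * D - (sqrt X - sqrt s * a)\<^sup>2"
  shows "exp (- 3 / 2) / 3 * (exp (- a\<^sup>2 / 2) / (1 + a)) *
      measure (PiM {..<m} (\<lambda>_. gauss 1)) {v \<in> space (PiM {..<m} (\<lambda>_. gauss 1)). (\<Sum>i<m. (v i)\<^sup>2) \<le> q}
    \<le> cover_prob (iid_codeword s) D n x"
proof -
  let ?P = "PiM {..<m} (\<lambda>_. gauss 1)" and ?Ps = "PiM {..<m} (\<lambda>_. gauss (sqrt s))" and ?G = "PiM {..<n} (\<lambda>_. gauss (sqrt s))"
  have \<tau>: "0 < sqrt s" using s by simp
  interpret Pn: prob_space ?G by (rule prob_space_PiM_gauss[OF \<tau>])
  interpret P: prob_space ?P by (rule prob_space_PiM_gauss) simp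
  interpret Ps: prob_space ?Ps by (rule prob_space_PiM_gauss[OF \<tau>])
  interpret G: prob_space "gauss (sqrt s)" by (rule prob_space_gauss[OF \<tau>])
  interpret G1: prob_space "gauss 1" by (rule prob_space_gauss) simp
  define I where "I = {sqrt s * a<..sqrt s * (a + 1 / (1 + a))}"
  define B where "B = {(p, t). X - 2 * p + t \<le> real n * D}"
  have B [measurable]: "B \<in> sets (borel \<Otimes>\<^sub>M borel)"
  proof -
    have "{z \<in> space (borel \<Otimes>\<^sub>M borel). X - 2 * fst z + snd z \<le> real n * D} \<in> sets (borel \<Otimes>\<^sub>M borel)" by measurable
    also have "{z \<in> space (borel \<Otimes>\<^sub>M borel). X - 2 * fst z + snd z \<le> real n * D} = B"
      by (auto simp: B_def space_pair_measure)
    finally show ?thesis .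
  qed
  have Xnn: "0 \<le> X" unfolding X_def by (rule sum_nonneg) simp
  have pt: "indicator I z * indicator {..s * q} R2 \<le> (indicator B (sqrt X * z, z\<^sup>2 + R2) :: ennreal)" for z R2
  proof (cases "z \<in> I \<and> R2 \<le> s * q")
    case True
    then have "\<bar>sqrt X - z\<bar> \<le> sqrt X - sqrt s * a" using a(2) by (auto simp: I_def abs_le_iff)
    then have "(sqrt X - z)\<^sup>2 \<le> (sqrt X - sqrt s * a)\<^sup>2" using power_mono[of "\<bar>sqrt X - z\<bar>" _ 2] by fastforce
    then have "(sqrt X - z)\<^sup>2 + R2 \<le> real n * D" using True q by linarith
    moreover have "(sqrt X - z)\<^sup>2 = X - 2 * (sqrt X * z) + z\<^sup>2" using Xnn by (simp add: power2_diff)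
    ultimately have "(sqrt X * z, z\<^sup>2 + R2) \<in> B" by (simp add: B_def)
    then show ?thesis by (simp add: indicator_def)
  qed (auto split: split_indicator)
  have d: "dist_n n x z \<le> D \<longleftrightarrow> (\<Sum>i<n. x i * z i, \<Sum>i<n. (z i)\<^sup>2) \<in> B" for z
  proof -
    have "(\<Sum>i<n. (x i - z i)\<^sup>2) = (\<Sum>i<n. (x i)\<^sup>2 - 2 * (x i * z i) + (z i)\<^sup>2)"
      by (intro sum.cong refl) (simp add: power2_diff)
    also have "\<dots> = X - 2 * (\<Sum>i<n. x i * z i) + (\<Sum>i<n. (z i)\<^sup>2)"
      unfolding X_def n_def by (simp only: sum.distrib sum_subtractf sum_distrib_left[symmetric])
    finally show ?thesis unfolding dist_n_def B_def by (simp add: pos_divide_le_eq mult.commute n_def)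
  qed
  have PI: "exp (- 3 / 2) / 3 * (exp (- a\<^sup>2 / 2) / (1 + a)) \<le> G.prob I"
  proof -
    have "{z. sqrt s * z \<in> I} = {a<..a + 1 / (1 + a)}" using \<tau> unfolding I_def by auto
    then have "G.prob I = G1.prob {a<..a + 1 / (1 + a)}" using \<tau> by (subst measure_gauss_scale) (auto simp: I_def)
    then show ?thesis using gauss_Ioc_near_ge[OF a(1)] by simp
  qed
  have "ennreal (G.prob I * P.prob {v \<in> space ?P. (\<Sum>i<m. (v i)\<^sup>2) \<le> q})
     = emeasure (gauss (sqrt s)) I * (\<integral>\<^sup>+v. indicator {..s * q} ((sqrt s)\<^sup>2 * (\<Sum>i<m. (v i)\<^sup>2)) \<partial>?P)"
  proof -
    have "(\<integral>\<^sup>+v. indicator {..s * q} ((sqrt s)\<^sup>2 * (\<Sum>i<m. (v i)\<^sup>2)) \<partial>?P) = (\<integral>\<^sup>+v. indicator {v \<in> space ?P. (\<Sum>i<m. (v i)\<^sup>2) \<le> q} v \<partial>?P)"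
      using s by (intro nn_integral_cong) (auto split: split_indicator)
    also have "\<dots> = emeasure ?P {v \<in> space ?P. (\<Sum>i<m. (v i)\<^sup>2) \<le> q}"
      by (rule nn_integral_indicator) measurable
    finally show ?thesis by (simp add: G.emeasure_eq_measure P.emeasure_eq_measure ennreal_mult)
  qed
  also have "\<dots> = emeasure (gauss (sqrt s)) I * (\<integral>\<^sup>+v. indicator {..s * q} (\<Sum>i<m. (v i)\<^sup>2) \<partial>?Ps)"
    by (subst nn_integral_gauss_scale_sum_squares[OF \<tau>]) auto
  also have "\<dots> = (\<integral>\<^sup>+z. indicator I z * (\<integral>\<^sup>+v. indicator {..s * q} (\<Sum>i<m. (v i)\<^sup>2) \<partial>?Ps) \<partial>gauss (sqrt s))"
    by (subst nn_integral_multc) (auto simp: I_def)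
  also have "\<dots> = (\<integral>\<^sup>+z. \<integral>\<^sup>+v. indicator I z * indicator {..s * q} (\<Sum>i<m. (v i)\<^sup>2) \<partial>?Ps \<partial>gauss (sqrt s))"
    by (intro nn_integral_cong) (subst nn_integral_cmult, auto)
  also have "\<dots> \<le> (\<integral>\<^sup>+z. \<integral>\<^sup>+v. indicator B (sqrt X * z, z\<^sup>2 + (\<Sum>i<m. (v i)\<^sup>2)) \<partial>?Ps \<partial>gauss (sqrt s))"
    by (intro nn_integral_mono pt)
  also have "\<dots> = (\<integral>\<^sup>+z. indicator B (\<Sum>i<n. x i * z i, \<Sum>i<n. (z i)\<^sup>2) \<partial>?G)"
    unfolding n_def X_def by (rule nn_integral_gauss_linear_quadratic[OF \<tau>, symmetric]) auto
  also have "\<dots> = (\<integral>\<^sup>+z. indicator {z \<in> space ?G. (\<Sum>i<n. x i * z i, \<Sum>i<n. (z i)\<^sup>2) \<in> B} z \<partial>?G)"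
    by (intro nn_integral_cong) (auto split: split_indicator)
  also have "\<dots> = emeasure ?G {z \<in> space ?G. (\<Sum>i<n. x i * z i, \<Sum>i<n. (z i)\<^sup>2) \<in> B}"
    by (rule nn_integral_indicator) measurable
  also have "\<dots> = ennreal (cover_prob (iid_codeword s) D n x)"
    unfolding cover_prob_def iid_codeword_eq d by (simp add: Pn.emeasure_eq_measure)
  finally have "G.prob I * P.prob {v \<in> space ?P. (\<Sum>i<m. (v i)\<^sup>2) \<le> q} \<le> cover_prob (iid_codeword s) D n x"
    by (simp add: ennreal_le_iff cover_prob_def)
  moreover have "exp (- 3 / 2) / 3 * (exp (- a\<^sup>2 / 2) / (1 + a)) * P.prob {v \<in> space ?P. (\<Sum>i<m. (v i)\<^sup>2) \<le> q}
     \<le> G.prob I * P.prob {v \<in> space ?P. (\<Sum>i<m. (v i)\<^sup>2) \<le> q}"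
    by (intro mult_right_mono PI) simp
  ultimately show ?thesis by linarith
qed

section \<open>Exponents of the covering probabilities\<close>

context memoryless_source
begin

text \<open>\<open>2 * T n x / n\<close> is the relative deviation of the power. Its smallness keeps
  the Taylor estimates of the logarithm valid, and \<open>n\<close> times its square bounds their
  remainders.\<close>

lemma T_small:
  assumes "0 \<le> A" "0 < y0"
  shows "\<forall>\<^sub>F n in sequentially. \<forall>x. \<bar>T n x\<bar> \<le> A * sqrt (real n * ln (real n)) \<longrightarrow>
     \<bar>2 * T n x / real n\<bar> \<le> y0 \<and> real n * (2 * T n x / real n)\<^sup>2 \<le> 4 * A\<^sup>2 * ln (real n)"
proof -
  have "\<forall>\<^sub>F n in sequentially. 2 * (A * sqrt (real n * ln (real n))) / real n < y0"
    by (rule order_tendstoD(2)[where y=0]) (real_asymp, rule assms(2))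
  then show ?thesis using eventually_ge_at_top[of 3]
  proof eventually_elim
    case (elim n)
    show ?case
    proof (intro allI impI conjI)
      fix x assume x: "\<bar>T n x\<bar> \<le> A * sqrt (real n * ln (real n))"
      have "\<bar>2 * T n x / real n\<bar> = 2 * \<bar>T n x\<bar> / real n" by (simp add: abs_mult)
      also have "\<dots> \<le> 2 * (A * sqrt (real n * ln (real n))) / real n"
        using x by (intro divide_right_mono mult_left_mono) auto
      finally show "\<bar>2 * T n x / real n\<bar> \<le> y0" using elim by linarith
      have "(T n x)\<^sup>2 \<le> (A * sqrt (real n * ln (real n)))\<^sup>2"
        using power_mono[OF x, of 2] by simp
      also have "\<dots> = A\<^sup>2 * (real n * ln (real n))" using elim by (simp add: power_mult_distrib)
      finally have "4 * (T n x)\<^sup>2 / real n \<le> 4 * (A\<^sup>2 * (real n * ln (real n))) / real n"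
        by (intro divide_right_mono mult_left_mono) auto
      then show "real n * (2 * T n x / real n)\<^sup>2 \<le> 4 * A\<^sup>2 * ln (real n)"
        using elim by (simp add: power_divide power_mult_distrib power2_eq_square[of "real n"])
    qed
  qed
qed

lemma sum_squares_eq:
  assumes "0 < n"
  shows "(\<Sum>i<n. (x i)\<^sup>2) = real n * s2 * (1 + 2 * T n x / real n)"
  using assms s2_pos by (simp add: T_def field_simps)

text \<open>For relative power deviation \<open>y\<close> the squared sine of the half-angle is
  exactly \<open>D / s2 * ((1 - a * y\<^sup>2) / (1 + y))\<close>. The linear dependence on
  \<open>y\<close> comes from \<open>1 + y\<close> alone, and \<open>n / 2 * ln (1 + y)\<close> is
  \<open>T\<close> up to \<open>O(ln n)\<close>.\<close>

lemma sp_cover_prob_exponent: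
  fixes D A :: real
  defines "L \<equiv> ln (s2 / D)"
  assumes D: "0 < D" "D < s2" and A: "0 \<le> A"
  shows "\<exists>K\<ge>0. \<forall>\<^sub>F n in sequentially. \<forall>x\<in>space (source_n P n). \<bar>T n x\<bar> \<le> A * sqrt (real n * ln (real n)) \<longrightarrow>
       exp (- real n / 2 * L - T n x - K * ln (real n)) \<le> cover_prob (sp_codeword (s2 - D)) D n x \<and>
       cover_prob (sp_codeword (s2 - D)) D n x \<le> exp (- real n / 2 * L - T n x + K * ln (real n))"
proof -
  define s where "s = s2 - D"
  have s: "0 < s" "s < s2" "s2 = s + D" using D by (auto simp: s_def)
  define a where "a = s2\<^sup>2 / (4 * s * D)"
  have a: "0 < a" using s D by (simp add: a_def)
  \<comment> \<open>\<open>1 / 2\<close> serves the logarithm estimates, \<open>s / s2\<close> keeps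
    the cosine \<open>\<rho>\<close> positive, and \<open>1 / (1 + 2 * a)\<close> gives
    \<open>a * y\<^sup>2 \<le> 1 / 2\<close>.\<close>
  define y0 where "y0 = min (min (1 / 2) (s / s2)) (1 / (1 + 2 * a))"
  have y0: "0 < y0" using s D a by (auto simp: y0_def)
  have L: "0 \<le> L" using D by (simp add: L_def)
  define c1 :: real where "c1 = exp (- 3 / 2) / 3"
  have c1: "0 < c1" by (simp add: c1_def)
  \<comment> \<open>\<open>k0\<close> and \<open>kmax\<close> will enclose the squared cotangent
    \<open>k\<close> of the half-angle.\<close>
  define kmax where "kmax = 3 * s2 / D"
  have kmax: "0 < kmax" using D by (simp add: kmax_def)
  define k0 where "k0 = s / (6 * s2)"
  have k0: "0 < k0" using s D by (simp add: k0_def)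
  \<comment> \<open>The \<open>2\<close> comes from the truncation term, at most half of the main
    one; \<open>1 + sqrt kmax\<close> bounds \<open>1 + sqrt k * n\<close> after splitting off
    \<open>n\<close>.\<close>
  define c2 where "c2 = c1 / (2 * (1 + sqrt kmax))"
  have c2: "0 < c2" using c1 kmax by (auto simp: c2_def intro!: divide_pos_pos add_pos_nonneg)
  define K1 where "K1 = L / 2 + 1 / 4 + 4 * (a + 1) * A\<^sup>2"
  have K1: "0 \<le> K1" using L a by (simp add: K1_def)
  define K where "K = K1 + 1 + \<bar>ln c2\<bar>"
  have K: "0 \<le> K" using K1 by (simp add: K_def)
  have "\<forall>\<^sub>F n in sequentially. 2 / k0 < real n" by real_asymp
  then have "\<forall>\<^sub>F n in sequentially. \<forall>x\<in>space (source_n P n). \<bar>T n x\<bar> \<le> A * sqrt (real n * ln (real n)) \<longrightarrow>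
       exp (- real n / 2 * L - T n x - K * ln (real n)) \<le> cover_prob (sp_codeword s) D n x \<and>
       cover_prob (sp_codeword s) D n x \<le> exp (- real n / 2 * L - T n x + K * ln (real n))"
    using T_small[OF A y0] eventually_ge_at_top[of 3]
  proof eventually_elim
    case (elim n)
    show ?case
    proof (intro ballI impI)
      fix x assume "\<bar>T n x\<bar> \<le> A * sqrt (real n * ln (real n))"
      define y where "y = 2 * T n x / real n"
      define l where "l = ln (real n)"
      have y: "\<bar>y\<bar> \<le> y0" "real n * y\<^sup>2 \<le> 4 * A\<^sup>2 * l"
        using elim(2) \<open>\<bar>T n x\<bar> \<le> _\<close> unfolding y_def l_def by auto
      have Ty: "T n x = real n * y / 2" using elim(3) by (simp add: y_def)
      obtain m where m: "n = Suc m" using elim(3) by (cases n) auto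
      have nm: "real n = real m + 1" by (simp add: m)
      have "ln (exp 1) \<le> ln (real n)" using elim(3) exp_le by (subst ln_le_cancel_iff) auto
      then have l: "1 \<le> l" by (simp add: l_def)
      have yh: "\<bar>y\<bar> \<le> 1 / 2" and ys: "\<bar>y\<bar> \<le> s / s2" and ya: "\<bar>y\<bar> \<le> 1 / (1 + 2 * a)"
        using y(1) by (auto simp: y0_def)
      have y1: "1 / 2 \<le> 1 + y" "1 + y \<le> 3 / 2" using yh by (auto simp: abs_le_iff)
      have sy: "s \<le> 2 * s + s2 * y"
      proof -
        have "s2 * \<bar>y\<bar> \<le> s" using ys s D by (simp add: field_simps)
        moreover have "\<bar>s2 * y\<bar> = s2 * \<bar>y\<bar>" using s2_pos by (simp add: abs_mult)
        ultimately show ?thesis by linarith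
      qed
      define t where "t = a * y\<^sup>2"
      have t: "0 \<le> t" "t \<le> 1 / 2"
      proof -
        show "0 \<le> t" using a by (simp add: t_def)
        have "y\<^sup>2 = \<bar>y\<bar> * \<bar>y\<bar>" by (simp add: power2_eq_square)
        also have "\<dots> \<le> \<bar>y\<bar> * 1" using yh by (intro mult_left_mono) auto
        finally have "t \<le> a * \<bar>y\<bar>" unfolding t_def using a by (intro mult_left_mono) auto
        also have "\<dots> \<le> a * (1 / (1 + 2 * a))" using ya a by (intro mult_left_mono) auto
        also have "\<dots> \<le> 1 / 2" using a by (simp add: field_simps)
        finally show "t \<le> 1 / 2" .
      qed
      define g where "g = D / s2 * ((1 - t) / (1 + y))"
      have g0: "0 < g" unfolding g_def using D s2_pos t y1 by (intro mult_pos_pos divide_pos_pos) auto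
      have gmin: "1 / kmax \<le> g"
      proof -
        have "(1 / 2) / (3 / 2) \<le> (1 - t) / (1 + y)" using t y1 by (intro frac_le) auto
        then have "D / s2 * (1 / 3) \<le> g" unfolding g_def using D s2_pos by (intro mult_left_mono) auto
        then show ?thesis by (simp add: kmax_def)
      qed
      \<comment> \<open>The cosine solving the cone equation for \<open>X = n * s2 * (1 + y)\<close>
        and codeword power \<open>s\<close>; the common factor \<open>n\<close> has
        cancelled.\<close>
      define \<rho> where "\<rho> = (2 * s + s2 * y) / (2 * sqrt (s * s2 * (1 + y)))"
      have w0: "0 < s * s2 * (1 + y)" using s s2_pos y1 by simp
      have \<rho>0: "0 < \<rho>" unfolding \<rho>_def using w0 sy s by (intro divide_pos_pos) auto
      have \<rho>sq: "\<rho>\<^sup>2 = (2 * s + s2 * y)\<^sup>2 / (4 * (s * s2 * (1 + y)))"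
        using w0 by (simp add: \<rho>_def power_divide power_mult_distrib)
      have \<rho>g: "1 - \<rho>\<^sup>2 = g"
      proof -
        have 1: "4 * (s * s2 * (1 + y)) - (2 * s + s2 * y)\<^sup>2 = 4 * s * D - s2\<^sup>2 * y\<^sup>2"
          unfolding s(3) by (simp add: power2_eq_square algebra_simps)
        have 2: "4 * s * D - s2\<^sup>2 * y\<^sup>2 = 4 * s * D * (1 - t)"
          using s D by (simp add: t_def a_def field_simps)
        have "1 - \<rho>\<^sup>2 = (4 * (s * s2 * (1 + y)) - (2 * s + s2 * y)\<^sup>2) / (4 * (s * s2 * (1 + y)))"
          unfolding \<rho>sq using s s2_pos y1 by (simp add: diff_divide_distrib)
        also have "\<dots> = 4 * s * D * (1 - t) / (4 * s * (s2 * (1 + y)))" unfolding 1 2 by (simp add: mult.assoc)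
        also have "\<dots> = g" using s by (simp add: g_def)
        finally show ?thesis .
      qed
      have \<rho>1: "\<rho> < 1" using \<rho>g g0 \<rho>0 by (smt (verit) one_le_power)
      define X where "X = (\<Sum>i<Suc m. (x i)\<^sup>2)"
      have X: "X = real n * s2 * (1 + y)" unfolding X_def m[symmetric] y_def by (rule sum_squares_eq) (use elim(3) in simp)
      have X0: "0 < X" unfolding X using elim(3) s2_pos y1 by simp
      have eq: "X + real (Suc m) * s - real (Suc m) * D = 2 * sqrt (real (Suc m) * s) * sqrt X * \<rho>"
      proof -
        have "sqrt (real n * s) * sqrt X = sqrt ((real n)\<^sup>2 * (s * s2 * (1 + y)))"
          unfolding X by (simp add: real_sqrt_mult[symmetric] power2_eq_square mult_ac)
        also have "\<dots> = real n * sqrt (s * s2 * (1 + y))" by (simp add: real_sqrt_mult)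
        finally have "2 * sqrt (real n * s) * sqrt X * \<rho> = 2 * (real n * sqrt (s * s2 * (1 + y))) * \<rho>" by simp
        also have "\<dots> = real n * (2 * s + s2 * y)" unfolding \<rho>_def using w0 by (simp add: field_simps)
        also have "\<dots> = X + real n * s - real n * D" unfolding X by (simp add: algebra_simps s(3))
        finally show ?thesis by (simp add: m)
      qed
      define k where "k = \<rho>\<^sup>2 / (1 - \<rho>\<^sup>2)"
      note b = sp_cover_prob_bounds[OF s(1) X0[unfolded X_def] \<rho>0 \<rho>1 eq[unfolded X_def], folded m k_def, unfolded \<rho>g]
      have k1: "1 + k = 1 / g" using g0 unfolding k_def \<rho>g by (simp add: field_simps flip: \<rho>g)
      define e where "e = real m / 2 * ln g"
      have ee: "sqrt g ^ m = exp e"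
      proof -
        have "sqrt g = exp (ln g / 2)" using g0 by (simp add: powr_half_sqrt[symmetric] powr_def)
        then show ?thesis by (simp add: e_def flip: exp_of_nat_mult)
      qed
      have lng: "ln g = - L + ln (1 - t) - ln (1 + y)"
        unfolding g_def L_def using D s2_pos t y1 by (simp add: ln_mult ln_div)
      have lt: "\<bar>ln (1 - t)\<bar> \<le> 2 * t"
      proof -
        have "\<bar>ln (1 + - t) - (- t)\<bar> \<le> 2 * (- t)\<^sup>2" using t by (intro abs_ln_one_plus_x_minus_x_bound) auto
        moreover have "2 * t\<^sup>2 \<le> t" using mult_left_mono[OF t(2) t(1)] by (simp add: power2_eq_square)
        ultimately show ?thesis using t by (simp add: abs_le_iff)
      qed
      have ly: "\<bar>ln (1 + y) - y\<bar> \<le> 2 * y\<^sup>2" using yh by (rule abs_ln_one_plus_x_minus_x_bound)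
      \<comment> \<open>The terms \<open>L / 2\<close> and \<open>y / 2\<close> stem from the
        exponent \<open>m = n - 1\<close>.\<close>
      have "e - (- real n / 2 * L - T n x) = L / 2 + real m / 2 * ln (1 - t) - real m / 2 * (ln (1 + y) - y) + y / 2"
        unfolding e_def lng Ty nm by (simp add: field_simps)
      also have "\<bar>\<dots>\<bar> \<le> L / 2 + real m / 2 * (2 * t) + real m / 2 * (2 * y\<^sup>2) + 1 / 4"
      proof -
        have "\<bar>real m / 2 * ln (1 - t)\<bar> \<le> real m / 2 * (2 * t)" unfolding abs_mult using lt by (intro mult_mono) auto
        moreover have "\<bar>real m / 2 * (ln (1 + y) - y)\<bar> \<le> real m / 2 * (2 * y\<^sup>2)" unfolding abs_mult using ly by (intro mult_mono) auto
        ultimately show ?thesis using yh L by linarith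
      qed
      also have "\<dots> = L / 2 + 1 / 4 + (a + 1) * (real m * y\<^sup>2)" by (simp add: t_def algebra_simps)
      also have "\<dots> \<le> L / 2 + 1 / 4 + (a + 1) * (4 * A\<^sup>2 * l)"
      proof -
        have "real m * y\<^sup>2 \<le> real n * y\<^sup>2" by (simp add: m mult_right_mono)
        then show ?thesis using a y(2) by (intro add_left_mono mult_left_mono) auto
      qed
      also have "\<dots> \<le> K1 * l"
      proof -
        have "(L / 2 + 1 / 4) * 1 \<le> (L / 2 + 1 / 4) * l" using l L by (intro mult_left_mono) auto
        then show ?thesis by (simp add: K1_def algebra_simps)
      qed
      finally have eK: "\<bar>e - (- real n / 2 * L - T n x)\<bar> \<le> K1 * l" .
      have K1l: "K1 * l \<le> K * l" using l K1 by (intro mult_right_mono) (auto simp: K_def)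
      have upper: "cover_prob (sp_codeword s) D n x \<le> exp (- real n / 2 * L - T n x + K * l)"
      proof -
        have "cover_prob (sp_codeword s) D n x \<le> exp e" using b(1) ee by simp
        also have "\<dots> \<le> exp (- real n / 2 * L - T n x + K * l)" using eK K1l by simp
        finally show ?thesis .
      qed
      have kle: "k \<le> kmax"
      proof -
        have "1 / g \<le> kmax" using gmin g0 kmax by (simp add: field_simps)
        then show ?thesis using k1 by linarith
      qed
      have kge: "k0 \<le> k"
      proof -
        have "s\<^sup>2 \<le> (2 * s + s2 * y)\<^sup>2" using sy s by (intro power_mono) auto
        moreover have "4 * (s * s2 * (1 + y)) \<le> 4 * (s * s2 * (3 / 2))" using y1 s s2_pos by (intro mult_left_mono) auto
        ultimately have "s\<^sup>2 / (4 * (s * s2 * (3 / 2))) \<le> \<rho>\<^sup>2" unfolding \<rho>sq using w0 by (intro frac_le) auto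
        moreover have "s\<^sup>2 / (4 * (s * s2 * (3 / 2))) = k0" using s by (simp add: k0_def power2_eq_square)
        moreover have "\<rho>\<^sup>2 \<le> k" unfolding k_def using \<rho>g g0 by (simp add: field_simps)
        ultimately show ?thesis by linarith
      qed
      \<comment> \<open>The truncation term has exponent quadratic in \<open>n\<close>, that of
        \<open>exp e\<close> is linear: \<open>- ln g = ln (1 + k) \<le> k\<close>. The lower bound
        \<open>k0\<close> makes the comparison uniform in \<open>x\<close>.\<close>
      have half: "exp (- k * (real n)\<^sup>2 / 2) \<le> exp e / 2"
      proof -
        have "- ln g = ln (1 + k)" unfolding k1 using g0 by (simp add: ln_div)
        also have "\<dots> \<le> k" using kge k0 by (intro ln_add_one_self_le_self) simp
        finally have "real m / 2 * (- ln g) \<le> real m / 2 * k" by (intro mult_left_mono) auto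
        then have e1: "- (real m / 2 * k) \<le> e" by (simp add: e_def)
        have "2 \<le> k0 * real n" using elim(1) k0 by (simp add: field_simps)
        also have "\<dots> \<le> k * ((real n)\<^sup>2 - real m)"
        proof (intro mult_mono kge)
          have "2 * real n \<le> real n * real n" using elim(3) by (intro mult_right_mono) auto
          then show "real n \<le> (real n)\<^sup>2 - real m" using m by (simp add: power2_eq_square)
        qed (use k0 kge in auto)
        finally have "- k * (real n)\<^sup>2 / 2 \<le> e + - 1" using e1 by (simp add: algebra_simps)
        then have "exp (- k * (real n)\<^sup>2 / 2) \<le> exp e * exp (- 1)" by (simp only: exp_add[symmetric] exp_le_cancel_iff)
        also have "\<dots> \<le> exp e * (1 / 2)"
          using exp_ge_add_one_self[of 1] by (intro mult_left_mono) (auto simp: exp_minus field_simps)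
        finally show ?thesis by simp
      qed
      have lower: "exp (- real n / 2 * L - T n x - K * l) \<le> cover_prob (sp_codeword s) D n x"
      proof -
        have "- K * l = - K1 * l + - 1 * l + - \<bar>ln c2\<bar> * l" by (simp add: K_def algebra_simps)
        moreover have "- \<bar>ln c2\<bar> * l \<le> ln c2"
        proof -
          have "\<bar>ln c2\<bar> * 1 \<le> \<bar>ln c2\<bar> * l" using l by (intro mult_left_mono) auto
          then show ?thesis by (simp add: abs_le_iff) 
        qed
        ultimately have "- real n / 2 * L - T n x - K * l \<le> ln c2 + (- l) + e" using eK by simp
        then have "exp (- real n / 2 * L - T n x - K * l) \<le> exp (ln c2 + (- l) + e)" by simp
        also have "\<dots> = c2 * (1 / real n) * exp e"
          unfolding exp_add using c2 elim(3) by (simp add: l_def exp_minus field_simps)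
        also have "\<dots> = c1 / ((1 + sqrt kmax) * real n) * (exp e / 2)"
          by (simp add: c2_def field_simps)
        also have "\<dots> \<le> c1 / (1 + sqrt k * real n) * (exp e / 2)"
        proof (intro mult_right_mono divide_left_mono)
          have "sqrt k * real n \<le> sqrt kmax * real n" using kle by (intro mult_right_mono) auto
          moreover have "1 \<le> real n" using elim(3) by simp
          ultimately show "1 + sqrt k * real n \<le> (1 + sqrt kmax) * real n" unfolding distrib_right by linarith
          show "0 < (1 + sqrt kmax) * real n * (1 + sqrt k * real n)"
            using kmax kge k0 elim(3) by (intro mult_pos_pos add_pos_nonneg) auto
        qed (use c1 in auto)
        also have "\<dots> \<le> c1 / (1 + sqrt k * real n) * (exp e - exp (- k * (real n)\<^sup>2 / 2))"
          using half c1 kge k0 by (intro mult_left_mono divide_nonneg_nonneg) auto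
        also have "\<dots> \<le> cover_prob (sp_codeword s) D n x" using b(2) by (simp add: ee c1_def)
        finally show ?thesis .
      qed
      show "exp (- real n / 2 * L - T n x - K * ln (real n)) \<le> cover_prob (sp_codeword s) D n x \<and>
         cover_prob (sp_codeword s) D n x \<le> exp (- real n / 2 * L - T n x + K * ln (real n))"
        using lower upper by (simp add: l_def)
    qed
  qed
  then show ?thesis using K unfolding s_def by blast
qed

text \<open>In the lower bound the component of the codeword along \<open>x\<close> is the one of
  the optimal test channel, \<open>s / s2\<close> times \<open>x\<close>. The residual,
  \<open>D / s2\<close> times \<open>x\<close>, then fixes the squared norm allowed for the
  orthogonal part, a fraction near \<open>D / s2\<close> of its mean.\<close>

lemma iid_cover_prob_exponent:
  fixes D A :: real
  defines "L \<equiv> ln (s2 / D)"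
  assumes D: "0 < D" "D < s2" and A: "0 \<le> A"
  shows "\<exists>K\<ge>0. \<forall>\<^sub>F n in sequentially. \<forall>x\<in>space (source_n P n). \<bar>T n x\<bar> \<le> A * sqrt (real n * ln (real n)) \<longrightarrow>
       exp (- real n / 2 * L - T n x - K * ln (real n)) \<le> cover_prob (iid_codeword (s2 - D)) D n x \<and>
       cover_prob (iid_codeword (s2 - D)) D n x \<le> exp (- real n / 2 * L - T n x + K * ln (real n))"
proof -
  define s where "s = s2 - D"
  have s: "0 < s" "s < s2" "s2 = s + D" using D by (auto simp: s_def)
  \<comment> \<open>This ensures
    \<open>(1 + \<eta>)\<^sup>2 \<le> 1 + 3 * \<eta> \<le> s2 / D\<close>, hence a tilting parameter
    \<open>r \<le> 1\<close>; \<open>y0\<close> then keeps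
    \<open>\<bar>t\<bar> \<le> \<eta>\<close>.\<close>
  define \<eta> where "\<eta> = min (1 / 2) (s / D / 3)"
  have \<eta>: "0 < \<eta>" "\<eta> \<le> 1 / 2" "3 * \<eta> \<le> s / D" using s D by (auto simp: \<eta>_def)
  define y0 where "y0 = min (1 / 2) (\<eta> * s / D)"
  have y0: "0 < y0" using s D \<eta> by (auto simp: y0_def)
  have L: "0 \<le> L" using D by (simp add: L_def)
  define c1 :: real where "c1 = exp (- 3 / 2) / 3"
  have c1: "0 < c1" by (simp add: c1_def)
  obtain C where C: "0 < C" and window: "\<forall>\<^sub>F m in sequentially. 1 / real m \<le>
     measure (PiM {..<m} (\<lambda>_. gauss 1)) {v \<in> space (PiM {..<m} (\<lambda>_. gauss 1)). (\<Sum>i<m. (v i)\<^sup>2) \<in> {real m - C * ln (real m)..real m}}"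
    using chi_square_window by blast
  \<comment> \<open>\<open>3\<close> collects a bounded term of the exponent and two factors
    \<open>1 / n\<close>. The other terms come from the constant of the normal estimate, the
    quadratic remainder in \<open>t\<close> and the window length.\<close>
  define K where "K = 3 + \<bar>ln (c1 / 3)\<bar> + 4 * A\<^sup>2 * (D / s)\<^sup>2 + C / 2"
  have K: "0 \<le> K" using C by (simp add: K_def)
  \<comment> \<open>Indexing by the orthogonal dimension \<open>m = n - 1\<close> matches the
    chi-square window; the shift is undone at the end.\<close>
  have small: "\<forall>\<^sub>F m in sequentially. \<forall>x. \<bar>T (Suc m) x\<bar> \<le> A * sqrt (real (Suc m) * ln (real (Suc m))) \<longrightarrow>
     \<bar>2 * T (Suc m) x / real (Suc m)\<bar> \<le> y0 \<and> real (Suc m) * (2 * T (Suc m) x / real (Suc m))\<^sup>2 \<le> 4 * A\<^sup>2 * ln (real (Suc m))"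
    using T_small[OF A y0] by (subst eventually_sequentially_Suc)
  have "\<forall>\<^sub>F m in sequentially. s * s2 / (2 * D\<^sup>2) < real m" by real_asymp
  moreover have "\<forall>\<^sub>F m in sequentially. 1 / \<eta> < real m" by real_asymp
  ultimately have "\<forall>\<^sub>F m in sequentially. \<forall>x\<in>space (source_n P (Suc m)). \<bar>T (Suc m) x\<bar> \<le> A * sqrt (real (Suc m) * ln (real (Suc m))) \<longrightarrow>
       exp (- real (Suc m) / 2 * L - T (Suc m) x - K * ln (real (Suc m))) \<le> cover_prob (iid_codeword s) D (Suc m) x \<and>
       cover_prob (iid_codeword s) D (Suc m) x \<le> exp (- real (Suc m) / 2 * L - T (Suc m) x + K * ln (real (Suc m)))"
    using small window eventually_ge_at_top[of 3]
  proof eventually_elim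
    case (elim m)
    show ?case
    proof (intro ballI impI)
      fix x assume Tx: "\<bar>T (Suc m) x\<bar> \<le> A * sqrt (real (Suc m) * ln (real (Suc m)))"
      define n where "n = Suc m"
      have nm: "real n = real m + 1" by (simp add: n_def)
      have m3: "3 \<le> real m" using elim(5) by simp
      define y where "y = 2 * T n x / real n"
      define l where "l = ln (real n)"
      have y: "\<bar>y\<bar> \<le> y0" "real n * y\<^sup>2 \<le> 4 * A\<^sup>2 * l"
        using elim(3) Tx unfolding y_def l_def n_def by auto
      have Ty: "T n x = real n * y / 2" by (simp add: y_def n_def)
      have "ln (exp 1) \<le> ln (real n)" using m3 nm exp_le by (subst ln_le_cancel_iff) auto
      then have l: "1 \<le> l" by (simp add: l_def)
      have yh: "\<bar>y\<bar> \<le> 1 / 2" and ys: "\<bar>y\<bar> \<le> \<eta> * s / D"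
        using y(1) by (auto simp: y0_def)
      have y1: "1 / 2 \<le> 1 + y" "1 + y \<le> 3 / 2" using yh by (auto simp: abs_le_iff)
      define t where "t = D * y / s"
      have t\<eta>: "\<bar>t\<bar> \<le> \<eta>"
      proof -
        have "\<bar>t\<bar> = D / s * \<bar>y\<bar>" using s D by (simp add: t_def abs_mult)
        also have "\<dots> \<le> D / s * (\<eta> * s / D)" using ys s D by (intro mult_left_mono) auto
        also have "\<dots> = \<eta>" using s D by simp
        finally show ?thesis .
      qed
      then have t: "\<bar>t\<bar> \<le> 1 / 2" using \<eta> by linarith
      have upper: "cover_prob (iid_codeword s) D n x \<le> exp (- real n / 2 * L - T n x + K * l)"
      proof -
        have "cover_prob (iid_codeword s) D n x \<le> exp (- real n / 2 * L - T n x)"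
        proof -
          have "s + D = s2" "0 < n" using s(3) by (auto simp: n_def)
          then show ?thesis using iid_cover_prob_le[OF s(1) D(1), of n x] unfolding L_def T_def by (simp only:)
        qed
        also have "\<dots> \<le> exp (- real n / 2 * L - T n x + K * l)" using K l by simp
        finally show ?thesis .
      qed
      \<comment> \<open>\<open>s * (r * m)\<close> is exactly the squared norm allowed for the
        orthogonal part; \<open>n / m\<close> accounts for the missing degree of freedom.\<close>
      define r where "r = real n / real m * (D / s2) * (1 - t)"
      have r0: "0 < r" unfolding r_def using m3 nm D s2_pos t by (intro mult_pos_pos) (auto simp: abs_le_iff)
      have r1: "r \<le> 1"
      proof -
        have "1 / real m \<le> \<eta>" using elim(2) \<eta> m3 by (simp add: field_simps)
        then have "real n / real m \<le> 1 + \<eta>" unfolding nm using m3 by (simp add: add_divide_distrib)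
        then have "r \<le> (1 + \<eta>) * (D / s2) * (1 + \<eta>)"
          unfolding r_def using t\<eta> \<eta> D s2_pos m3 t by (intro mult_mono) (auto simp: abs_le_iff)
        also have "\<dots> = (1 + 2 * \<eta> + \<eta> * \<eta>) * (D / s2)" by (simp add: algebra_simps add_divide_distrib)
        also have "\<dots> \<le> (1 + s / D) * (D / s2)"
        proof (rule mult_right_mono)
          have "\<eta> * \<eta> \<le> \<eta> * 1" using \<eta> by (intro mult_left_mono) auto
          then show "1 + 2 * \<eta> + \<eta> * \<eta> \<le> 1 + s / D" using \<eta>(3) by linarith
        qed (use D s2_pos in simp)
        also have "\<dots> = 1"
        proof -
          have "1 + s / D = s2 / D" using D unfolding s(3) by (simp add: add_divide_distrib)
          then show ?thesis using D s2_pos by simp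
        qed
        finally show ?thesis .
      qed
      define X where "X = (\<Sum>i<Suc m. (x i)\<^sup>2)"
      have X: "X = real n * s2 * (1 + y)" unfolding X_def y_def n_def by (rule sum_squares_eq) simp
      have X0: "0 < X" unfolding X using s2_pos y1 nm m3 by simp
      \<comment> \<open>In units of the standard deviation: \<open>sqrt s * a\<close> is the
        test-channel value \<open>s / s2 * sqrt X\<close>.\<close>
      define a where "a = sqrt s * sqrt X / s2"
      have a: "0 \<le> a" using s s2_pos X0 by (simp add: a_def)
      have sa: "sqrt s * a = s / s2 * sqrt X" using s by (simp add: a_def)
      have Xa: "sqrt X - sqrt s * a = D / s2 * sqrt X"
      proof -
        have "1 - s / s2 = D / s2" using s2_pos s(3) by (simp add: field_simps)
        then show ?thesis unfolding sa by (metis left_diff_distrib mult_1)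
      qed
      \<comment> \<open>Holds once \<open>sqrt X\<close>, of order \<open>sqrt n\<close>, outgrows
        the interval length, which is at most \<open>sqrt s\<close>.\<close>
      have cond1: "sqrt s * (a + 1 / (1 + a)) \<le> 2 * sqrt X - sqrt s * a"
      proof -
        have "s * s2 < real m * (2 * D\<^sup>2)" using elim(1) D by (simp add: field_simps)
        also have "\<dots> \<le> real n * (2 * D\<^sup>2)" using nm by (intro mult_right_mono) auto
        finally have "s * s2 < 2 * real n * D\<^sup>2" by simp
        then have "s < 4 * D\<^sup>2 / s2\<^sup>2 * (real n * s2 * (1 / 2))" using s2_pos by (simp add: field_simps power2_eq_square)
        also have "\<dots> \<le> 4 * D\<^sup>2 / s2\<^sup>2 * X" unfolding X using s2_pos y1 by (intro mult_left_mono) auto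
        finally have "sqrt s \<le> sqrt (4 * D\<^sup>2 / s2\<^sup>2 * X)" by (intro real_sqrt_le_mono) simp
        also have "\<dots> = 2 * (D / s2 * sqrt X)" using D s2_pos by (simp add: real_sqrt_mult real_sqrt_divide)
        finally have 1: "sqrt s \<le> 2 * (sqrt X - sqrt s * a)" unfolding Xa .
        have "sqrt s * (1 / (1 + a)) \<le> sqrt s * 1" using a s by (intro mult_left_mono) auto
        then have "sqrt s * (a + 1 / (1 + a)) \<le> sqrt s * a + sqrt s" by (simp add: distrib_left)
        also have "\<dots> \<le> 2 * sqrt X - sqrt s * a" using 1 by (simp add: algebra_simps)
        finally show ?thesis .
      qed
      have cond2: "s * (r * real m) \<le> real (Suc m) * D - (sqrt X - sqrt s * a)\<^sup>2"
      proof -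
        have "s * (r * real m) = real n * D / s2 * (s * (1 - t))" unfolding r_def using m3 by simp
        also have "s * (1 - t) = s - D * y" using s by (simp add: t_def right_diff_distrib)
        also have "real n * D / s2 * (s - D * y) = real n * D - (D / s2)\<^sup>2 * X"
        proof -
          have "(D / s2)\<^sup>2 * X = real n * D / s2 * (D * (1 + y))" unfolding X using s2_pos by (simp add: power2_eq_square)
          moreover have "real n * D = real n * D / s2 * s2" using s2_pos by simp
          ultimately have "real n * D - (D / s2)\<^sup>2 * X = real n * D / s2 * (s2 - D * (1 + y))"
            by (simp only: right_diff_distrib)
          moreover have "s2 - D * (1 + y) = s - D * y" by (simp add: s(3) algebra_simps)
          ultimately show ?thesis by (simp only:)
        qed
        also have "(D / s2)\<^sup>2 * X = (sqrt X - sqrt s * a)\<^sup>2" unfolding Xa power_mult_distrib using X0 by simp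
        finally show ?thesis by (simp add: n_def)
      qed
      have lm: "0 \<le> ln (real m)" "ln (real m) \<le> l" using m3 nm by (auto simp: l_def)
      define w where "w = C * ln (real m)"
      have w: "0 \<le> w" "w \<le> C * l" using C lm by (auto simp: w_def)
      have chi: "sqrt r ^ m * exp ((1 - r) / 2 * (real m - w)) * (1 / real m)
         \<le> measure (PiM {..<m} (\<lambda>_. gauss 1)) {v \<in> space (PiM {..<m} (\<lambda>_. gauss 1)). (\<Sum>i<m. (v i)\<^sup>2) \<le> r * real m}"
        by (rule chi_square_lower_tail_ge[OF r0 r1 w(1)]) (use elim(4) in \<open>simp add: w_def\<close>)
      have "c1 * (exp (- a\<^sup>2 / 2) / (1 + a)) * (sqrt r ^ m * exp ((1 - r) / 2 * (real m - w)) * (1 / real m))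
         \<le> c1 * (exp (- a\<^sup>2 / 2) / (1 + a)) * measure (PiM {..<m} (\<lambda>_. gauss 1)) {v \<in> space (PiM {..<m} (\<lambda>_. gauss 1)). (\<Sum>i<m. (v i)\<^sup>2) \<le> r * real m}"
        using c1 a by (intro mult_left_mono[OF chi]) auto
      also have "\<dots> \<le> cover_prob (iid_codeword s) D n x"
        unfolding c1_def n_def by (rule iid_cover_prob_ge[OF s(1) a]) (use cond1 cond2 in \<open>simp_all add: X_def\<close>)
      finally have low: "c1 * (exp (- a\<^sup>2 / 2) / (1 + a)) * (sqrt r ^ m * exp ((1 - r) / 2 * (real m - w)) * (1 / real m))
         \<le> cover_prob (iid_codeword s) D n x" .
      define E where "E = - a\<^sup>2 / 2 + real m / 2 * ln r + (1 - r) / 2 * (real m - w)"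
      have Eexp: "exp (- a\<^sup>2 / 2) * (sqrt r ^ m * exp ((1 - r) / 2 * (real m - w))) = exp E"
      proof -
        have "sqrt r = exp (ln r / 2)" using r0 by (simp add: powr_half_sqrt[symmetric] powr_def)
        then have "sqrt r ^ m = exp (real m / 2 * ln r)" by (simp flip: exp_of_nat_mult)
        then show ?thesis unfolding E_def exp_add by (simp add: mult.assoc)
      qed
      have Ege: "- real n / 2 * L - T n x - (1 + 4 * A\<^sup>2 * (D / s)\<^sup>2 + C / 2) * l \<le> E"
      proof -
        have "a\<^sup>2 = s * X / s2\<^sup>2"
          unfolding a_def power_divide power_mult_distrib using s(1) X0 by simp
        then have a2: "a\<^sup>2 = real n * (s * (1 + y) / s2)"
          unfolding X using s2_pos by (simp add: power2_eq_square)
        have rm: "r * real m = real n * (D / s2 * (1 - t))" unfolding r_def using m3 by simp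
        \<comment> \<open>The nonnegative contribution of \<open>n / m\<close> to
          \<open>ln r\<close> is dropped.\<close>
        have lnr: "- L + (- t - 2 * t\<^sup>2) \<le> ln r"
        proof -
          have "ln (p * q * u) = ln p + ln q + ln u" if "0 < p" "0 < q" "0 < u" for p q u :: real
            using that by (simp add: ln_mult)
          from this[of "real n / real m" "D / s2" "1 - t"]
          have "ln r = ln (real n / real m) + ln (D / s2) + ln (1 - t)"
            unfolding r_def using m3 nm D s2_pos t by (simp add: abs_le_iff)
          moreover have "0 \<le> ln (real n / real m)" using m3 nm by simp
          moreover have "ln (D / s2) = - L" unfolding L_def using D s2_pos by (simp add: ln_div)
          moreover have "\<bar>ln (1 + - t) - (- t)\<bar> \<le> 2 * (- t)\<^sup>2" using t by (intro abs_ln_one_plus_x_minus_x_bound) auto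
          ultimately show ?thesis by (simp add: abs_le_iff)
        qed
        have lnr': "real m / 2 * (- L + (- t - 2 * t\<^sup>2)) \<le> real m / 2 * ln r" by (intro mult_left_mono lnr) simp
        \<comment> \<open>The contributions of \<open>a\<^sup>2\<close>, \<open>1 - r\<close> and
          \<open>ln r\<close>, in units of \<open>n / 2\<close>: constants cancel apart from the
          \<open>L\<close> term, and the linear parts combine to \<open>- y\<close>, that is to
          \<open>- T\<close>.\<close>
        have id: "- (s * (1 + y) / s2) + 1 - D / s2 * (1 - t) - t = - y"
        proof -
          have "s2 * (- (s * (1 + y) / s2) + 1 - D / s2 * (1 - t) - t) = - s * (1 + y) + s2 - D * (1 - t) - s2 * t"
            using s2_pos by (simp add: field_simps)
          also have "\<dots> = - s * y - s * t" unfolding s(3) by (simp add: algebra_simps)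
          also have "s * t = D * y" using s by (simp add: t_def)
          also have "- s * y - D * y = s2 * (- y)" unfolding s(3) by (simp add: algebra_simps)
          finally show ?thesis using s2_pos by (simp only: mult_left_cancel[OF less_imp_neq[OF s2_pos, symmetric]])
        qed
        \<comment> \<open>Separates the multiple of \<open>n\<close> from the bounded terms left by
          \<open>m = n - 1\<close> and from the quadratic term.\<close>
        have gen: "- ((M + 1) * p) / 2 + M / 2 * (- L + (- t - 2 * t\<^sup>2)) + (M - (M + 1) * q) / 2
            = (M + 1) / 2 * (- p + 1 - q - t) - (M + 1) / 2 * L + L / 2 - 1 / 2 + t / 2 - M * t\<^sup>2" for M p q
          by (simp add: field_simps)
        have "- a\<^sup>2 / 2 + real m / 2 * (- L + (- t - 2 * t\<^sup>2)) + (real m - r * real m) / 2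
            = real n / 2 * (- (s * (1 + y) / s2) + 1 - D / s2 * (1 - t) - t) - real n / 2 * L + L / 2 - 1 / 2 + t / 2 - real m * t\<^sup>2"
          unfolding a2 rm nm by (rule gen)
        also have "\<dots> = - T n x - real n / 2 * L + L / 2 - 1 / 2 + t / 2 - real m * t\<^sup>2"
          unfolding id Ty by simp
        finally have main: "- a\<^sup>2 / 2 + real m / 2 * (- L + (- t - 2 * t\<^sup>2)) + (real m - r * real m) / 2
            = - T n x - real n / 2 * L + L / 2 - 1 / 2 + t / 2 - real m * t\<^sup>2" .
        have "(1 - r) * w \<le> 1 * w" using r0 w by (intro mult_right_mono) auto
        then have wb: "(1 - r) * w \<le> C * l" using w by linarith
        have mt: "real m * t\<^sup>2 \<le> 4 * A\<^sup>2 * (D / s)\<^sup>2 * l"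
        proof -
          have "real m * t\<^sup>2 \<le> real n * t\<^sup>2" using nm by (intro mult_right_mono) auto
          also have "\<dots> = (D / s)\<^sup>2 * (real n * y\<^sup>2)" by (simp add: t_def power_divide power_mult_distrib)
          also have "\<dots> \<le> (D / s)\<^sup>2 * (4 * A\<^sup>2 * l)" by (intro mult_left_mono y) simp
          finally show ?thesis by (simp add: mult_ac)
        qed
        have "E = - a\<^sup>2 / 2 + real m / 2 * ln r + (real m - r * real m) / 2 - (1 - r) * w / 2"
          unfolding E_def by (simp add: field_simps)
        then have "- T n x - real n / 2 * L + L / 2 - 1 / 2 + t / 2 - real m * t\<^sup>2 - C * l / 2 \<le> E"
          using main lnr' wb by linarith
        moreover have "- 1 / 2 \<le> t" using t by (simp add: abs_le_iff)
        moreover have "(1 + 4 * A\<^sup>2 * (D / s)\<^sup>2 + C / 2) * l = l + 4 * A\<^sup>2 * (D / s)\<^sup>2 * l + C * l / 2" by (simp add: distrib_right)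
        moreover have "- real n / 2 * L = - (real n / 2 * L)" by simp
        ultimately show ?thesis using mt l L by linarith
      qed
      have lower: "exp (- real n / 2 * L - T n x - K * l) \<le> cover_prob (iid_codeword s) D n x"
      proof -
        have "\<bar>ln (c1 / 3)\<bar> * 1 \<le> \<bar>ln (c1 / 3)\<bar> * l" using l by (intro mult_left_mono) auto
        then have "- (\<bar>ln (c1 / 3)\<bar> * l) \<le> ln (c1 / 3)" by (simp add: abs_le_iff)
        moreover have "K * l = (1 + 4 * A\<^sup>2 * (D / s)\<^sup>2 + C / 2) * l + 2 * l + \<bar>ln (c1 / 3)\<bar> * l"
          by (simp add: K_def algebra_simps)
        ultimately have "- real n / 2 * L - T n x - K * l \<le> ln (c1 / 3) + (- l) + (- l) + E" using Ege by linarith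
        then have "exp (- real n / 2 * L - T n x - K * l) \<le> exp (ln (c1 / 3) + (- l) + (- l) + E)" by simp
        also have "\<dots> = c1 / 3 * (1 / real n) * (1 / real n) * exp E"
          unfolding exp_add using c1 m3 nm by (simp add: l_def exp_minus field_simps)
        also have "\<dots> = c1 / (3 * real n) * (1 / real n) * exp E" by simp
        \<comment> \<open>\<open>a\<close> is of order \<open>sqrt n\<close>, so
          \<open>1 + a \<le> 3 * n\<close> is generous, but it costs only a multiple of
          \<open>ln n\<close> in the exponent.\<close>
        also have "\<dots> \<le> c1 / (1 + a) * (1 / real m) * exp E"
        proof (intro mult_right_mono mult_mono)
          have "X \<le> real n * s2 * (3 / 2)" unfolding X using s2_pos y1 by (intro mult_left_mono) auto
          then have "s * X / s2\<^sup>2 \<le> s * (real n * s2 * (3 / 2)) / s2\<^sup>2" using s by (intro divide_right_mono mult_left_mono) auto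
          also have "\<dots> = s / s2 * (3 / 2 * real n)" using s2_pos by (simp add: power2_eq_square)
          also have "\<dots> \<le> 1 * (3 / 2 * real n)" using s s2_pos by (intro mult_right_mono) auto
          also have "\<dots> \<le> (2 * real n)\<^sup>2"
          proof -
            have "real n * 1 \<le> real n * real n" using m3 nm by (intro mult_left_mono) auto
            then show ?thesis by (simp add: power2_eq_square)
          qed
          finally have "a\<^sup>2 \<le> (2 * real n)\<^sup>2" using s X0 by (simp add: a_def power_divide power_mult_distrib)
          then have "a \<le> 2 * real n" by (rule power2_le_imp_le) simp
          then have "1 + a \<le> 3 * real n" using m3 nm by linarith
          then show "c1 / (3 * real n) \<le> c1 / (1 + a)" using c1 a by (intro divide_left_mono) (auto intro!: mult_pos_pos simp: n_def)
          show "1 / real n \<le> 1 / real m" using m3 nm by (intro divide_left_mono) auto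
        qed (use c1 a in auto)
        also have "\<dots> = c1 * (exp (- a\<^sup>2 / 2) / (1 + a)) * (sqrt r ^ m * exp ((1 - r) / 2 * (real m - w)) * (1 / real m))"
          unfolding Eexp[symmetric] by simp
        also note low
        finally show ?thesis .
      qed
      show "exp (- real (Suc m) / 2 * L - T (Suc m) x - K * ln (real (Suc m))) \<le> cover_prob (iid_codeword s) D (Suc m) x \<and>
         cover_prob (iid_codeword s) D (Suc m) x \<le> exp (- real (Suc m) / 2 * L - T (Suc m) x + K * ln (real (Suc m)))"
        using lower upper by (simp add: l_def n_def)
    qed
  qed
  then show ?thesis using K unfolding s_def by (subst (asm) eventually_sequentially_Suc) blast
qed

end

theorem theorem1:
  fixes P :: "real measure" and D eps :: real
  defines "sigma2 \<equiv> \<integral>x. x\<^sup>2 \<partial>P"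
      and "zeta \<equiv> \<integral>x. x ^ 4 \<partial>P"
  assumes "prob_space P"
      and "sets P = sets borel"
      and "integrable P (\<lambda>x. x ^ 4)"
      and "integrable P (\<lambda>x. x ^ 6)"
      and "0 < D" and "D < sigma2"
      and "0 < eps" and "eps < 1"
  shows "((\<lambda>n. ln (real (M_star_sp P sigma2 D eps n)) - real n / 2 * ln (sigma2 / D)
            - sqrt (real n * dispersion sigma2 zeta) * Qinv eps) \<in> O(\<lambda>n. ln (real n)))
      \<and> ((\<lambda>n. ln (real (M_star_iid P sigma2 D eps n)) - real n / 2 * ln (sigma2 / D)
            - sqrt (real n * dispersion sigma2 zeta) * Qinv eps) \<in> O(\<lambda>n. ln (real n)))
      \<and> (second_order_rate (M_star_sp P sigma2 D eps) sigma2 D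
           = ereal (sqrt (dispersion sigma2 zeta) * Qinv eps))
      \<and> (second_order_rate (M_star_iid P sigma2 D eps) sigma2 D
           = ereal (sqrt (dispersion sigma2 zeta) * Qinv eps))
      \<and> ((\<lambda>n. ln (real (M_star_iid P sigma2 D eps n)) / real n) \<longlonglongrightarrow> ln (sigma2 / D) / 2)
      \<and> ((\<lambda>n. ln (real (M_star_sp P sigma2 D eps n)) / real n) \<longlonglongrightarrow> ln (sigma2 / D) / 2)"
proof -
  interpret prob_space P by fact
  interpret memoryless_source P sigma2 zeta
    by unfold_locales (use assms in \<open>auto simp: sigma2_def zeta_def\<close>)
  have L: "0 < ln (sigma2 / D)" using assms by simp
  have s: "0 < sigma2 - D" using assms by simp
  have sp: "(\<lambda>n. ln (real (M_star_sp P sigma2 D eps n)) - real n / 2 * ln (sigma2 / D)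
      - sqrt (real n * dispersion sigma2 zeta) * Qinv eps) \<in> O(\<lambda>n. ln (real n))"
    unfolding M_star_sp_def
    by (rule M_star_asymptotics[OF \<open>0 < eps\<close> \<open>eps < 1\<close> L prob_space_sp_codeword
        cover_prob_measurable[OF prob_space_sp_codeword sets_sp_codeword sets_source]
        sp_cover_prob_exponent[OF \<open>0 < D\<close> \<open>D < sigma2\<close>]])
  have iid: "(\<lambda>n. ln (real (M_star_iid P sigma2 D eps n)) - real n / 2 * ln (sigma2 / D)
      - sqrt (real n * dispersion sigma2 zeta) * Qinv eps) \<in> O(\<lambda>n. ln (real n))"
    unfolding M_star_iid_def
    by (rule M_star_asymptotics[OF \<open>0 < eps\<close> \<open>eps < 1\<close> L prob_space_iid_codeword[OF s]
        cover_prob_measurable[OF prob_space_iid_codeword[OF s] sets_iid_codeword sets_source]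
        iid_cover_prob_exponent[OF \<open>0 < D\<close> \<open>D < sigma2\<close>]])
  show ?thesis
    using sp iid rates_of_log_asymptotics[OF sp] rates_of_log_asymptotics[OF iid] by blast
qed

end
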